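(* Let $[a,b]\subset\mathbb{R}$ be a finite interval, $n\in\mathbb{N}\cup\{0\}$, $m,r\in\mathbb{N}$, $1\leq p\leq\infty$, let $\mathcal{M}$ be a metric space and $\mu_0\in\mathcal{M}$. For every $\mu\in\mathcal{M}$ let $A_{r-\ell}(\cdot,\mu)\in(W_p^n)^{m\times m}$, $\ell\in\{1,\dots,r\}$, and a continuous linear operator $B(\mu)\colon(W_p^{n+r})^m\to\mathbb{C}^{rm}$ be given, and put $$(L(\mu)y)(t):=y^{(r)}(t)+\sum_{\ell=1}^{r}A_{r-\ell}(t,\mu)\,y^{(r-\ell)}(t),\qquad t\in(a,b).$$ Assume: (0) the homogeneous problem $L(\mu_0)y=0$ on $(a,b)$, $B(\mu_0)y=0$ has only the trivial solution in $(W_p^{n+r})^m$; (I) $A_{r-\ell}(\cdot,\mu)\to A_{r-\ell}(\cdot,\mu_0)$ in $(W_p^n)^{m\times m}$ as $\mu\to\mu_0$, for every $\ell\in\{1,\dots,r\}$; (II) $B(\mu)y\to B(\mu_0)y$ in $\mathbb{C}^{rm}$ as $\mu\to\mu_0$, for every $y\in(W_p^{n+r})^m$. Then there exist positive numbers $\varepsilon,\gamma_1,\gamma_2$ such that, for all $\mu\in\mathcal{B}(\mu_0,\varepsilon)$, $$\gamma_1\,\widetilde d_{n,p}(\mu)\leq\big\|y(\cdot;\mu_0)-y(\cdot;\mu)\big\|_{n+r,p}\leq\gamma_2\,\widetilde d_{n,p}(\mu),$$ where $$\widetilde d_{n,p}(\mu):=\big\|L(\mu)y(\cdot;\mu_0)-f(\cdot;\mu)\big\|_{n,p}+\big\|B(\mu)y(\cdot;\mu_0)-c(\mu)\big\|_{\mathbb{C}^{rm}},$$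 and $y(\cdot;\mu)\in(W_p^{n+r})^m$ denotes the solution of $L(\mu)y(\cdot;\mu)=f(\cdot;\mu)$ on $(a,b)$, $B(\mu)y(\cdot;\mu)=c(\mu)$ with right-hand sides $f(\cdot;\mu)\in(W_p^n)^m$, $c(\mu)\in\mathbb{C}^{rm}$ (and likewise for $\mu=\mu_0$). The numbers $\varepsilon,\gamma_1,\gamma_2$ do not depend on $y(\cdot;\mu_0)$ or $y(\cdot;\mu)$ (i.e. they can be chosen uniformly in all right-hand sides).
   Context: For $l\in\mathbb{N}$, $W_p^{l}=W_p^l([a,b];\mathbb{C})$ is the space of $y\in C^{l-1}([a,b];\mathbb{C})$ with $y^{(l-1)}$ absolutely continuous and $y^{(l)}\in L_p[a,b]$, with norm $\|y\|_{l,p}=\sum_{s=0}^{l}\|y^{(s)}\|_p$; $W_p^0:=L_p$. $(W_p^{l})^m$ and $(W_p^l)^{m\times m}$ are the spaces of $\mathbb{C}^m$-valued (column) and $\mathbb{C}^{m\times m}$-valued functions with entries in $W_p^l$, normed by the sum of the norms of the entries (same notation $\|\cdot\|_{l,p}$). A solution is a function in $(W_p^{n+r})^m$ satisfying the differential equation (everywhere on $(a,b)$ if $n\ge1$, almost everywhere if $n=0$) and the boundary condition. $\mathcal{B}(\mu_0,\varepsilon)$ is the ball in $\mathcal{M}$ of centre $\mu_0$ and radius $\varepsilon$. *)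

theory Defs
  imports "HOL-Probability.Essential_Supremum"
begin

text \<open>One-sided at the end points of \<open>[a,b]\<close>; arbitrary values wherever the derivative
  does not exist.\<close>

definition nderiv :: "real \<Rightarrow> real \<Rightarrow> nat \<Rightarrow> (real \<Rightarrow> 'v::real_normed_vector) \<Rightarrow> real \<Rightarrow> 'v" where
  "nderiv a b k y = ((\<lambda>g t. vector_derivative g (at t within {a..b})) ^^ k) y"

definition C_on :: "real \<Rightarrow> real \<Rightarrow> nat \<Rightarrow> (real \<Rightarrow> 'v::real_normed_vector) set" where
  "C_on a b k = {y. (\<forall>j<k. \<forall>t\<in>{a..b}. nderiv a b j y differentiable (at t within {a..b})) \<and>
                    (\<forall>j\<le>k. continuous_on {a..b} (nderiv a b j y))}"

definition abs_continuous_on :: "real \<Rightarrow> real \<Rightarrow> (real \<Rightarrow> 'v::real_normed_vector) \<Rightarrow> bool" where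
  "abs_continuous_on a b f \<longleftrightarrow>
     (\<forall>\<epsilon>>0. \<exists>\<delta>>0. \<forall>I :: (real \<times> real) set.
        finite I \<and> (\<forall>(u, v)\<in>I. a \<le> u \<and> u < v \<and> v \<le> b) \<and>
        pairwise (\<lambda>(u, v) (u', v'). {u<..<v} \<inter> {u'<..<v'} = {}) I \<and>
        (\<Sum>(u, v)\<in>I. v - u) < \<delta>
        \<longrightarrow> (\<Sum>(u, v)\<in>I. norm (f v - f u)) < \<epsilon>)"

text \<open>Elements of \<open>L\<^sub>p[a,b]\<close> are represented by functions, with no quotient by
  almost-everywhere equality.\<close>

definition Lp_on :: "real \<Rightarrow> real \<Rightarrow> ereal \<Rightarrow> (real \<Rightarrow> complex) set" where
  "Lp_on a b p = {f. f \<in> borel_measurable (lebesgue_on {a..b}) \<and>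
     (if p = \<infinity> then esssup (lebesgue_on {a..b}) (\<lambda>t. ereal (cmod (f t))) < \<infinity>
      else integrable (lebesgue_on {a..b}) (\<lambda>t. cmod (f t) powr real_of_ereal p))}"

definition Lp_norm :: "real \<Rightarrow> real \<Rightarrow> ereal \<Rightarrow> (real \<Rightarrow> complex) \<Rightarrow> real" where
  "Lp_norm a b p f =
     (if p = \<infinity> then real_of_ereal (esssup (lebesgue_on {a..b}) (\<lambda>t. ereal (cmod (f t))))
      else (\<integral>t. cmod (f t) powr real_of_ereal p \<partial>(lebesgue_on {a..b})) powr (1 / real_of_ereal p))"

text \<open>The almost-everywhere differentiability below is a consequence of absolute continuity;
  it is spelled out so that the top derivative is visibly not a junk value of
  \<^const>\<open>vector_derivative\<close>.\<close>

fun Sob :: "real \<Rightarrow> real \<Rightarrow> nat \<Rightarrow> ereal \<Rightarrow> (real \<Rightarrow> complex) set" where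
  "Sob a b 0 p = Lp_on a b p"
| "Sob a b (Suc k) p = {y \<in> C_on a b k. abs_continuous_on a b (nderiv a b k y) \<and>
     (AE t in lebesgue_on {a..b}. nderiv a b k y differentiable (at t within {a..b})) \<and>
     nderiv a b (Suc k) y \<in> Lp_on a b p}"

definition Sob_norm :: "real \<Rightarrow> real \<Rightarrow> nat \<Rightarrow> ereal \<Rightarrow> (real \<Rightarrow> complex) \<Rightarrow> real" where
  "Sob_norm a b l p y = (\<Sum>s=0..l. Lp_norm a b p (nderiv a b s y))"

definition vSob :: "real \<Rightarrow> real \<Rightarrow> nat \<Rightarrow> ereal \<Rightarrow> (real \<Rightarrow> complex ^ 'm) set" where
  "vSob a b l p = {y. \<forall>i. (\<lambda>t. y t $ i) \<in> Sob a b l p}"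

definition vSob_norm :: "real \<Rightarrow> real \<Rightarrow> nat \<Rightarrow> ereal \<Rightarrow> (real \<Rightarrow> complex ^ 'm::finite) \<Rightarrow> real" where
  "vSob_norm a b l p y = (\<Sum>i\<in>UNIV. Sob_norm a b l p (\<lambda>t. y t $ i))"

definition mSob :: "real \<Rightarrow> real \<Rightarrow> nat \<Rightarrow> ereal \<Rightarrow> (real \<Rightarrow> complex ^ 'm ^ 'm) set" where
  "mSob a b l p = {X. \<forall>i j. (\<lambda>t. X t $ i $ j) \<in> Sob a b l p}"

definition mSob_norm ::
  "real \<Rightarrow> real \<Rightarrow> nat \<Rightarrow> ereal \<Rightarrow> (real \<Rightarrow> complex ^ 'm::finite ^ 'm) \<Rightarrow> real" where
  "mSob_norm a b l p X = (\<Sum>i\<in>UNIV. \<Sum>j\<in>UNIV. Sob_norm a b l p (\<lambda>t. X t $ i $ j))"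

text \<open>Continuity with respect to the seminorm forces \<open>B y\<close> to depend only on the restriction
  of \<open>y\<close> to \<open>[a,b]\<close>.\<close>

definition cont_linear_op ::
  "real \<Rightarrow> real \<Rightarrow> nat \<Rightarrow> ereal \<Rightarrow> ((real \<Rightarrow> complex ^ 'm::finite) \<Rightarrow> complex ^ 'k::finite) \<Rightarrow> bool" where
  "cont_linear_op a b l p B \<longleftrightarrow>
     (\<forall>y\<in>vSob a b l p. \<forall>z\<in>vSob a b l p. B (\<lambda>t. y t + z t) = B y + B z) \<and>
     (\<forall>\<alpha>. \<forall>y\<in>vSob a b l p. B (\<lambda>t. \<alpha> *s y t) = \<alpha> *s B y) \<and>
     (\<forall>y\<in>vSob a b l p. \<forall>\<epsilon>>0. \<exists>\<delta>>0. \<forall>z\<in>vSob a b l p.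
        vSob_norm a b l p (\<lambda>t. z t - y t) < \<delta> \<longrightarrow> norm (B z - B y) < \<epsilon>)"

definition diff_op ::
  "real \<Rightarrow> real \<Rightarrow> nat \<Rightarrow> (nat \<Rightarrow> real \<Rightarrow> complex ^ 'm ^ 'm) \<Rightarrow>
   (real \<Rightarrow> complex ^ 'm::finite) \<Rightarrow> real \<Rightarrow> complex ^ 'm" where
  "diff_op a b r A y t = nderiv a b r y t + (\<Sum>l=1..r. A (r - l) t *v nderiv a b (r - l) y t)"

definition is_solution ::
  "real \<Rightarrow> real \<Rightarrow> nat \<Rightarrow> nat \<Rightarrow> ereal \<Rightarrow> (nat \<Rightarrow> real \<Rightarrow> complex ^ 'm ^ 'm) \<Rightarrow>
   ((real \<Rightarrow> complex ^ 'm::finite) \<Rightarrow> complex ^ 'k::finite) \<Rightarrow>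
   (real \<Rightarrow> complex ^ 'm) \<Rightarrow> complex ^ 'k \<Rightarrow> (real \<Rightarrow> complex ^ 'm) \<Rightarrow> bool" where
  "is_solution a b n r p A B f c y \<longleftrightarrow>
     y \<in> vSob a b (n + r) p \<and>
     (if n \<ge> 1 then \<forall>t\<in>{a<..<b}. diff_op a b r A y t = f t
      else AE t in lebesgue_on {a<..<b}. diff_op a b r A y t = f t) \<and>
     B y = c"

end

theory Submission
  imports Defs
begin

text \<open>Both problems are linear, so with \<open>w = y(\<mu>0) - y(\<mu>)\<close> the quantity in question is
  \<open>\<parallel>L(\<mu>)w\<parallel> + \<parallel>B(\<mu>)w\<parallel>\<close>, and the claim is that \<open>(L(\<mu>), B(\<mu>))\<close> is bounded from above and from below
  uniformly for \<open>\<mu>\<close> near \<open>\<mu>0\<close>. The upper bound is the product estimate in Sobolev spaces for \<open>L(\<mu>)\<close> and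
  the uniform boundedness principle for \<open>B(\<mu>)\<close>.

  The lower bound is a compactness argument. If it fails, there are \<open>\<mu>\<^sub>k \<rightarrow> \<mu>0\<close> and normalised \<open>w\<^sub>k\<close> with
  \<open>L(\<mu>\<^sub>k)w\<^sub>k \<rightarrow> 0\<close> and \<open>B(\<mu>\<^sub>k)w\<^sub>k \<rightarrow> 0\<close>, hence \<open>L(\<mu>0)w\<^sub>k \<rightarrow> 0\<close>. The Cauchy data of \<open>w\<^sub>k\<close> at \<open>a\<close> are
  bounded in a finite-dimensional space, so a subsequence of them converges. By Gronwall's inequality and
  bootstrapping, the norm of \<open>w\<close> is controlled by its Cauchy data and \<open>\<parallel>L(\<mu>0)w\<parallel>\<close>, so this subsequence is
  Cauchy. Its limit is a normalised solution of the homogeneous problem, a contradiction. No existence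
  theorem for the Cauchy problem is needed.\<close>

section \<open>Lebesgue spaces on an interval\<close>

text \<open>Three facts shape the work. A derivative of top order exists only almost everywhere and
  has arbitrary values elsewhere; Sobolev functions are therefore handled through the relation
  \<open>primitive\<close>, which mentions no derivative and passes to limits. The space W_p^0 is in
  general not an algebra, so products are estimated with one more order on the solution; this order
  is available because only derivatives of order below r meet a coefficient. Finally, p = 1 and p =
  \<infinity> are included, so neither reflexivity nor weak compactness can supply limits:
  compactness is that of the r * m Cauchy data alone, and the a priori estimate turns convergence of
  these numbers into convergence in the full norm, which keeps the normalisation in the limit. One
  problem remains for the boundary operators: in B(mu_k) w_k both factors move, and pointwise
  convergence of B(mu_k) is enough only together with a bound uniform in k. Hence the uniform
  boundedness principle serves the lower estimate as well as the upper one.\<close>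

text \<open>Completeness of Lebesgue measure; extension by zero transfers the question from
  \<open>S\<close> to the whole line.\<close>

lemma borel_measurable_lebesgue_on_AE:
  fixes f g :: "real \<Rightarrow> complex"
  assumes f: "f \<in> borel_measurable (lebesgue_on S)" and S: "S \<in> sets lebesgue"
    and ae: "AE t in lebesgue_on S. f t = g t"
  shows "g \<in> borel_measurable (lebesgue_on S)"
proof -
  have "(\<lambda>t. if t \<in> S then f t else 0) \<in> borel_measurable lebesgue"
    using f S by (rule borel_measurable_if_I)
  moreover have "AE t in lebesgue. (if t \<in> S then f t else 0) = (if t \<in> S then g t else 0)"
    using ae S by (auto simp: AE_restrict_space_iff)
  ultimately have "(\<lambda>t. if t \<in> S then g t else 0) \<in> borel_measurable lebesgue"
    by (rule borel_measurable_AE)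
  then show ?thesis using S
    by (simp add: borel_measurable_if)
qed

text \<open>Convexity of the power function, for Minkowski's inequality. If one argument vanishes,
  the claim reduces to \<open>s powr q \<le> s\<close> for 0 < s < 1 and q at least 1.\<close>

lemma powr_convex_comb:
  fixes u v s q :: real
  assumes "1 \<le> q" "0 \<le> u" "0 \<le> v" "0 < s" "s < 1"
  shows "(s * u + (1 - s) * v) powr q \<le> s * u powr q + (1 - s) * v powr q"
proof -
  have aux: "(s * w) powr q \<le> s * w powr q" if "0 < s" "s < 1" "0 \<le> w" for s w :: real
  proof -
    have "s powr q \<le> s powr 1" using that assms by (intro powr_mono') auto
    then show ?thesis using that by (auto simp: powr_mult intro: mult_right_mono)
  qed
  consider "u = 0" | "v = 0" | "u > 0" "v > 0" using assms by linarith
  then show ?thesis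
  proof cases
    case 1 then show ?thesis using aux[of "1 - s" v] assms by auto
  next
    case 2 then show ?thesis using aux[of "s" u] assms by auto
  next
    case 3
    then show ?thesis
      using convex_onD[OF powr_convex[OF \<open>1 \<le> q\<close>], of "1 - s" u v] assms by auto
  qed
qed

locale lp_interval =
  fixes a b :: real and p :: ereal
  assumes ab: "a < b" and p1: "1 \<le> p"
begin

abbreviation I :: "real set" where "I \<equiv> {a..b}"
abbreviation M :: "real measure" where "M \<equiv> lebesgue_on {a..b}"
text \<open>For p = \<infinity> this is the default value 0; the bound 1 \<le> q is available for
  finite p only.\<close>

abbreviation q :: real where "q \<equiv> real_of_ereal p"
abbreviation LP :: "(real \<Rightarrow> complex) set" where "LP \<equiv> Lp_on a b p"
abbreviation nrm :: "(real \<Rightarrow> complex) \<Rightarrow> real" where "nrm \<equiv> Lp_norm a b p"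

sublocale M: finite_measure M
  by (rule finite_measureI) (simp add: emeasure_restrict_space emeasure_lborel_Icc_eq)

lemma emeasure_M: "emeasure M (space M) = ennreal (b - a)"
  using ab by (simp add: emeasure_restrict_space)

lemma measure_M: "measure M (space M) = b - a"
  using emeasure_M ab by (simp add: measure_def)

lemma q1: "p \<noteq> \<infinity> \<Longrightarrow> 1 \<le> q"
  using p1 by (cases p) auto

lemma Lp_measurable: "f \<in> LP \<Longrightarrow> f \<in> borel_measurable M"
  by (simp add: Lp_on_def)

text \<open>No membership in the space is assumed: the essential supremum of a nonmeasurable
  function is the top value. For measurable functions, comparison with the constant 0 works because
  the interval has positive measure.\<close>

lemma Lp_norm_nonneg: "0 \<le> nrm f"
proof (cases "p = \<infinity>")
  case True
  have "0 \<le> esssup M (\<lambda>t. ereal (cmod (f t)))"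
  proof (cases "(\<lambda>t. ereal (cmod (f t))) \<in> borel_measurable M")
    case True
    have "esssup M (\<lambda>t. (0::ereal)) \<le> esssup M (\<lambda>t. ereal (cmod (f t)))"
      by (rule esssup_mono) auto
    then show ?thesis using esssup_const[of M "0::ereal"] emeasure_M ab by simp
  qed (simp add: esssup_non_measurable)
  then show ?thesis using True by (simp add: Lp_norm_def real_of_ereal_pos)
qed (simp add: Lp_norm_def)

text \<open>Membership and norm bound are characterised jointly, here and for finite p, so that
  later proofs split on p once and obtain both from a single estimate.\<close>

lemma Lp_inf_iff:
  assumes "p = \<infinity>" "0 \<le> c"
  shows "f \<in> LP \<and> nrm f \<le> c \<longleftrightarrow> f \<in> borel_measurable M \<and> (AE t in M. cmod (f t) \<le> c)"
proof -
  let ?e = "esssup M (\<lambda>t. ereal (cmod (f t)))"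
  { assume f[measurable]: "f \<in> borel_measurable M"
    have "esssup M (\<lambda>t. (0::ereal)) \<le> ?e"
      by (rule esssup_mono) auto
    then have "0 \<le> ?e" using esssup_const[of M "0::ereal"] emeasure_M ab by simp
    then have "?e < \<infinity> \<and> real_of_ereal ?e \<le> c \<longleftrightarrow> ?e \<le> ereal c"
      by (cases ?e) auto
    also have "\<dots> \<longleftrightarrow> (AE t in M. cmod (f t) \<le> c)"
    proof
      assume "?e \<le> ereal c"
      with esssup_AE[of "\<lambda>t. ereal (cmod (f t))" M] show "AE t in M. cmod (f t) \<le> c"
        by (auto elim!: eventually_mono dest: order_trans)
    qed (auto intro: esssup_I)
    finally have "?e < \<infinity> \<and> real_of_ereal ?e \<le> c \<longleftrightarrow> (AE t in M. cmod (f t) \<le> c)" . }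
  then show ?thesis using assms by (auto simp: Lp_on_def Lp_norm_def)
qed

text \<open>The nonnegative integral carries integrability with it: a finite bound already makes the
  q-th power integrable.\<close>

lemma Lp_fin_iff:
  assumes "p \<noteq> \<infinity>" "0 \<le> c"
  shows "f \<in> LP \<and> nrm f \<le> c \<longleftrightarrow>
    f \<in> borel_measurable M \<and> (\<integral>\<^sup>+t. ennreal (cmod (f t) powr q) \<partial>M) \<le> ennreal (c powr q)"
    (is "_ \<longleftrightarrow> _ \<and> ?J \<le> _")
proof -
  have q: "1 \<le> q" using q1 assms by auto
  { assume f[measurable]: "f \<in> borel_measurable M"
    assume int: "integrable M (\<lambda>t. cmod (f t) powr q)"
    let ?i = "\<integral>t. cmod (f t) powr q \<partial>M"
    have i0: "0 \<le> ?i" by simp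
    have "?J = ennreal ?i" by (rule nn_integral_eq_integral[OF int]) simp
    moreover have "?i powr (1/q) \<le> c \<longleftrightarrow> ?i \<le> c powr q"
    proof
      assume "?i powr (1/q) \<le> c"
      then have "(?i powr (1/q)) powr q \<le> c powr q" using q by (intro powr_mono2) auto
      then show "?i \<le> c powr q" using q i0 by (simp add: powr_powr)
    next
      assume "?i \<le> c powr q"
      then have "?i powr (1/q) \<le> (c powr q) powr (1/q)" using q i0 by (intro powr_mono2) auto
      then show "?i powr (1/q) \<le> c" using q assms by (simp add: powr_powr)
    qed
    ultimately have "?i powr (1/q) \<le> c \<longleftrightarrow> ?J \<le> ennreal (c powr q)" by simp }
  moreover
  { assume f[measurable]: "f \<in> borel_measurable M" and "?J \<le> ennreal (c powr q)"
    then have "integrable M (\<lambda>t. cmod (f t) powr q)"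
      by (intro integrableI_bounded) (auto intro: le_less_trans) }
  ultimately show ?thesis using assms by (auto simp: Lp_on_def Lp_norm_def)
qed

lemma Lp_mono:
  assumes g: "g \<in> LP" and f: "f \<in> borel_measurable M" and K: "0 \<le> K"
    and le: "AE t in M. cmod (f t) \<le> K * cmod (g t)"
  shows "f \<in> LP" "nrm f \<le> K * nrm g"
proof -
  have c: "0 \<le> K * nrm g" using K Lp_norm_nonneg by simp
  have "f \<in> LP \<and> nrm f \<le> K * nrm g"
  proof (cases "p = \<infinity>")
    case True
    have "AE t in M. cmod (g t) \<le> nrm g"
      using Lp_inf_iff[OF True Lp_norm_nonneg] g by blast
    with le have "AE t in M. cmod (f t) \<le> K * nrm g"
      by eventually_elim (use K in \<open>auto intro: order_trans mult_left_mono\<close>)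
    then show ?thesis using Lp_inf_iff[OF True c] f by blast
  next
    case False
    have [measurable]: "g \<in> borel_measurable M" "f \<in> borel_measurable M"
      using g f by (auto simp: Lp_on_def)
    have q: "1 \<le> q" using q1 False by auto
    have "(\<integral>\<^sup>+t. ennreal (cmod (f t) powr q) \<partial>M)
        \<le> (\<integral>\<^sup>+t. ennreal (K powr q) * ennreal (cmod (g t) powr q) \<partial>M)"
    proof (rule nn_integral_mono_AE)
      show "AE t in M. ennreal (cmod (f t) powr q) \<le> ennreal (K powr q) * ennreal (cmod (g t) powr q)"
        using le
      proof eventually_elim
        case (elim t)
        then have "cmod (f t) powr q \<le> (K * cmod (g t)) powr q"
          using q by (intro powr_mono2) auto
        then show ?case using K by (auto simp: powr_mult ennreal_mult[symmetric] intro: ennreal_leI)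
      qed
    qed
    also have "\<dots> = ennreal (K powr q) * (\<integral>\<^sup>+t. ennreal (cmod (g t) powr q) \<partial>M)"
      by (rule nn_integral_cmult) measurable
    also have "\<dots> \<le> ennreal (K powr q) * ennreal (nrm g powr q)"
      using Lp_fin_iff[OF False Lp_norm_nonneg, of g g] g by (intro mult_left_mono) auto
    also have "\<dots> = ennreal ((K * nrm g) powr q)"
      using K Lp_norm_nonneg by (simp add: powr_mult ennreal_mult)
    finally show ?thesis using Lp_fin_iff[OF False c] f by blast
  qed
  then show "f \<in> LP" "nrm f \<le> K * nrm g" by auto
qed

lemma Lp_cong_AE:
  assumes f: "f \<in> LP" and ae: "AE t in M. f t = g t"
  shows "g \<in> LP" "nrm g = nrm f"
proof -
  have m: "g \<in> borel_measurable M"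
    using borel_measurable_lebesgue_on_AE[OF Lp_measurable[OF f] _ ae] by simp
  show g: "g \<in> LP"
    by (rule Lp_mono(1)[OF f m, of 1]) (use ae in auto)
  have "nrm g \<le> 1 * nrm f"
    by (rule Lp_mono(2)[OF f m, of 1]) (use ae in auto)
  moreover have "nrm f \<le> 1 * nrm g"
    by (rule Lp_mono(2)[OF g Lp_measurable[OF f], of 1]) (use ae in auto)
  ultimately show "nrm g = nrm f" by simp
qed

lemma AE_M_I: "(\<And>t. t \<in> I \<Longrightarrow> P t) \<Longrightarrow> AE t in M. P t"
  by (rule AE_I2) simp

text \<open>In contrast to the almost-everywhere version, the norms agree without any membership:
  the essential supremum and the integral see only the values on the interval, also when they return
  default values.\<close>

lemma Lp_cong:
  assumes "\<And>t. t \<in> I \<Longrightarrow> f t = g t"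
  shows "f \<in> LP \<longleftrightarrow> g \<in> LP" "nrm f = nrm g"
proof -
  have fg: "AE t in M. f t = g t" "AE t in M. g t = f t" using assms by (auto intro!: AE_M_I)
  show "f \<in> LP \<longleftrightarrow> g \<in> LP" using Lp_cong_AE(1) fg by blast
  have "(\<lambda>t. ereal (cmod (f t))) \<in> borel_measurable M \<longleftrightarrow> (\<lambda>t. ereal (cmod (g t))) \<in> borel_measurable M"
    using assms by (intro measurable_cong) auto
  then have "esssup M (\<lambda>t. ereal (cmod (f t))) = esssup M (\<lambda>t. ereal (cmod (g t)))"
    using fg by (auto simp: esssup_def intro!: Limsup_eq)
  moreover have "(\<integral>t. cmod (f t) powr q \<partial>M) = (\<integral>t. cmod (g t) powr q \<partial>M)"
    using assms by (intro Bochner_Integration.integral_cong) auto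
  ultimately show "nrm f = nrm g" by (simp add: Lp_norm_def)
qed

text \<open>Equality follows from the inequality for all factors, applied once to \<open>c\<close>
  and once to \<open>1/c\<close>.\<close>

lemma Lp_scale:
  assumes "f \<in> LP"
  shows "(\<lambda>t. c * f t) \<in> LP" "nrm (\<lambda>t. c * f t) = cmod c * nrm f"
proof -
  have m[measurable]: "f \<in> borel_measurable M" using assms by (rule Lp_measurable)
  have *: "(\<lambda>t. c * f t) \<in> LP \<and> nrm (\<lambda>t. c * f t) \<le> cmod c * nrm f" if "f \<in> LP" for c f
  proof -
    have [measurable]: "f \<in> borel_measurable M" using that by (rule Lp_measurable)
    show ?thesis
      using Lp_mono[OF that, of "\<lambda>t. c * f t" "cmod c"] by (auto simp: norm_mult)
  qed
  show "(\<lambda>t. c * f t) \<in> LP" using * assms by auto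
  show "nrm (\<lambda>t. c * f t) = cmod c * nrm f"
  proof (cases "c = 0")
    case True
    then show ?thesis using *[OF assms, of 0] Lp_norm_nonneg[of "\<lambda>t. 0"] by simp
  next
    case False
    then have "nrm f \<le> cmod (1/c) * nrm (\<lambda>t. c * f t)"
      using *[of "\<lambda>t. c * f t" "1/c"] * assms by simp
    then have "cmod c * nrm f \<le> nrm (\<lambda>t. c * f t)"
      using False by (simp add: norm_divide field_simps)
    then show ?thesis using *[OF assms, of c] by simp
  qed
qed

text \<open>Minkowski's inequality by convexity, without Hoelder. Working with strict positive upper
  bounds \<open>\<alpha>\<close> and \<open>\<beta>\<close> of the norms avoids division by zero;
  they are lowered to the norms at the end.\<close>

lemma Lp_add:
  assumes f: "f \<in> LP" and g: "g \<in> LP"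
  shows "(\<lambda>t. f t + g t) \<in> LP" "nrm (\<lambda>t. f t + g t) \<le> nrm f + nrm g"
proof -
  have m[measurable]: "f \<in> borel_measurable M" "g \<in> borel_measurable M"
    using f g by (auto simp: Lp_on_def)
  have *: "(\<lambda>t. f t + g t) \<in> LP \<and> nrm (\<lambda>t. f t + g t) \<le> \<alpha> + \<beta>"
    if \<alpha>: "nrm f \<le> \<alpha>" "0 < \<alpha>" and \<beta>: "nrm g \<le> \<beta>" "0 < \<beta>" for \<alpha> \<beta>
  proof (cases "p = \<infinity>")
    case True
    have "AE t in M. cmod (f t) \<le> \<alpha>" "AE t in M. cmod (g t) \<le> \<beta>"
      using Lp_inf_iff[OF True] f g \<alpha> \<beta> by (meson less_imp_le)+
    then have "AE t in M. cmod (f t + g t) \<le> \<alpha> + \<beta>"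
      by eventually_elim (meson add_mono norm_triangle_le)
    then show ?thesis using Lp_inf_iff[OF True, of "\<alpha> + \<beta>"] \<alpha> \<beta> by auto
  next
    case False
    have q: "1 \<le> q" using q1 False by auto
    \<comment> \<open>With this weight \<open>f + g\<close> is \<alpha> + \<beta> times a convex
      combination of \<open>f / \<alpha>\<close> and \<open>g / \<beta>\<close>, whose q-th powers
      have integral at most 1.\<close>
    define l where "l = \<alpha> / (\<alpha> + \<beta>)"
    have l: "0 < l" "l < 1" "1 - l = \<beta> / (\<alpha> + \<beta>)" using \<alpha> \<beta> by (auto simp: l_def field_simps)
    define F where "F = (\<lambda>t. ennreal (cmod (f t) powr q))"
    define G where "G = (\<lambda>t. ennreal (cmod (g t) powr q))"
    define A where "A = ennreal ((\<alpha> + \<beta>) powr q * l / \<alpha> powr q)"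
    define B where "B = ennreal ((\<alpha> + \<beta>) powr q * (1 - l) / \<beta> powr q)"
    have [measurable]: "F \<in> borel_measurable M" "G \<in> borel_measurable M" by (auto simp: F_def G_def)
    have FG: "integral\<^sup>N M F \<le> ennreal (\<alpha> powr q)" "integral\<^sup>N M G \<le> ennreal (\<beta> powr q)"
      using Lp_fin_iff[OF False] f g \<alpha> \<beta> unfolding F_def G_def by (meson less_imp_le)+
    have pt: "ennreal (cmod (f t + g t) powr q) \<le> A * F t + B * G t" for t
    proof -
      have "cmod (f t + g t) \<le> (\<alpha> + \<beta>) * (l * (cmod (f t) / \<alpha>) + (1 - l) * (cmod (g t) / \<beta>))"
      proof -
        have "(\<alpha> + \<beta>) * (l * (cmod (f t) / \<alpha>) + (1 - l) * (cmod (g t) / \<beta>)) = cmod (f t) + cmod (g t)"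
        proof -
          have "(\<alpha> + \<beta>) * l = \<alpha>" "(\<alpha> + \<beta>) * (1 - l) = \<beta>"
            unfolding l(3) using \<alpha> \<beta> by (simp_all add: l_def)
          then have "(\<alpha> + \<beta>) * (l * (x / \<alpha>) + (1 - l) * (y / \<beta>)) = \<alpha> * (x / \<alpha>) + \<beta> * (y / \<beta>)" for x y
            by (metis distrib_left mult.assoc)
          then show ?thesis using \<alpha> \<beta> by simp
        qed
        then show ?thesis using norm_triangle_ineq by metis
      qed
      then have "cmod (f t + g t) powr q \<le>
          ((\<alpha> + \<beta>) * (l * (cmod (f t) / \<alpha>) + (1 - l) * (cmod (g t) / \<beta>))) powr q"
        using q by (intro powr_mono2) auto
      also have "\<dots> = (\<alpha> + \<beta>) powr q * (l * (cmod (f t) / \<alpha>) + (1 - l) * (cmod (g t) / \<beta>)) powr q"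
        by (rule powr_mult)
      also have "\<dots> \<le> (\<alpha> + \<beta>) powr q * (l * (cmod (f t) / \<alpha>) powr q + (1 - l) * (cmod (g t) / \<beta>) powr q)"
        using \<alpha> \<beta> l q by (intro mult_left_mono powr_convex_comb) auto
      also have "\<dots> = (\<alpha> + \<beta>) powr q * l / \<alpha> powr q * cmod (f t) powr q
                     + (\<alpha> + \<beta>) powr q * (1 - l) / \<beta> powr q * cmod (g t) powr q"
        using \<alpha> \<beta> by (simp add: powr_divide algebra_simps)
      finally have "ennreal (cmod (f t + g t) powr q) \<le> ennreal \<dots>" by (rule ennreal_leI)
      also have "\<dots> = A * F t + B * G t"
        unfolding A_def B_def F_def G_def using \<alpha> \<beta> l
        by (subst ennreal_plus) (auto simp: ennreal_mult'[symmetric])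
      finally show ?thesis .
    qed
    have "(\<integral>\<^sup>+t. ennreal (cmod (f t + g t) powr q) \<partial>M) \<le> (\<integral>\<^sup>+t. A * F t + B * G t \<partial>M)"
      by (intro nn_integral_mono pt)
    also have "\<dots> = A * integral\<^sup>N M F + B * integral\<^sup>N M G"
      by (simp add: nn_integral_add nn_integral_cmult)
    also have "\<dots> \<le> A * ennreal (\<alpha> powr q) + B * ennreal (\<beta> powr q)"
      by (intro add_mono mult_left_mono FG) auto
    also have "\<dots> = ennreal ((\<alpha> + \<beta>) powr q * l + (\<alpha> + \<beta>) powr q * (1 - l))"
      unfolding A_def B_def using \<alpha> \<beta> l by (subst ennreal_plus) (auto simp: ennreal_mult'[symmetric])
    also have "\<dots> = ennreal ((\<alpha> + \<beta>) powr q)" by (simp add: algebra_simps)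
    finally show ?thesis using Lp_fin_iff[OF False, of "\<alpha> + \<beta>"] \<alpha> \<beta> by auto
  qed
  show "(\<lambda>t. f t + g t) \<in> LP"
    using *[of "nrm f + 1" "nrm g + 1"] Lp_norm_nonneg[of f] Lp_norm_nonneg[of g] by auto
  show "nrm (\<lambda>t. f t + g t) \<le> nrm f + nrm g"
  proof (rule field_le_epsilon)
    fix e :: real assume "0 < e"
    then show "nrm (\<lambda>t. f t + g t) \<le> nrm f + nrm g + e"
      using *[of "nrm f + e/2" "nrm g + e/2"] Lp_norm_nonneg[of f] Lp_norm_nonneg[of g] by auto
  qed
qed

text \<open>The factor b - a + 1 serves every p: it dominates the L_p norm (b - a)^(1/p) of the
  constant 1 for finite p, and the value 1 for p = \<infinity>.\<close>

lemma Lp_bounded: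
  assumes f: "f \<in> borel_measurable M" and K: "0 \<le> K" "AE t in M. cmod (f t) \<le> K"
  shows "f \<in> LP" "nrm f \<le> K * (b - a + 1)"
proof -
  have 1: "f \<in> LP \<and> nrm f \<le> K * (b - a + 1)"
  proof (cases "p = \<infinity>")
    case True
    have "K \<le> K * (b - a + 1)" using K ab by (simp add: mult_le_cancel_left1)
    then show ?thesis using Lp_inf_iff[OF True K(1)] f K by (meson order_trans)
  next
    case False
    have q: "1 \<le> q" using q1 False by auto
    have "(\<integral>\<^sup>+t. ennreal (cmod (f t) powr q) \<partial>M) \<le> (\<integral>\<^sup>+t. ennreal (K powr q) \<partial>M)"
      using K(2) by (intro nn_integral_mono_AE) (auto elim!: eventually_mono intro!: ennreal_leI powr_mono2 simp: q1[OF False] order_trans[OF _ q])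
    also have "\<dots> = ennreal (K powr q * (b - a))"
      using emeasure_M ab by (simp add: ennreal_mult)
    also have "\<dots> \<le> ennreal ((K * (b - a + 1)) powr q)"
    proof (rule ennreal_leI)
      have "b - a \<le> (b - a + 1) powr 1" using ab by simp
      also have "\<dots> \<le> (b - a + 1) powr q" using ab q by (intro powr_mono) auto
      finally show "K powr q * (b - a) \<le> (K * (b - a + 1)) powr q"
        using K ab by (auto simp: powr_mult intro: mult_left_mono)
    qed
    finally show ?thesis using Lp_fin_iff[OF False, of "K * (b - a + 1)"] f K ab by auto
  qed
  then show "f \<in> LP" "nrm f \<le> K * (b - a + 1)" by auto
qed

text \<open>The inclusion of L_p in L_1 on a finite interval. In the constant, b - a comes from the
  part where the function is below its norm, and 1 from the part above it.\<close>

lemma Lp_integrable: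
  assumes f: "f \<in> LP"
  shows "integrable M f" "(\<integral>t. cmod (f t) \<partial>M) \<le> (b - a + 1) * nrm f"
proof -
  have [measurable]: "f \<in> borel_measurable M" using f by (rule Lp_measurable)
  have *: "integrable M f \<and> (\<integral>t. cmod (f t) \<partial>M) \<le> (b - a + 1) * \<alpha>" if \<alpha>: "nrm f \<le> \<alpha>" "0 < \<alpha>" for \<alpha>
  proof -
    have "(\<integral>\<^sup>+t. ennreal (cmod (f t)) \<partial>M) \<le> ennreal ((b - a + 1) * \<alpha>)"
    proof (cases "p = \<infinity>")
      case True
      have "AE t in M. cmod (f t) \<le> \<alpha>" using Lp_inf_iff[OF True] f \<alpha> by (meson less_imp_le)
      then have "(\<integral>\<^sup>+t. ennreal (cmod (f t)) \<partial>M) \<le> (\<integral>\<^sup>+t. ennreal \<alpha> \<partial>M)"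
        by (intro nn_integral_mono_AE) (auto elim!: eventually_mono intro: ennreal_leI)
      also have "\<dots> \<le> ennreal ((b - a + 1) * \<alpha>)"
        using emeasure_M ab \<alpha> by (auto simp: ennreal_mult'[symmetric] field_simps intro: ennreal_leI)
      finally show ?thesis .
    next
      case False
      have q: "1 \<le> q" using q1 False by auto
      \<comment> \<open>This pointwise bound replaces Hoelder's inequality: where |f| exceeds
        \<alpha>, the quotient |f| / \<alpha> is above 1 and hence at most its q-th power.\<close>
      have pt: "cmod (f t) \<le> \<alpha> + \<alpha> / \<alpha> powr q * cmod (f t) powr q" for t
      proof (cases "cmod (f t) \<le> \<alpha>")
        case True then show ?thesis using \<alpha> by (simp add: add_increasing2)
      next
        case False
        then have "(cmod (f t) / \<alpha>) powr 1 \<le> (cmod (f t) / \<alpha>) powr q"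
          using \<alpha> q by (intro powr_mono) auto
        then have "cmod (f t) / \<alpha> \<le> cmod (f t) powr q / \<alpha> powr q"
          using False \<alpha> by (simp add: powr_divide)
        then show ?thesis using \<alpha> by (simp add: field_simps) (smt (verit) mult_pos_pos powr_gt_zero)
      qed
      have "(\<integral>\<^sup>+t. ennreal (cmod (f t)) \<partial>M) \<le>
          (\<integral>\<^sup>+t. ennreal \<alpha> + ennreal (\<alpha> / \<alpha> powr q) * ennreal (cmod (f t) powr q) \<partial>M)"
      proof (intro nn_integral_mono)
        fix t
        have "ennreal (cmod (f t)) \<le> ennreal (\<alpha> + \<alpha> / \<alpha> powr q * cmod (f t) powr q)"
          by (intro ennreal_leI pt)
        then show "ennreal (cmod (f t)) \<le> ennreal \<alpha> + ennreal (\<alpha> / \<alpha> powr q) * ennreal (cmod (f t) powr q)"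
          using \<alpha> by (subst (asm) ennreal_plus) (auto simp: ennreal_mult'[symmetric])
      qed
      also have "\<dots> = ennreal (\<alpha> * (b - a)) + ennreal (\<alpha> / \<alpha> powr q) * (\<integral>\<^sup>+t. ennreal (cmod (f t) powr q) \<partial>M)"
        using emeasure_M \<alpha> ab by (simp add: nn_integral_add nn_integral_cmult ennreal_mult)
      also have "\<dots> \<le> ennreal (\<alpha> * (b - a)) + ennreal (\<alpha> / \<alpha> powr q) * ennreal (\<alpha> powr q)"
        using Lp_fin_iff[OF False] f \<alpha> by (intro add_mono mult_left_mono) (auto intro: less_imp_le)
      also have "\<dots> = ennreal ((b - a + 1) * \<alpha>)"
        using ab \<alpha> by (simp add: ennreal_mult'[symmetric] ennreal_plus[symmetric] field_simps del: ennreal_plus)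
      finally show ?thesis .
    qed
    moreover from this have int: "integrable M f"
      by (intro integrableI_bounded) (auto intro: le_less_trans)
    ultimately show ?thesis
      using nn_integral_eq_integral[OF integrable_norm[OF int]] ab \<alpha> by simp
  qed
  show "integrable M f" using *[of "nrm f + 1"] Lp_norm_nonneg[of f] by auto
  show "(\<integral>t. cmod (f t) \<partial>M) \<le> (b - a + 1) * nrm f"
  proof (rule field_le_epsilon)
    fix e :: real assume "0 < e"
    then have "(\<integral>t. cmod (f t) \<partial>M) \<le> (b - a + 1) * (nrm f + e / (b - a + 1))"
      using *[of "nrm f + e / (b - a + 1)"] Lp_norm_nonneg[of f] ab by (simp add: add_nonneg_pos)
    also have "\<dots> = (b - a + 1) * nrm f + e" using ab by (simp add: field_simps)
    finally show "(\<integral>t. cmod (f t) \<partial>M) \<le> (b - a + 1) * nrm f + e" .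
  qed
qed

lemma Lp_norm_eq_0_AE:
  assumes f: "f \<in> LP" and "nrm f = 0"
  shows "AE t in M. f t = 0"
proof -
  have "(\<integral>t. cmod (f t) \<partial>M) = 0"
    using Lp_integrable(2)[OF f] assms by (intro antisym) auto
  then have "AE t in M. cmod (f t) = 0"
    using Lp_integrable(1)[OF f] by (subst (asm) integral_nonneg_eq_0_iff_AE) auto
  then show ?thesis by simp
qed

text \<open>Closed balls are stable under almost-everywhere convergence: by Fatou's lemma for finite
  p, and for p = \<infinity> because countably many null sets can be discarded together.\<close>

lemma Lp_Fatou:
  assumes h: "\<And>k. h k \<in> LP" "\<And>k::nat. nrm (h k) \<le> c" and lim: "AE t in M. (\<lambda>k. h k t) \<longlonglongrightarrow> g t"
    and g: "g \<in> borel_measurable M"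
  shows "g \<in> LP" "nrm g \<le> c"
proof -
  have c: "0 \<le> c" using h(2)[of 0] Lp_norm_nonneg order_trans by blast
  note [measurable] = Lp_measurable[OF h(1)] g
  have "g \<in> LP \<and> nrm g \<le> c"
  proof (cases "p = \<infinity>")
    case True
    have "AE t in M. \<forall>k. cmod (h k t) \<le> c"
      using Lp_inf_iff[OF True c] h by (subst AE_all_countable) blast
    with lim have "AE t in M. cmod (g t) \<le> c"
      by eventually_elim (metis LIMSEQ_le_const2 tendsto_norm)
    then show ?thesis using Lp_inf_iff[OF True c] g by blast
  next
    case False
    have q: "1 \<le> q" using q1 False by auto
    have "(\<integral>\<^sup>+t. ennreal (cmod (g t) powr q) \<partial>M) = (\<integral>\<^sup>+t. liminf (\<lambda>k. ennreal (cmod (h k t) powr q)) \<partial>M)"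
    proof (rule nn_integral_cong_AE)
      show "AE t in M. ennreal (cmod (g t) powr q) = liminf (\<lambda>k. ennreal (cmod (h k t) powr q))"
        using lim
      proof eventually_elim
        case (elim t)
        then have "(\<lambda>k. ennreal (cmod (h k t) powr q)) \<longlonglongrightarrow> ennreal (cmod (g t) powr q)"
          using q by (intro tendsto_ennrealI tendsto_powr2 tendsto_norm tendsto_const) auto
        from lim_imp_Liminf[OF _ this] show ?case by simp
      qed
    qed
    also have "\<dots> \<le> liminf (\<lambda>k. \<integral>\<^sup>+t. ennreal (cmod (h k t) powr q) \<partial>M)"
      by (rule nn_integral_liminf) measurable
    also have "\<dots> \<le> liminf (\<lambda>k::nat. ennreal (c powr q))"
      using Lp_fin_iff[OF False c] h by (intro Liminf_mono always_eventually) blast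
    also have "\<dots> = ennreal (c powr q)" by (simp add: Liminf_const)
    finally show ?thesis using Lp_fin_iff[OF False c] g by blast
  qed
  then show "g \<in> LP" "nrm g \<le> c" by auto
qed

lemma Lp_diff:
  assumes f: "f \<in> LP" and g: "g \<in> LP"
  shows "(\<lambda>t. f t - g t) \<in> LP" "nrm (\<lambda>t. f t - g t) \<le> nrm f + nrm g"
  using Lp_add[OF f Lp_scale(1)[OF g, of "-1"]] Lp_scale(2)[OF g, of "-1"] by auto

text \<open>Riesz-Fischer: a Cauchy sequence in L_p is Cauchy in L_1, so a subsequence converges
  almost everywhere, and Fatou identifies its limit as the limit in norm.\<close>

lemma Lp_complete:
  assumes f: "\<And>k. f k \<in> LP"
    and C: "\<And>e. 0 < e \<Longrightarrow> \<exists>N. \<forall>i\<ge>N. \<forall>j\<ge>N. nrm (\<lambda>t. f i t - f j t) \<le> e"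
  shows "\<exists>g\<in>LP. (\<lambda>k. nrm (\<lambda>t. f k t - g t)) \<longlonglongrightarrow> 0"
proof -
  note [measurable] = Lp_measurable[OF f]
  obtain r where r: "strict_mono r" "AE t in M. Cauchy (\<lambda>i. f (r i) t)"
  proof (rule cauchy_L1_AE_cauchy_subseq[where M = M and s = f])
    show "integrable M (f k)" for k using f Lp_integrable by blast
    fix e :: real assume e: "0 < e"
    then obtain N where N: "\<forall>i\<ge>N. \<forall>j\<ge>N. nrm (\<lambda>t. f i t - f j t) \<le> e / (2 * (b - a + 1))"
      using C[of "e / (2 * (b - a + 1))"] ab by auto
    have "LINT t|M. norm (f i t - f j t) < e" if "i \<ge> N" "j \<ge> N" for i j
    proof -
      have "LINT t|M. norm (f i t - f j t) \<le> (b - a + 1) * nrm (\<lambda>t. f i t - f j t)"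
        using Lp_integrable(2)[OF Lp_diff(1)[OF f f]] .
      also have "\<dots> \<le> (b - a + 1) * (e / (2 * (b - a + 1)))"
        using N that ab by (intro mult_left_mono) auto
      also have "\<dots> = e / 2"
      proof -
        have "x * (e / (2 * x)) = e / 2" if "0 < x" for x using that by simp
        from this[of "b - a + 1"] ab show ?thesis by simp
      qed
      also have "\<dots> < e" using e by simp
      finally show ?thesis .
    qed
    then show "\<exists>N. \<forall>i\<ge>N. \<forall>j\<ge>N. LINT t|M. norm (f i t - f j t) < e" by blast
  qed
  \<comment> \<open>Where the subsequence diverges, which is on a null set, \<open>lim\<close> is an
    unspecified value.\<close>
  define g where "g = (\<lambda>t. lim (\<lambda>i. f (r i) t))"
  have [measurable]: "g \<in> borel_measurable M" unfolding g_def by measurable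
  have lim: "AE t in M. (\<lambda>i. f (r i) t) \<longlonglongrightarrow> g t"
    using r(2) by eventually_elim (auto simp: g_def Cauchy_convergent_iff convergent_LIMSEQ_iff)
  \<comment> \<open>Fatou is applied in the second index with \<open>k\<close> fixed. The
    subsequence is shifted by \<open>N\<close> so that all its indices are in the range of the
    Cauchy estimate.\<close>
  have est: "\<exists>N. \<forall>k\<ge>N. (\<lambda>t. f k t - g t) \<in> LP \<and> nrm (\<lambda>t. f k t - g t) \<le> e" if e: "0 < e" for e
  proof -
    obtain N where N: "\<forall>i\<ge>N. \<forall>j\<ge>N. nrm (\<lambda>t. f i t - f j t) \<le> e" using C[OF e] by blast
    have "(\<lambda>t. f k t - g t) \<in> LP \<and> nrm (\<lambda>t. f k t - g t) \<le> e" if "k \<ge> N" for k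
    proof -
      have "AE t in M. (\<lambda>i. f k t - f (r (i + N)) t) \<longlonglongrightarrow> f k t - g t"
        using lim by eventually_elim (intro tendsto_intros LIMSEQ_ignore_initial_segment)
      moreover have "r (i + N) \<ge> N" for i using seq_suble[OF r(1), of "i + N"] by simp
      ultimately show ?thesis
        using Lp_Fatou[of "\<lambda>i t. f k t - f (r (i + N)) t" e "\<lambda>t. f k t - g t"] Lp_diff(1)[OF f f] N that
        by auto
    qed
    then show ?thesis by blast
  qed
  obtain N where "(\<lambda>t. f N t - g t) \<in> LP" using est[of 1] by auto
  from Lp_diff(1)[OF f[of N] this] have "g \<in> LP" by simp
  moreover have "(\<lambda>k. nrm (\<lambda>t. f k t - g t)) \<longlonglongrightarrow> 0"
  proof (rule LIMSEQ_I)
    fix e :: real assume "0 < e"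
    then show "\<exists>N. \<forall>k\<ge>N. norm (nrm (\<lambda>t. f k t - g t) - 0) < e"
      using est[of "e/2"] Lp_norm_nonneg by force
  qed
  ultimately show ?thesis by blast
qed

end

section \<open>Absolutely continuous functions\<close>

text \<open>Names the premise on families of intervals in \<open>abs_continuous_on\<close>, so that
  it can be passed around as a whole.\<close>

definition short_family :: "real \<Rightarrow> real \<Rightarrow> real \<Rightarrow> (real \<times> real) set \<Rightarrow> bool" where
  "short_family a b \<delta> I \<longleftrightarrow> finite I \<and> (\<forall>(u, v)\<in>I. a \<le> u \<and> u < v \<and> v \<le> b) \<and>
     pairwise (\<lambda>(u, v) (u', v'). {u<..<v} \<inter> {u'<..<v'} = {}) I \<and> (\<Sum>(u, v)\<in>I. v - u) < \<delta>"

lemma abs_continuous_on_iff: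
  "abs_continuous_on a b f \<longleftrightarrow>
     (\<forall>\<epsilon>>0. \<exists>\<delta>>0. \<forall>I. short_family a b \<delta> I \<longrightarrow> (\<Sum>(u, v)\<in>I. norm (f v - f u)) < \<epsilon>)"
  unfolding abs_continuous_on_def short_family_def by (rule refl)

text \<open>A gauge argument, with integrability of the derivative as part of the conclusion. Pieces
  tagged outside \<open>N\<close> are controlled by differentiability. Pieces tagged in
  \<open>N\<close> are confined to an open set of small measure, and absolute continuity makes the
  increments of \<open>f\<close> over them small.\<close>

lemma integral_FTC_abs_continuous:
  fixes f f' :: "real \<Rightarrow> 'v::euclidean_space"
  assumes "a \<le> b" and ac: "abs_continuous_on a b f" and N: "negligible N"
    and vd: "\<And>t. t \<in> {a..b} - N \<Longrightarrow> (f has_vector_derivative f' t) (at t within {a..b})"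
  shows "(f' has_integral (f b - f a)) {a..b}"
proof -
  \<comment> \<open>A tag in \<open>N\<close> then contributes nothing to the Riemann sum, so only
    the increment of \<open>f\<close> is left there.\<close>
  define g where "g t = (if t \<in> N then 0 else f' t)" for t
  have "(g has_integral (f b - f a)) {a..b}"
    unfolding has_integral_real
  proof safe
    fix e :: real assume e: "0 < e"
    \<comment> \<open>One half of the error, spread over the length; adding 1 covers the degenerate
      case a = b.\<close>
    define e1 where "e1 = e / (2 * (b - a + 1))"
    have e1: "0 < e1" "e1 * (b - a) < e / 2"
    proof -
      show "0 < e1" using e \<open>a \<le> b\<close> by (simp add: e1_def)
      then have "e1 * (b - a) < e1 * (b - a + 1)" by simp
      also have "\<dots> = e / 2"
      proof -
        have "e / (2 * x) * x = e / 2" if "0 < x" for x using that by simp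
        from this[of "b - a + 1"] \<open>a \<le> b\<close> show ?thesis unfolding e1_def by simp
      qed
      finally show "e1 * (b - a) < e / 2" .
    qed
    have "0 < e / 2" using e by simp
    then obtain \<delta> where \<delta>: "0 < \<delta>"
      and ac\<delta>: "\<And>I. \<lbrakk>finite I; \<And>u v. (u, v) \<in> I \<Longrightarrow> a \<le> u \<and> u < v \<and> v \<le> b;
            pairwise (\<lambda>(u, v) (u', v'). {u<..<v} \<inter> {u'<..<v'} = {}) I;
            (\<Sum>(u, v)\<in>I. v - u) < \<delta>\<rbrakk> \<Longrightarrow> (\<Sum>(u, v)\<in>I. norm (f v - f u)) < e / 2"
    proof -
      from ac \<open>0 < e / 2\<close> obtain \<delta> where "0 < \<delta>" and \<delta>: "\<And>I. short_family a b \<delta> I \<longrightarrow> (\<Sum>(u, v)\<in>I. norm (f v - f u)) < e / 2"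
        unfolding abs_continuous_on_iff by meson
      show ?thesis
      proof (rule that[OF \<open>0 < \<delta>\<close>])
        fix I assume "finite I" "\<And>u v. (u, v) \<in> I \<Longrightarrow> a \<le> u \<and> u < v \<and> v \<le> b"
            "pairwise (\<lambda>(u, v) (u', v'). {u<..<v} \<inter> {u'<..<v'} = {}) I"
            "(\<Sum>(u, v)\<in>I. v - u) < \<delta>"
        then show "(\<Sum>(u, v)\<in>I. norm (f v - f u)) < e / 2"
          by (intro \<delta>[rule_format]) (auto simp: short_family_def)
      qed
    qed
    \<comment> \<open>Outer regularity: the null set has an open neighbourhood shorter than the
      threshold from absolute continuity.\<close>
    obtain U where U: "open U" "N \<subseteq> U" "U \<in> lmeasurable" "measure lebesgue U < \<delta>"
    proof -
      obtain T where T: "open T" "N \<subseteq> T" "T - N \<in> lmeasurable" "emeasure lebesgue (T - N) < ennreal \<delta>"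
        using sets_lebesgue_outer_open[OF negligible_imp_sets[OF N] \<delta>] by blast
      have "T = (T - N) \<union> N" using T by blast
      moreover have "N \<in> null_sets lebesgue" using N negligible_iff_null_sets by blast
      ultimately have "emeasure lebesgue T = emeasure lebesgue (T - N)"
        using T(3) by (metis emeasure_Un_null_set fmeasurableD)
      then have "emeasure lebesgue T < ennreal \<delta>" using T by simp
      moreover have "T \<in> sets lebesgue" using T(1) by simp
      ultimately have "T \<in> lmeasurable" by (auto simp: fmeasurable_def intro: less_trans)
      moreover from this have "measure lebesgue T < \<delta>"
        using \<open>emeasure lebesgue T < ennreal \<delta>\<close> by (simp add: emeasure_eq_measure2 ennreal_less_iff)
      ultimately show ?thesis using that T by blast
    qed
    have "\<exists>d>0. x \<in> {a..b} - N \<longrightarrow>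
         (\<forall>y\<in>{a..b}. norm (y-x) < d \<longrightarrow> norm (f y - f x - (y-x) *\<^sub>R f' x) \<le> e1 * norm (y-x))" for x
    proof (cases "x \<in> {a..b} - N")
      case True
      from vd[OF this] e1(1) show ?thesis
        unfolding has_vector_derivative_def has_derivative_within_alt by blast
    qed (auto intro: exI[of _ 1])
    then obtain d where d0: "\<And>x. 0 < d x \<and> (x \<in> {a..b} - N \<longrightarrow>
         (\<forall>y\<in>{a..b}. norm (y-x) < d x \<longrightarrow> norm (f y - f x - (y-x) *\<^sub>R f' x) \<le> e1 * norm (y-x)))"
      by meson
    then have d: "\<And>x. 0 < d x"
        "\<And>x y. \<lbrakk>x \<in> {a..b}; x \<notin> N; y \<in> {a..b}; norm (y-x) < d x\<rbrakk>
            \<Longrightarrow> norm (f y - f x - (y-x) *\<^sub>R f' x) \<le> e1 * norm (y-x)"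
      by blast+
    define \<gamma> where "\<gamma> x = (if x \<in> N then U else ball x (d x))" for x
    have gauge: "gauge \<gamma>" using U d(1) by (auto simp: gauge_def \<gamma>_def)
    have main: "norm ((\<Sum>(x, K)\<in>D. measure lborel K *\<^sub>R g x) - (f b - f a)) < e"
      if ptag: "D tagged_division_of {a..b}" and fine: "\<gamma> fine D" for D
    proof -
      have finD: "finite D" using ptag by blast
      have ba: "b - a = (\<Sum>(x,K)\<in>D. Sup K - Inf K)" "f b - f a = (\<Sum>(x,K)\<in>D. f(Sup K) - f(Inf K))"
        using additive_tagged_division_1[where f= "\<lambda>x. x"] additive_tagged_division_1[where f= f]
              \<open>a \<le> b\<close> ptag by auto
      have K: "x \<in> K \<and> K \<subseteq> {a..b} \<and> (\<forall>t. Inf K < t \<longrightarrow> t < Sup K \<longrightarrow> t \<in> K) \<and>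
          interior K = {Inf K<..<Sup K} \<and> Inf K \<le> x \<and> x \<le> Sup K \<and>
          measure lborel K = Sup K - Inf K \<and> Inf K \<in> K \<and> Sup K \<in> K \<and> K \<subseteq> \<gamma> x"
        if "(x, K) \<in> D" for x K
      proof -
        obtain u v where uv: "K = cbox u v" using tagged_division_ofD(4)[OF ptag \<open>(x, K) \<in> D\<close>] by blast
        have "x \<in> K" "K \<subseteq> {a..b}" using tagged_division_ofD(2,3)[OF ptag \<open>(x, K) \<in> D\<close>] by auto
        then have "u \<le> v" using uv by auto
        then show ?thesis using uv \<open>x \<in> K\<close> \<open>K \<subseteq> {a..b}\<close> fineD[OF fine \<open>(x, K) \<in> D\<close>] by auto
      qed
      \<comment> \<open>Degenerate pieces are left out: interval families in absolute continuity
        need u < v, and nonempty interiors make the map \<open>h\<close> to end points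
        injective.\<close>
      define D2 where "D2 = {z\<in>D. fst z \<in> N \<and> Inf (snd z) < Sup (snd z)}"
      define h where "h z = (Inf (snd z), Sup (snd z))" for z :: "real \<times> real set"
      define w where "w z = norm (f (Sup (snd z)) - f (Inf (snd z)))" for z :: "real \<times> real set"
      have D2: "D2 \<subseteq> D" "finite D2" using finD by (auto simp: D2_def)
      have disj: "{Inf K<..<Sup K} \<inter> {Inf K'<..<Sup K'} = {}"
        if "(x, K) \<in> D" "(x', K') \<in> D" "(x, K) \<noteq> (x', K')" for x K x' K'
        using tagged_division_ofD(5)[OF ptag that] K[OF that(1)] K[OF that(2)]
        by metis
      have inj: "inj_on h D2"
      proof (rule inj_onI, rule ccontr)
        fix z z' assume z: "z \<in> D2" "z' \<in> D2" "h z = h z'" "z \<noteq> z'"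
        have "{Inf (snd z)<..<Sup (snd z)} \<inter> {Inf (snd z')<..<Sup (snd z')} = {}"
          by (rule disj[of "fst z" _ "fst z'"]) (use z D2(1) in auto)
        moreover have "Inf (snd z') = Inf (snd z)" "Sup (snd z') = Sup (snd z)" "Inf (snd z) < Sup (snd z)"
          using z by (simp_all add: D2_def h_def)
        ultimately show False by simp
      qed
      have pw: "pairwise (\<lambda>(u, v) (u', v'). {u<..<v} \<inter> {u'<..<v'} = {}) (h ` D2)"
      proof (rule pairwiseI)
        fix i j assume "i \<in> h ` D2" "j \<in> h ` D2" "i \<noteq> j"
        then obtain z z' where z: "z \<in> D2" "z' \<in> D2" "i = h z" "j = h z'" "z \<noteq> z'" by blast
        have "{Inf (snd z)<..<Sup (snd z)} \<inter> {Inf (snd z')<..<Sup (snd z')} = {}"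
          by (rule disj[of "fst z" _ "fst z'"]) (use z D2(1) in auto)
        then show "(case i of (u, v) \<Rightarrow> \<lambda>(u', v'). {u<..<v} \<inter> {u'<..<v'} = {}) j"
          unfolding z(3,4) h_def prod.case .
      qed
      have "(\<Sum>(u, v)\<in>h ` D2. v - u) = (\<Sum>i\<in>h ` D2. measure lebesgue {fst i<..<snd i})"
        by (rule sum.cong) (auto simp: h_def D2_def)
      also have "\<dots> = measure lebesgue (\<Union>i\<in>h ` D2. {fst i<..<snd i})"
      proof (rule measure_finite_Union[symmetric])
        show "disjoint_family_on (\<lambda>i. {fst i<..<snd i}) (h ` D2)"
          using pw unfolding disjoint_family_on_def pairwise_def split_beta by blast
        show "emeasure lebesgue {fst i<..<snd i} \<noteq> \<infinity>" if "i \<in> h ` D2" for i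
          using that by (auto simp: h_def D2_def)
      qed (use D2 in auto)
      \<comment> \<open>Fineness places every piece tagged in \<open>N\<close> inside
        \<open>U\<close>.\<close>
      also have "\<dots> \<le> measure lebesgue U"
      proof (rule measure_mono_fmeasurable)
        show "(\<Union>i\<in>h ` D2. {fst i<..<snd i}) \<subseteq> U"
        proof clarsimp
          fix x K t assume t: "(x, K) \<in> D2" "fst (h (x, K)) < t" "t < snd (h (x, K))"
          have D: "(x, K) \<in> D" "x \<in> N" using t by (simp_all add: D2_def)
          have "t \<in> K" using K[OF D(1)] t by (simp add: h_def)
          moreover have "K \<subseteq> \<gamma> x" using K[OF D(1)] by simp
          ultimately show "t \<in> U" using D(2) by (auto simp: \<gamma>_def)
        qed
      qed (use U D2 in auto)
      finally have len: "(\<Sum>(u, v)\<in>h ` D2. v - u) < \<delta>" using U by simp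
      have "(\<Sum>(u, v)\<in>h ` D2. norm (f v - f u)) < e / 2"
      proof (rule ac\<delta>[OF _ _ pw len])
        fix u v assume "(u, v) \<in> h ` D2"
        then obtain z where "z \<in> D2" "h z = (u, v)" by force
        then show "a \<le> u \<and> u < v \<and> v \<le> b"
          using K[of "fst z" "snd z"] D2 by (auto simp: D2_def h_def)
      qed (use D2 in auto)
      then have sum2: "(\<Sum>z\<in>D2. w z) < e / 2"
        using inj by (subst (asm) sum.reindex) (auto simp: h_def w_def split_beta)
      have each: "norm (measure lborel (snd z) *\<^sub>R g (fst z) - (f (Sup (snd z)) - f (Inf (snd z))))
          \<le> e1 * (Sup (snd z) - Inf (snd z)) + (if z \<in> D2 then w z else 0)" if "z \<in> D" for z
      proof -
        obtain x L where z: "z = (x, L)" by (cases z)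
        note KK = K[OF that[unfolded z]]
        define u v where "u = Inf L" and "v = Sup L"
        have le: "u \<le> x" "x \<le> v" using KK by (auto simp: u_def v_def)
        show ?thesis
        proof (cases "x \<in> N")
          case True
          show ?thesis
          proof (cases "u < v")
            case uv: True
            then have "z \<in> D2" using that True z by (auto simp: D2_def u_def v_def)
            then show ?thesis using uv e1(1) z True by (simp add: g_def w_def u_def v_def norm_minus_commute)
          next
            case False
            then have "u = v" using le by simp
            then show ?thesis using z True by (auto simp: g_def u_def v_def w_def)
          qed
        next
          case False
          have x: "x \<in> {a..b}" "u \<in> {a..b}" "v \<in> {a..b}" using KK by (auto simp: u_def v_def)
          have "u \<in> ball x (d x)" "v \<in> ball x (d x)" using KK False by (auto simp: \<gamma>_def u_def v_def)
          then have "norm (f u - f x - (u - x) *\<^sub>R f' x) \<le> e1 * norm (u - x)"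
             "norm (f v - f x - (v - x) *\<^sub>R f' x) \<le> e1 * norm (v - x)"
            using d(2)[OF x(1) False x(2)] d(2)[OF x(1) False x(3)]
            by (auto simp: dist_real_def abs_minus_commute)
          moreover have "norm ((v - u) *\<^sub>R f' x - (f v - f u)) \<le>
              norm (f u - f x - (u - x) *\<^sub>R f' x) + norm (f v - f x - (v - x) *\<^sub>R f' x)"
          proof -
            have "(v - u) *\<^sub>R f' x - (f v - f u)
                = (f u - f x - (u - x) *\<^sub>R f' x) - (f v - f x - (v - x) *\<^sub>R f' x)"
              by (simp add: algebra_simps)
            then show ?thesis by (simp only: norm_triangle_ineq4)
          qed
          \<comment> \<open>The tag lies between the end points, so its two distances add up to the
            length.\<close>
          moreover have "e1 * norm (u - x) + e1 * norm (v - x) = e1 * (v - u)"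
            using le by (simp add: algebra_simps)
          ultimately have "norm ((v - u) *\<^sub>R f' x - (f v - f u)) \<le> e1 * (v - u)" by linarith
          moreover have "z \<notin> D2" using False z by (auto simp: D2_def)
          ultimately show ?thesis using KK z False by (simp add: g_def u_def v_def)
        qed
      qed
      have "norm ((\<Sum>(x, K)\<in>D. measure lborel K *\<^sub>R g x) - (f b - f a))
          = norm (\<Sum>z\<in>D. measure lborel (snd z) *\<^sub>R g (fst z) - (f (Sup (snd z)) - f (Inf (snd z))))"
        unfolding ba(2) split_beta sum_subtractf by simp
      also have "\<dots> \<le> (\<Sum>z\<in>D. e1 * (Sup (snd z) - Inf (snd z)) + (if z \<in> D2 then w z else 0))"
        using each by (rule sum_norm_le)
      also have "\<dots> = e1 * (b - a) + (\<Sum>z\<in>D2. w z)"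
      proof -
        have "(\<Sum>z\<in>D. if z \<in> D2 then w z else 0) = (\<Sum>z\<in>D2. w z)"
          using D2 finD by (simp add: sum.If_cases Int_absorb1)
        then show ?thesis unfolding ba(1) sum.distrib sum_distrib_left split_beta by simp
      qed
      also have "\<dots> < e" using e1 sum2 by linarith
      finally show ?thesis .
    qed
    show "\<exists>\<gamma>. gauge \<gamma> \<and> (\<forall>D. D tagged_division_of {a..b} \<and> \<gamma> fine D \<longrightarrow>
        norm ((\<Sum>(x, K)\<in>D. measure lborel K *\<^sub>R g x) - (f b - f a)) < e)"
    proof (rule exI[of _ \<gamma>], rule conjI[OF gauge], intro allI impI)
      fix D assume "D tagged_division_of {a..b} \<and> \<gamma> fine D"
      then show "norm ((\<Sum>(x, K)\<in>D. measure lborel K *\<^sub>R g x) - (f b - f a)) < e"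
        by (rule conjE) (rule main)
    qed
  qed
  then show ?thesis
    by (rule has_integral_spike[OF N _ , of "{a..b}" f' g, rotated]) (simp add: g_def)
qed

lemma abs_continuous_on_subinterval:
  assumes "abs_continuous_on a b f" "a \<le> c" "d \<le> b"
  shows "abs_continuous_on c d f"
proof -
  have "short_family a b \<delta> I" if "short_family c d \<delta> I" for \<delta> I
    using that assms(2,3) unfolding short_family_def by fastforce
  then show ?thesis using assms(1) unfolding abs_continuous_on_iff by meson
qed

text \<open>The increment of the product splits as (f v - f u) g v + f u (g v - g u), and a common
  bound for both functions absorbs the other factor.\<close>

lemma abs_continuous_on_mult:
  fixes f g :: "real \<Rightarrow> 'v::real_normed_algebra"
  assumes f: "abs_continuous_on a b f" "\<And>t. t \<in> {a..b} \<Longrightarrow> norm (f t) \<le> K"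
    and g: "abs_continuous_on a b g" "\<And>t. t \<in> {a..b} \<Longrightarrow> norm (g t) \<le> K"
  shows "abs_continuous_on a b (\<lambda>t. f t * g t)"
  unfolding abs_continuous_on_iff
proof (intro allI impI)
  fix e :: real assume e: "0 < e"
  define K' where "K' = \<bar>K\<bar> + 1"
  have K': "0 < K'" "K \<le> K'" by (auto simp: K'_def)
  have e': "0 < e / (2 * K')" using e K' by simp
  obtain \<delta>1 where \<delta>1: "0 < \<delta>1" "\<And>I. short_family a b \<delta>1 I \<longrightarrow> (\<Sum>(u, v)\<in>I. norm (f v - f u)) < e / (2 * K')"
    using f(1) e' unfolding abs_continuous_on_iff by meson
  obtain \<delta>2 where \<delta>2: "0 < \<delta>2" "\<And>I. short_family a b \<delta>2 I \<longrightarrow> (\<Sum>(u, v)\<in>I. norm (g v - g u)) < e / (2 * K')"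
    using g(1) e' unfolding abs_continuous_on_iff by meson
  show "\<exists>\<delta>>0. \<forall>I. short_family a b \<delta> I \<longrightarrow> (\<Sum>(u, v)\<in>I. norm (f v * g v - f u * g u)) < e"
  proof (intro exI[of _ "min \<delta>1 \<delta>2"] conjI allI impI)
    show "0 < min \<delta>1 \<delta>2" using \<delta>1 \<delta>2 by simp
    fix I assume "short_family a b (min \<delta>1 \<delta>2) I"
    note I = this[unfolded short_family_def]
    have fg: "(\<Sum>(u, v)\<in>I. norm (f v - f u)) < e / (2 * K')" "(\<Sum>(u, v)\<in>I. norm (g v - g u)) < e / (2 * K')"
      using \<delta>1(2)[of I] \<delta>2(2)[of I] I unfolding short_family_def by auto
    have pt: "norm (f v * g v - f u * g u) \<le> K' * norm (f v - f u) + K' * norm (g v - g u)"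
      if "(u, v) \<in> I" for u v
    proof -
      have "a \<le> u \<and> u < v \<and> v \<le> b" using I that by blast
      then have uv: "u \<in> {a..b}" "v \<in> {a..b}" by auto
      have "f v * g v - f u * g u = (f v - f u) * g v + f u * (g v - g u)" by (simp add: algebra_simps)
      then have "norm (f v * g v - f u * g u) \<le> norm (f v - f u) * norm (g v) + norm (f u) * norm (g v - g u)"
        by (simp only: norm_triangle_le add_mono norm_mult_ineq)
      also have "\<dots> \<le> norm (f v - f u) * K' + K' * norm (g v - g u)"
        using f(2) g(2) uv K' by (intro add_mono mult_left_mono mult_right_mono) (auto intro: order_trans)
      finally show ?thesis by (simp add: mult.commute)
    qed
    have "(\<Sum>(u, v)\<in>I. norm (f v * g v - f u * g u))
        \<le> (\<Sum>(u, v)\<in>I. K' * norm (f v - f u) + K' * norm (g v - g u))"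
      using pt by (intro sum_mono) auto
    also have "\<dots> = K' * (\<Sum>(u, v)\<in>I. norm (f v - f u)) + K' * (\<Sum>(u, v)\<in>I. norm (g v - g u))"
      by (simp add: split_beta sum.distrib sum_distrib_left)
    also have "\<dots> < K' * (e / (2 * K')) + K' * (e / (2 * K'))"
      using fg K' by (intro add_strict_mono mult_strict_left_mono)
    also have "\<dots> = e" using K' by simp
    finally show "(\<Sum>(u, v)\<in>I. norm (f v * g v - f u * g u)) < e" .
  qed
qed

section \<open>Absolute continuity and differentiation of indefinite integrals\<close>

lemma integrable_lebesgue_on_subset:
  fixes g :: "real \<Rightarrow> 'v::euclidean_space"
  assumes "integrable (lebesgue_on S) g" "S \<in> sets lebesgue" "T \<subseteq> S" "T \<in> sets lebesgue"
  shows "integrable (lebesgue_on T) g"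
proof -
  have "set_integrable lebesgue S g"
    using assms(1,2) by (simp add: set_integrable_def integrable_restrict_space)
  from set_integrable_subset[OF this assms(4,3)] have "set_integrable lebesgue T g" .
  from absolutely_integrable_imp_integrable[OF this assms(4)] show ?thesis .
qed

text \<open>Truncation: |g| is at most a constant \<open>k\<close> plus an excess of small integral.
  The constant is paid for by short total length, the excess by its integral over the whole
  interval.\<close>

lemma abs_continuous_on_integral:
  fixes g :: "real \<Rightarrow> complex"
  assumes g: "integrable (lebesgue_on {a..b}) g"
    and F: "\<And>u v. \<lbrakk>a \<le> u; u \<le> v; v \<le> b\<rbrakk> \<Longrightarrow> F v - F u = integral {u..v} g"
  shows "abs_continuous_on a b F"
  unfolding abs_continuous_on_iff
proof (intro allI impI)
  let ?M = "lebesgue_on {a..b}"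
  fix e :: real assume e: "0 < e"
  have [measurable]: "g \<in> borel_measurable ?M" using g by (rule borel_measurable_integrable)
  \<comment> \<open>The excess over level \<open>k\<close>; it vanishes for large \<open>k\<close>
    at each point and is dominated by |g|, so its integral tends to 0.\<close>
  define s where "s k t = max 0 (cmod (g t) - real k)" for k t
  have s0: "0 \<le> s k t" for k t by (simp add: s_def)
  have "(\<lambda>k. \<integral>t. s k t \<partial>?M) \<longlonglongrightarrow> (\<integral>t. 0 \<partial>?M)"
  proof (rule integral_dominated_convergence[where w = "\<lambda>t. cmod (g t)"])
    show "AE t in ?M. (\<lambda>k. s k t) \<longlonglongrightarrow> 0"
    proof (rule AE_I2)
      fix t
      obtain N where N: "cmod (g t) \<le> real N" using real_arch_simple by blast
      then have "s k t = 0" if "k \<ge> N" for k using that by (simp add: s_def)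
      then show "(\<lambda>k. s k t) \<longlonglongrightarrow> 0"
        by (intro tendsto_eventually eventually_sequentiallyI)
    qed
    show "integrable ?M (\<lambda>t. cmod (g t))" using g by (rule integrable_norm)
    show "AE t in ?M. norm (s k t) \<le> cmod (g t)" for k by (rule AE_I2) (simp add: s_def)
    show "s k \<in> borel_measurable ?M" for k unfolding s_def by measurable
  qed simp
  then have "\<forall>\<^sub>F k in sequentially. (\<integral>t. s k t \<partial>?M) < e / 2"
    using e by (intro order_tendstoD) auto
  then obtain k where k: "(\<integral>t. s k t \<partial>?M) < e / 2" by (auto simp: eventually_sequentially)
  have sk: "integrable ?M (s k)"
  proof (rule Bochner_Integration.integrable_bound[OF integrable_norm[OF g]])
    show "s k \<in> borel_measurable ?M" unfolding s_def by measurable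
  qed (auto simp: s_def intro!: AE_I2)
  \<comment> \<open>With this total length the level \<open>k\<close> contributes at most e / 2; the
    added 1 covers k = 0.\<close>
  show "\<exists>\<delta>>0. \<forall>I. short_family a b \<delta> I \<longrightarrow> (\<Sum>(u, v)\<in>I. norm (F v - F u)) < e"
  proof (intro exI[of _ "e / (2 * (real k + 1))"] conjI allI impI)
    show "0 < e / (2 * (real k + 1))" using e by simp
    fix I :: "(real \<times> real) set"
    assume "short_family a b (e / (2 * (real k + 1))) I"
    note I = this[unfolded short_family_def]
    define J where "J i = {fst i<..<snd i}" for i :: "real \<times> real"
    have Iuv: "a \<le> fst i" "fst i < snd i" "snd i \<le> b" if "i \<in> I" for i
      using I that by (auto simp: split_beta)
    have each: "norm (F (snd i) - F (fst i)) \<le> real k * (snd i - fst i) + (\<integral>t. indicator (J i) t * s k t \<partial>?M)"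
      if "i \<in> I" for i
    proof -
      have sub: "J i \<subseteq> {a..b}" using Iuv[OF that] by (auto simp: J_def)
      have gi: "integrable (lebesgue_on (J i)) g"
        using g sub by (intro integrable_lebesgue_on_subset[OF g _ sub]) (auto simp: J_def)
      have "integrable ?M (\<lambda>t. real k)"
        by (intro finite_measure.integrable_const finite_measureI)
          (simp add: emeasure_restrict_space emeasure_lborel_Icc_eq)
      from integrable_lebesgue_on_subset[OF this _ sub]
      have const: "integrable (lebesgue_on (J i)) (\<lambda>t. real k)" by (simp add: J_def)
      have ski: "integrable (lebesgue_on (J i)) (s k)"
        by (intro integrable_lebesgue_on_subset[OF sk _ sub]) (auto simp: J_def)
      have "F (snd i) - F (fst i) = integral {fst i..snd i} g" using F Iuv[OF that] by simp
      also have "\<dots> = integral (J i) g" unfolding J_def by (rule integral_open_interval_real)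
      also have "\<dots> = integral\<^sup>L (lebesgue_on (J i)) g"
        using gi by (intro lebesgue_integral_eq_integral[symmetric]) (auto simp: J_def)
      finally have "norm (F (snd i) - F (fst i)) \<le> (\<integral>t. norm (g t) \<partial>(lebesgue_on (J i)))"
        using integral_norm_bound by simp
      also have "\<dots> \<le> (\<integral>t. real k + s k t \<partial>(lebesgue_on (J i)))"
      proof (rule integral_mono)
        show "integrable (lebesgue_on (J i)) (\<lambda>t. real k + s k t)"
          using ski const by (intro Bochner_Integration.integrable_add)
        show "norm (g t) \<le> real k + s k t" for t by (simp add: s_def)
      qed (use gi in auto)
      also have "\<dots> = real k * (snd i - fst i) + (\<integral>t. s k t \<partial>(lebesgue_on (J i)))"
      proof -
        have "measure (lebesgue_on (J i)) (J i) = snd i - fst i"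
          using Iuv[OF that] by (simp add: J_def measure_restrict_space)
        then have c: "(\<integral>t. real k \<partial>(lebesgue_on (J i))) = real k * (snd i - fst i)" by simp
        from Bochner_Integration.integral_add[OF const ski] c show ?thesis by simp
      qed
      also have "(\<integral>t. s k t \<partial>(lebesgue_on (J i))) = (\<integral>t. (if t \<in> J i then s k t else 0) \<partial>?M)"
        using sub by (intro integral_restrict[symmetric]) (auto simp: J_def)
      also have "\<dots> = (\<integral>t. indicator (J i) t * s k t \<partial>?M)"
        by (rule Bochner_Integration.integral_cong) (auto simp: indicator_def)
      finally show ?thesis .
    qed
    have int_i: "integrable ?M (\<lambda>t. indicator (J i) t * s k t)" if "i \<in> I" for i
    proof -
      have "J i \<subseteq> {a..b}" "J i \<in> sets lebesgue" using Iuv[OF that] by (auto simp: J_def)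
      then have "J i \<in> sets ?M" by (simp add: sets_restrict_space_iff)
      from integrable_mult_indicator[OF this sk] show ?thesis by simp
    qed
    have "(\<Sum>i\<in>I. \<integral>t. indicator (J i) t * s k t \<partial>?M) = (\<integral>t. (\<Sum>i\<in>I. indicator (J i) t * s k t) \<partial>?M)"
      using int_i by (intro Bochner_Integration.integral_sum[symmetric])
    also have "\<dots> \<le> (\<integral>t. s k t \<partial>?M)"
    proof (rule integral_mono[OF _ sk])
      show "integrable ?M (\<lambda>t. \<Sum>i\<in>I. indicator (J i) t * s k t)" using int_i by auto
      fix t
      have eq: "(\<Sum>i\<in>I. indicator (J i) t * s k t) = (\<Sum>i\<in>I. indicat_real (J i) t) * s k t"
        by (simp add: sum_distrib_right)
      \<comment> \<open>Disjointness of the family enters here: a point lies in at most one of the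
        intervals, so the excesses add up to no more than the total excess.\<close>
      have "(\<Sum>i\<in>I. indicat_real (J i) t) = real (card {i\<in>I. t \<in> J i})"
        using I by (simp add: indicator_def sum.If_cases Int_def)
      also have "real (card {i\<in>I. t \<in> J i}) \<le> 1"
      proof -
        have "i = j" if "i \<in> I" "j \<in> I" "t \<in> J i" "t \<in> J j" for i j
        proof (rule ccontr)
          assume "i \<noteq> j"
          with I that(1,2) have "{fst i<..<snd i} \<inter> {fst j<..<snd j} = {}"
            unfolding pairwise_def split_beta by blast
          with that(3,4) show False by (auto simp: J_def)
        qed
        then have "card {i\<in>I. t \<in> J i} \<le> Suc 0" using I by (intro card_le_Suc0_iff_eq[THEN iffD2]) auto
        then show ?thesis by simp
      qed
      finally show "(\<Sum>i\<in>I. indicator (J i) t * s k t) \<le> s k t"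
        unfolding eq using mult_right_mono[OF _ s0[of k t], of _ 1] by simp
    qed
    finally have part: "(\<Sum>i\<in>I. \<integral>t. indicator (J i) t * s k t \<partial>?M) < e / 2" using k by linarith
    have len: "(\<Sum>i\<in>I. snd i - fst i) < e / (2 * (real k + 1))" using I by (simp add: split_beta)
    have "(\<Sum>(u, v)\<in>I. norm (F v - F u)) = (\<Sum>i\<in>I. norm (F (snd i) - F (fst i)))"
      by (simp add: split_beta)
    also have "\<dots> \<le> (\<Sum>i\<in>I. real k * (snd i - fst i) + (\<integral>t. indicator (J i) t * s k t \<partial>?M))"
      using each by (rule sum_mono)
    also have "\<dots> = real k * (\<Sum>i\<in>I. snd i - fst i) + (\<Sum>i\<in>I. \<integral>t. indicator (J i) t * s k t \<partial>?M)"
      by (simp only: sum.distrib sum_distrib_left)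
    also have "\<dots> < real k * (e / (2 * (real k + 1))) + e / 2"
      using len part by (intro add_le_less_mono mult_left_mono) auto
    also have "\<dots> \<le> e / 2 + e / 2"
    proof -
      have "real k / (real k + 1) \<le> 1" by simp
      then have "e / 2 * (real k / (real k + 1)) \<le> e / 2 * 1" using e by (intro mult_left_mono) auto
      moreover have "real k * (e / (2 * (real k + 1))) = e / 2 * (real k / (real k + 1))" by simp
      ultimately show ?thesis by linarith
    qed
    finally show "(\<Sum>(u, v)\<in>I. norm (F v - F u)) < e" by simp
  qed
qed

text \<open>Differentiation along cubes with lower corner x is, in dimension one, a statement on
  right-hand difference quotients; here it is cleared of the division by h.\<close>

lemma Lebesgue_differentiation_right:
  fixes g :: "real \<Rightarrow> complex"
  assumes "integrable lebesgue g"
  obtains N where "negligible N"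
    "\<And>x e. \<lbrakk>x \<notin> N; 0 < e\<rbrakk> \<Longrightarrow> \<exists>d>0. \<forall>h. 0 < h \<and> h < d \<longrightarrow>
        norm (integral {x..x + h} g - h *\<^sub>R g x) \<le> e * h"
proof -
  have "g integrable_on cbox u v" for u v
    using integrable_on_lebesgue[OF assms] integrable_on_subcbox by blast
  from integrable_ccontinuous_explicit[OF this] obtain N where N: "negligible N"
    and N': "\<And>x e. \<lbrakk>x \<notin> N; 0 < e\<rbrakk> \<Longrightarrow> \<exists>d>0. \<forall>h. 0 < h \<and> h < d \<longrightarrow>
       norm (integral (cbox x (x + h *\<^sub>R One)) g /\<^sub>R h ^ DIM(real) - g x) < e" by blast
  show ?thesis
  proof (rule that[OF N])
    fix x e :: real assume "x \<notin> N" "0 < e"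
    then obtain d where d: "d > 0" "\<And>h. 0 < h \<and> h < d \<Longrightarrow>
       norm (integral (cbox x (x + h *\<^sub>R One)) g /\<^sub>R h ^ DIM(real) - g x) < e" using N' by meson
    have "norm (integral {x..x + h} g - h *\<^sub>R g x) \<le> e * h" if "0 < h" "h < d" for h
    proof -
      have "integral {x..x + h} g - h *\<^sub>R g x = h *\<^sub>R (integral {x..x + h} g /\<^sub>R h - g x)"
        using that by (simp add: scaleR_diff_right)
      then have "norm (integral {x..x + h} g - h *\<^sub>R g x) = h * norm (integral {x..x + h} g /\<^sub>R h - g x)"
        using that by simp
      also have "\<dots> \<le> h * e" using d(2)[of h] that by (intro mult_left_mono) auto
      finally show ?thesis by (simp add: mult.commute)
    qed
    with d(1) show "\<exists>d>0. \<forall>h. 0 < h \<and> h < d \<longrightarrow> norm (integral {x..x + h} g - h *\<^sub>R g x) \<le> e * h"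
      by blast
  qed
qed

text \<open>Left-hand quotients at x are right-hand quotients at -x of the reflected function, so
  two applications of the one-sided theorem suffice. At the end points the derivative within the
  interval involves one side only.\<close>

lemma Lebesgue_differentiation_interval:
  fixes g :: "real \<Rightarrow> complex"
  assumes g: "integrable (lebesgue_on {a..b}) g"
    and F: "\<And>u v. \<lbrakk>a \<le> u; u \<le> v; v \<le> b\<rbrakk> \<Longrightarrow> F v - F u = integral {u..v} g"
  shows "AE t in lebesgue_on {a..b}. (F has_vector_derivative g t) (at t within {a..b})"
proof -
  define G where "G t = (if t \<in> {a..b} then g t else 0)" for t
  have G: "integrable lebesgue G"
    unfolding G_def using g by (subst Lebesgue_Measure.integrable_restrict_UNIV) auto
  obtain N1 where N1: "negligible N1" "\<And>x e. \<lbrakk>x \<notin> N1; 0 < e\<rbrakk> \<Longrightarrow> \<exists>d>0. \<forall>h. 0 < h \<and> h < d \<longrightarrow>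
        norm (integral {x..x + h} G - h *\<^sub>R G x) \<le> e * h"
    using Lebesgue_differentiation_right[OF G] by blast
  have "integrable lebesgue (\<lambda>t. G (- t))"
    using G lebesgue_integrable_real_affine[of G "-1" 0] by simp
  from Lebesgue_differentiation_right[OF this]
  obtain N2 where N2: "negligible N2" "\<And>x e. \<lbrakk>x \<notin> N2; 0 < e\<rbrakk> \<Longrightarrow> \<exists>d>0. \<forall>h. 0 < h \<and> h < d \<longrightarrow>
        norm (integral {x..x + h} (\<lambda>t. G (- t)) - h *\<^sub>R G (- x)) \<le> e * h"
    by blast
  define N where "N = N1 \<union> uminus ` N2"
  have "negligible (uminus ` N2)"
    using N2(1) by (intro negligible_differentiable_image_negligible) (auto intro!: derivative_intros)
  then have N: "negligible N" using N1 by (simp add: N_def)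
  have FG: "F v - F u = integral {u..v} G" if "a \<le> u" "u \<le> v" "v \<le> b" for u v
    unfolding F[OF that] by (rule Henstock_Kurzweil_Integration.integral_cong) (use that in \<open>auto simp: G_def\<close>)
  have "(F has_vector_derivative g x) (at x within {a..b})" if x: "x \<in> {a..b}" "x \<notin> N" for x
    unfolding has_vector_derivative_def has_derivative_within_alt
  proof (intro conjI allI impI)
    show "bounded_linear (\<lambda>h. h *\<^sub>R g x)" by (rule bounded_linear_scaleR_left)
    fix e :: real assume e: "0 < e"
    have xN: "x \<notin> N1" "- x \<notin> N2" using x by (auto simp: N_def image_iff)
    obtain d1 where d1: "d1 > 0" "\<And>h. 0 < h \<and> h < d1 \<Longrightarrow> norm (integral {x..x + h} G - h *\<^sub>R G x) \<le> e * h"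
      using N1(2)[OF xN(1) e] by blast
    obtain d2 where d2: "d2 > 0" "\<And>h. 0 < h \<and> h < d2 \<Longrightarrow>
        norm (integral {- x..- x + h} (\<lambda>t. G (- t)) - h *\<^sub>R G x) \<le> e * h"
      using N2(2)[OF xN(2) e] by auto
    have Gx: "G x = g x" using x by (simp add: G_def)
    have "norm (F y - F x - (y - x) *\<^sub>R g x) \<le> e * norm (y - x)"
      if y: "y \<in> {a..b}" "norm (y - x) < min d1 d2" for y
    proof -
      consider "y = x" | "x < y" | "y < x" by linarith
      then show ?thesis
      proof cases
        case 2
        then have "F y - F x = integral {x..x + (y - x)} G" using FG[of x y] x y by simp
        then show ?thesis using d1(2)[of "y - x"] 2 y Gx by simp
      next
        case 3
        then have "F x - F y = integral {y..x} G" using FG[of y x] x y by simp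
        also have "\<dots> = integral {- x..- x + (x - y)} (\<lambda>t. G (- t))"
          using integral_reflect_real[of x y G] by simp
        finally have *: "F x - F y = integral {- x..- x + (x - y)} (\<lambda>t. G (- t))" .
        have "norm (F y - F x - (y - x) *\<^sub>R g x) = norm ((F x - F y) - (x - y) *\<^sub>R g x)"
          by (subst norm_minus_cancel[symmetric]) (simp add: algebra_simps del: norm_minus_cancel)
        then show ?thesis using d2(2)[of "x - y"] 3 y Gx * by simp
      qed simp
    qed
    then show "\<exists>d>0. \<forall>y\<in>{a..b}. norm (y - x) < d \<longrightarrow>
        norm (F y - F x - (y - x) *\<^sub>R g x) \<le> e * norm (y - x)"
      using d1(1) d2(1) by (intro exI[of _ "min d1 d2"]) auto
  qed
  moreover have "AE x in lebesgue. x \<notin> N"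
    using N by (simp add: eventually_ae_filter_negligible) blast
  ultimately show ?thesis
    by (auto simp: AE_restrict_space_iff elim: eventually_mono)
qed

section \<open>Sobolev spaces of scalar functions\<close>

lemma continuous_on_Icc_bounded:
  fixes f :: "real \<Rightarrow> 'v::real_normed_vector"
  assumes "continuous_on {a..b} f"
  obtains K where "\<And>t. t \<in> {a..b} \<Longrightarrow> norm (f t) \<le> K"
  using compact_imp_bounded[OF compact_continuous_image[OF assms compact_Icc]] unfolding bounded_iff by blast

lemma nderiv_0 [simp]: "nderiv a b 0 y = y"
  by (simp add: nderiv_def)

lemma nderiv_Suc: "nderiv a b (Suc k) y t = vector_derivative (nderiv a b k y) (at t within {a..b})"
  by (simp add: nderiv_def)

lemma nderiv_add_index: "nderiv a b (j + k) y = nderiv a b j (nderiv a b k y)"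
  by (simp add: nderiv_def funpow_add)

lemma nderiv_Suc_shift: "nderiv a b (Suc k) y = nderiv a b k (nderiv a b (Suc 0) y)"
  using nderiv_add_index[of a b k 1 y] by simp

lemma nderiv_1_nderiv: "nderiv a b (Suc 0) (nderiv a b k y) = nderiv a b (Suc k) y"
  using nderiv_add_index[of a b 1 k y] by simp

lemma has_vector_derivative_within_cong:
  assumes "\<And>t. t \<in> S \<Longrightarrow> f t = g t" "t \<in> S"
  shows "(f has_vector_derivative f') (at t within S) \<longleftrightarrow> (g has_vector_derivative f') (at t within S)"
proof
  assume "(f has_vector_derivative f') (at t within S)"
  then show "(g has_vector_derivative f') (at t within S)"
    by (rule has_vector_derivative_transform[OF assms(2), rotated]) (simp add: assms(1))
next
  assume "(g has_vector_derivative f') (at t within S)"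
  then show "(f has_vector_derivative f') (at t within S)"
    by (rule has_vector_derivative_transform[OF assms(2), rotated]) (simp add: assms(1))
qed

lemma nderiv_cong:
  assumes "\<And>t. t \<in> {a..b} \<Longrightarrow> y t = z t" "t \<in> {a..b}"
  shows "nderiv a b k y t = nderiv a b k z t"
  using assms(2)
proof (induction k arbitrary: t)
  case (Suc k)
  then show ?case
    unfolding nderiv_Suc vector_derivative_def
    using has_vector_derivative_within_cong[of "{a..b}" "nderiv a b k y" "nderiv a b k z" t] by simp
qed (use assms in auto)

lemma differentiable_within_cong:
  fixes f g :: "real \<Rightarrow> 'v::real_normed_vector"
  assumes "\<And>t. t \<in> S \<Longrightarrow> f t = g t" "t \<in> S"
  shows "f differentiable (at t within S) \<longleftrightarrow> g differentiable (at t within S)"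
proof -
  have *: "h differentiable (at t within S) \<longleftrightarrow> (\<exists>h'. (h has_vector_derivative h') (at t within S))"
    for h :: "real \<Rightarrow> 'v"
    using vector_derivative_works differentiableI_vector by blast
  have "(f has_vector_derivative h') (at t within S) \<longleftrightarrow> (g has_vector_derivative h') (at t within S)" for h'
    by (rule has_vector_derivative_within_cong[OF assms])
  then show ?thesis unfolding * by simp
qed

lemma abs_continuous_on_cong:
  assumes "\<And>t. t \<in> {a..b} \<Longrightarrow> f t = g t" "abs_continuous_on a b f"
  shows "abs_continuous_on a b g"
proof -
  have "(\<Sum>(u, v)\<in>I. norm (g v - g u)) = (\<Sum>(u, v)\<in>I. norm (f v - f u))" if "short_family a b \<delta> I" for \<delta> I
  proof (rule sum.cong)
    fix i assume "i \<in> I"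
    with that have "a \<le> fst i \<and> fst i < snd i \<and> snd i \<le> b" by (auto simp: short_family_def split_beta)
    then show "(case i of (u, v) \<Rightarrow> norm (g v - g u)) = (case i of (u, v) \<Rightarrow> norm (f v - f u))"
      using assms(1)[of "fst i"] assms(1)[of "snd i"] by (simp add: split_beta)
  qed simp
  then show ?thesis using assms(2) unfolding abs_continuous_on_iff by metis
qed

context lp_interval
begin

abbreviation D :: "nat \<Rightarrow> (real \<Rightarrow> complex) \<Rightarrow> real \<Rightarrow> complex" where "D \<equiv> nderiv a b"
abbreviation S :: "nat \<Rightarrow> (real \<Rightarrow> complex) set" where "S n \<equiv> Sob a b n p"
abbreviation VS :: "nat \<Rightarrow> (real \<Rightarrow> complex ^ 'm::finite) set" where "VS n \<equiv> vSob a b n p"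
abbreviation VN :: "nat \<Rightarrow> (real \<Rightarrow> complex ^ 'm::finite) \<Rightarrow> real" where "VN n \<equiv> vSob_norm a b n p"
abbreviation MS :: "nat \<Rightarrow> (real \<Rightarrow> complex ^ 'm::finite ^ 'm) set" where "MS n \<equiv> mSob a b n p"
abbreviation SN :: "nat \<Rightarrow> (real \<Rightarrow> complex) \<Rightarrow> real" where "SN n \<equiv> Sob_norm a b n p"

section \<open>Sobolev functions as indefinite integrals\<close>

text \<open>A substitute for "g is the derivative of y" that is insensitive to changes of
  \<open>g\<close> on null sets and is preserved by linear combinations, products and
  limits.\<close>

definition primitive :: "(real \<Rightarrow> complex) \<Rightarrow> (real \<Rightarrow> complex) \<Rightarrow> bool" where
  "primitive y g \<longleftrightarrow> (\<forall>t\<in>I. y t = y a + integral {a..t} g)"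

lemma primitiveD: "primitive y g \<Longrightarrow> t \<in> I \<Longrightarrow> y t = y a + integral {a..t} g"
  unfolding primitive_def by (rule bspec)

lemma LP_integrable_on: "g \<in> LP \<Longrightarrow> u \<in> I \<Longrightarrow> v \<in> I \<Longrightarrow> g integrable_on {u..v}"
  by (rule integrable_on_subinterval[OF integrable_on_lebesgue_on[OF Lp_integrable(1)]]) auto

lemma primitive_diff:
  assumes "primitive y g" "g \<in> LP" "a \<le> u" "u \<le> v" "v \<le> b"
  shows "y v - y u = integral {u..v} g"
proof -
  have "integral {a..u} g + integral {u..v} g = integral {a..v} g"
    using assms LP_integrable_on[of g a v] by (intro Henstock_Kurzweil_Integration.integral_combine) auto
  moreover have "y u = y a + integral {a..u} g" "y v = y a + integral {a..v} g"
    using assms by (intro primitiveD; simp)+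
  ultimately show ?thesis by (metis add_diff_cancel_left add_diff_cancel_left')
qed

lemma primitive_AC: "primitive y g \<Longrightarrow> g \<in> LP \<Longrightarrow> abs_continuous_on a b y"
  using abs_continuous_on_integral[OF Lp_integrable(1)] primitive_diff by meson

lemma primitive_AE: "primitive y g \<Longrightarrow> g \<in> LP \<Longrightarrow>
    AE t in M. (y has_vector_derivative g t) (at t within I)"
  using Lebesgue_differentiation_interval[OF Lp_integrable(1)] primitive_diff by meson

lemma primitive_continuous:
  assumes "primitive y g" "g \<in> LP"
  shows "continuous_on I y"
proof -
  have "continuous_on I (\<lambda>t. y a + integral {a..t} g)"
    using LP_integrable_on[OF assms(2)] ab by (intro continuous_intros indefinite_integral_continuous_1) auto
  then show ?thesis using primitiveD[OF assms(1)] by (subst continuous_on_cong[OF refl]) 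
qed

lemma primitive_deriv:
  assumes "primitive y g" "continuous_on I g" "t \<in> I"
  shows "(y has_vector_derivative g t) (at t within I)"
proof -
  have "((\<lambda>t. y a + integral {a..t} g) has_vector_derivative g t) (at t within I)"
    using has_vector_derivative_add[OF has_vector_derivative_const integral_has_vector_derivative[OF assms(2,3)]]
    by simp
  then show ?thesis
    using has_vector_derivative_within_cong[OF primitiveD[OF assms(1)] assms(3)] by simp
qed

lemma AC_primitive:
  assumes ac: "abs_continuous_on a b y" and ae: "AE t in M. (y has_vector_derivative g t) (at t within I)"
  shows "primitive y g"
  unfolding primitive_def
proof
  fix t assume t: "t \<in> I"
  have "AE t in lebesgue. t \<in> I \<longrightarrow> (y has_vector_derivative g t) (at t within I)"
    using ae by (simp add: AE_restrict_space_iff)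
  then obtain N where N: "negligible N" "\<And>t. t \<notin> N \<Longrightarrow> t \<in> I \<Longrightarrow> (y has_vector_derivative g t) (at t within I)"
    by (auto simp: eventually_ae_filter_negligible)
  have "(g has_integral (y t - y a)) {a..t}"
  proof (rule integral_FTC_abs_continuous[OF _ _ N(1)])
    show "abs_continuous_on a t y" using t by (intro abs_continuous_on_subinterval[OF ac]) auto
    fix s assume "s \<in> {a..t} - N"
    then show "(y has_vector_derivative g s) (at s within {a..t})"
      using t by (intro has_vector_derivative_within_subset[OF N(2)]) auto
  qed (use t in auto)
  then show "y t = y a + integral {a..t} g" by (simp add: integral_unique)
qed

lemma vector_derivative_I:
  fixes y :: "real \<Rightarrow> complex"
  assumes "(y has_vector_derivative g) (at t within I)" "t \<in> I"
  shows "vector_derivative y (at t within I) = g"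
  using vector_derivative_within_closed_interval[OF ab assms(2,1)] .

lemma continuous_LP: "continuous_on I y \<Longrightarrow> y \<in> LP"
proof -
  assume y: "continuous_on I y"
  then have "y \<in> borel_measurable M" by (intro continuous_imp_measurable_on_sets_lebesgue) auto
  moreover obtain K where "\<And>t. t \<in> I \<Longrightarrow> cmod (y t) \<le> K"
    using continuous_on_Icc_bounded[OF y] by blast
  ultimately show ?thesis
    by (intro Lp_bounded(1)[of y "max K 0"]) (auto intro!: AE_M_I simp: le_max_iff_disj)
qed

lemma Sob_Suc_continuous: "y \<in> S (Suc n) \<Longrightarrow> continuous_on I y"
  by (auto simp: C_on_def)

lemma Sob_LP: "y \<in> S n \<Longrightarrow> y \<in> LP"
  by (cases n) (auto simp del: Sob.simps(2) intro: continuous_LP Sob_Suc_continuous)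

lemma Sob_top_LP: "y \<in> S n \<Longrightarrow> D n y \<in> LP"
  by (cases n) auto

text \<open>Together with \<open>Sob_SucI\<close> this turns the definition into a recursion: order
  n + 1 consists of the primitives of functions of order n. For n = 0 the fundamental theorem for
  absolutely continuous functions is required; for larger n the function is continuously
  differentiable and the classical one suffices.\<close>

lemma Sob_SucD:
  assumes y: "y \<in> S (Suc n)"
  shows "D (Suc 0) y \<in> S n" "primitive y (D (Suc 0) y)"
proof -
  have "D (Suc 0) y \<in> S n \<and> primitive y (D (Suc 0) y)"
  proof (cases n)
    case 0
    have "AE t in M. (y has_vector_derivative D (Suc 0) y t) (at t within I)"
    proof -
      have "AE t in M. y differentiable (at t within I)" using y 0 by simp
      then show ?thesis by (simp add: nderiv_Suc vector_derivative_works[symmetric])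
    qed
    then show ?thesis using y 0 by (auto intro: AC_primitive)
  next
    case (Suc m)
    have C: "\<And>j t. j < Suc m \<Longrightarrow> t \<in> I \<Longrightarrow> D j y differentiable (at t within I)"
       "\<And>j. j \<le> Suc m \<Longrightarrow> continuous_on I (D j y)"
       and ac: "abs_continuous_on a b (D (Suc m) y)"
       and ae: "AE t in M. D (Suc m) y differentiable (at t within I)"
       and top: "D (Suc (Suc m)) y \<in> LP"
      using y Suc by (auto simp: C_on_def)
    have "D (Suc 0) y \<in> S n"
    proof -
      have sh: "D j (D (Suc 0) y) = D (Suc j) y" for j by (rule nderiv_Suc_shift[symmetric])
      show ?thesis unfolding Suc using C ac ae top by (auto simp: sh C_on_def)
    qed
    moreover have "primitive y (D (Suc 0) y)"
      unfolding primitive_def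
    proof
      fix t assume t: "t \<in> I"
      have "(D (Suc 0) y has_integral (y t - y a)) {a..t}"
      proof (rule fundamental_theorem_of_calculus)
        fix s assume "s \<in> {a..t}"
        then have s: "s \<in> I" "{a..t} \<subseteq> I" using t by auto
        have "(y has_vector_derivative D (Suc 0) y s) (at s within I)"
          using C(1)[of 0, OF _ s(1)] by (simp add: nderiv_Suc vector_derivative_works[symmetric])
        then show "(y has_vector_derivative D (Suc 0) y s) (at s within {a..t})"
          using s(2) by (rule has_vector_derivative_within_subset)
      qed (use t in auto)
      then show "y t = y a + integral {a..t} (D (Suc 0) y)" by (simp add: integral_unique)
    qed
    ultimately show ?thesis by simp
  qed
  then show "D (Suc 0) y \<in> S n" "primitive y (D (Suc 0) y)" by auto
qed

text \<open>The converse half of the recursion. The top derivative is matched with that of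
  \<open>g\<close> only almost everywhere because of n = 0, where \<open>g\<close> is recovered from
  its integral by Lebesgue differentiation.\<close>

lemma Sob_SucI:
  assumes g: "g \<in> S n" and prim: "primitive y g"
  shows "y \<in> S (Suc n)"
    and "\<And>j t. j < n \<Longrightarrow> t \<in> I \<Longrightarrow> D (Suc j) y t = D j g t"
    and "AE t in M. D (Suc n) y t = D n g t"
proof -
  have gL: "g \<in> LP" using g by (rule Sob_LP)
  have ae: "AE t in M. (y has_vector_derivative g t) (at t within I)"
    using prim gL by (rule primitive_AE)
  have cont: "continuous_on I y" using prim gL by (rule primitive_continuous)
  have ae1: "AE t in M. D (Suc 0) y t = g t"
  proof -
    have "AE t in M. t \<in> I" by (rule AE_M_I)
    with ae show ?thesis by eventually_elim (simp add: nderiv_Suc vector_derivative_I)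
  qed
  have "y \<in> S (Suc n) \<and> (\<forall>j<n. \<forall>t\<in>I. D (Suc j) y t = D j g t) \<and> (AE t in M. D (Suc n) y t = D n g t)"
  proof (cases n)
    case 0
    have "D (Suc 0) y \<in> LP" by (rule Lp_cong_AE(1)[OF gL]) (use ae1 in auto)
    moreover have "AE t in M. y differentiable (at t within I)"
      using ae by eventually_elim (rule differentiableI_vector)
    ultimately show ?thesis
      using 0 cont primitive_AC[OF prim gL] ae1 by (auto simp: C_on_def)
  next
    case (Suc m)
    have gc: "continuous_on I g" using g Suc Sob_Suc_continuous by blast
    have vd: "(y has_vector_derivative g t) (at t within I)" if "t \<in> I" for t
      using primitive_deriv[OF prim gc that] .
    have d1: "D (Suc 0) y t = g t" if "t \<in> I" for t
      using vd[OF that] that by (simp add: nderiv_Suc vector_derivative_I)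
    have dj: "D (Suc j) y t = D j g t" if "t \<in> I" for j t
      unfolding nderiv_Suc_shift[of a b j y] using d1 that by (rule nderiv_cong)
    have C: "\<And>j t. j < m \<Longrightarrow> t \<in> I \<Longrightarrow> D j g differentiable (at t within I)"
       "\<And>j. j \<le> m \<Longrightarrow> continuous_on I (D j g)"
       and ac: "abs_continuous_on a b (D m g)"
       and aed: "AE t in M. D m g differentiable (at t within I)"
       and top: "D (Suc m) g \<in> LP"
      using g Suc by (auto simp: C_on_def)
    have "D j y differentiable (at t within I)" if "j < Suc m" "t \<in> I" for j t
    proof (cases j)
      case 0 then show ?thesis using vd[OF that(2)] by (auto intro: differentiableI_vector)
    next
      case (Suc i)
      then show ?thesis
        using C(1)[of i t] that differentiable_within_cong[of I "D (Suc i) y" "D i g" t] dj by auto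
    qed
    moreover have "continuous_on I (D j y)" if "j \<le> Suc m" for j
    proof (cases j)
      case 0 then show ?thesis using cont by simp
    next
      case (Suc i)
      then show ?thesis using C(2)[of i] that dj continuous_on_cong[OF refl, of I "D (Suc i) y" "D i g"] by auto
    qed
    moreover have "abs_continuous_on a b (D (Suc m) y)"
      by (rule abs_continuous_on_cong[OF _ ac]) (simp add: dj)
    moreover have "AE t in M. D (Suc m) y differentiable (at t within I)"
    proof -
      have "AE t in M. t \<in> I" by (rule AE_M_I)
      with aed show ?thesis
        by eventually_elim (use differentiable_within_cong[of I "D (Suc m) y" "D m g"] dj in blast)
    qed
    moreover have "D (Suc (Suc m)) y \<in> LP"
      using Lp_cong(1)[of "D (Suc (Suc m)) y" "D (Suc m) g"] dj top by blast
    ultimately show ?thesis using Suc dj by (auto simp: C_on_def intro!: AE_M_I)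
  qed
  then show "y \<in> S (Suc n)" "\<And>j t. j < n \<Longrightarrow> t \<in> I \<Longrightarrow> D (Suc j) y t = D j g t"
     "AE t in M. D (Suc n) y t = D n g t" by auto
qed

section \<open>Norms, linear structure and inclusions of scalar Sobolev spaces\<close>

lemma Sob_norm_shift: "SN (n + r) y = (\<Sum>j<r. nrm (D j y)) + SN n (D r y)"
proof -
  have "SN (n + r) y = (\<Sum>s<r + Suc n. nrm (D s y))"
    by (simp add: Sob_norm_def atLeast0AtMost lessThan_Suc_atMost[symmetric] add.commute)
  also have "\<dots> = (\<Sum>s<r. nrm (D s y)) + (\<Sum>s<Suc n. nrm (D (s + r) y))"
    by (simp only: lessThan_atLeast0 sum.atLeastLessThan_concat[of 0 r "r + Suc n", symmetric])
       (simp add: sum.shift_bounds_nat_ivl[of _ 0 r, simplified] add.commute)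
  finally show ?thesis
    by (simp add: Sob_norm_def nderiv_add_index atLeast0AtMost lessThan_Suc_atMost)
qed

lemma Sob_norm_nonneg: "0 \<le> SN n y"
  by (simp add: Sob_norm_def sum_nonneg Lp_norm_nonneg)

lemma Sob_norm_Suc: "SN (Suc n) y = nrm y + SN n (D (Suc 0) y)"
  using Sob_norm_shift[of n 1 y] by simp

lemma Sob_norm_0: "SN 0 y = nrm y"
  by (simp add: Sob_norm_def)

lemma Lp_norm_le_Sob_norm: "nrm y \<le> SN n y"
  using Sob_norm_nonneg by (cases n) (simp_all add: Sob_norm_Suc Sob_norm_0)

lemma Sob_norm_Suc_le: "SN n y \<le> SN (Suc n) y"
  by (simp add: Sob_norm_def Lp_norm_nonneg)

text \<open>The norm can be computed from any \<open>g\<close> of which \<open>y\<close> is a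
  primitive, although \<open>g\<close> may differ from the derivative of \<open>y\<close> on a null
  set.\<close>

lemma Sob_norm_primitive:
  assumes g: "g \<in> S n" and prim: "primitive y g"
  shows "SN (Suc n) y = nrm y + SN n g"
proof -
  have "SN n (D (Suc 0) y) = SN n g"
    unfolding Sob_norm_def
  proof (rule sum.cong)
    fix j assume "j \<in> {0..n}"
    then consider "j < n" | "j = n" by force
    then show "nrm (D j (D (Suc 0) y)) = nrm (D j g)"
    proof cases
      case 1
      then show ?thesis
        using Sob_SucI(2)[OF g prim 1] nderiv_Suc_shift[of a b j y] by (intro Lp_cong(2)) metis
    next
      case 2
      have "AE t in M. D n g t = D (Suc n) y t" using Sob_SucI(3)[OF g prim] by eventually_elim simp
      from Lp_cong_AE(2)[OF Sob_top_LP[OF g] this] show ?thesis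
        using 2 nderiv_Suc_shift[of a b n y] by simp
    qed
  qed simp
  then show ?thesis by (simp add: Sob_norm_Suc)
qed

lemma primitive_lincomb:
  assumes "primitive y g" "g \<in> LP" "primitive z h" "h \<in> LP"
  shows "primitive (\<lambda>t. c * y t + d * z t) (\<lambda>t. c * g t + d * h t)"
  unfolding primitive_def
proof
  fix t assume t: "t \<in> I"
  have gi: "g integrable_on {a..t}" "h integrable_on {a..t}"
    using LP_integrable_on assms t by auto
  then have "integral {a..t} (\<lambda>t. c * g t + d * h t) = c * integral {a..t} g + d * integral {a..t} h"
    by (subst Henstock_Kurzweil_Integration.integral_add) (auto intro: integrable_on_mult_right)
  then show "c * y t + d * z t = c * y a + d * z a + integral {a..t} (\<lambda>t. c * g t + d * h t)"
    unfolding primitiveD[OF assms(1) t] primitiveD[OF assms(3) t] by (simp add: algebra_simps)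
qed

lemma Lp_lincomb:
  assumes "y \<in> LP" "z \<in> LP"
  shows "(\<lambda>t. c * y t + d * z t) \<in> LP" "nrm (\<lambda>t. c * y t + d * z t) \<le> cmod c * nrm y + cmod d * nrm z"
  using Lp_add[OF Lp_scale(1)[OF assms(1), of c] Lp_scale(1)[OF assms(2), of d]] assms
  by (auto simp: Lp_scale(2))

text \<open>Linearity of the n-th derivative can fail at points where the derivative of order n - 1
  is not differentiable, since the values there are arbitrary; hence the separate last
  clause.\<close>

lemma Sob_lincomb:
  assumes "y \<in> S n" "z \<in> S n"
  shows "(\<lambda>t. c * y t + d * z t) \<in> S n"
    "SN n (\<lambda>t. c * y t + d * z t) \<le> cmod c * SN n y + cmod d * SN n z"
    "\<And>j t. j < n \<Longrightarrow> t \<in> I \<Longrightarrow> D j (\<lambda>t. c * y t + d * z t) t = c * D j y t + d * D j z t"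
    "AE t in M. D n (\<lambda>t. c * y t + d * z t) t = c * D n y t + d * D n z t"
proof -
  let ?P = "\<lambda>n y z. (\<lambda>t. c * y t + d * z t) \<in> S n \<and>
    SN n (\<lambda>t. c * y t + d * z t) \<le> cmod c * SN n y + cmod d * SN n z \<and>
    (\<forall>j<n. \<forall>t\<in>I. D j (\<lambda>t. c * y t + d * z t) t = c * D j y t + d * D j z t) \<and>
    (AE t in M. D n (\<lambda>t. c * y t + d * z t) t = c * D n y t + d * D n z t)"
  have "?P n y z" using assms
  proof (induction n arbitrary: y z)
    case 0
    then show ?case using Lp_lincomb[of y z] by (simp add: Sob_norm_0)
  next
    case (Suc n)
    let ?y = "D (Suc 0) y" and ?z = "D (Suc 0) z"
    note y = Sob_SucD[OF Suc.prems(1)] and z = Sob_SucD[OF Suc.prems(2)]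
    note yL = Sob_LP[OF y(1)] and zL = Sob_LP[OF z(1)]
    have IH: "?P n ?y ?z" by (rule Suc.IH[OF y(1) z(1)])
    have prim: "primitive (\<lambda>t. c * y t + d * z t) (\<lambda>t. c * ?y t + d * ?z t)"
      by (rule primitive_lincomb[OF y(2) yL z(2) zL])
    note new = Sob_SucI[OF conjunct1[OF IH] prim]
    have "SN (Suc n) (\<lambda>t. c * y t + d * z t) = nrm (\<lambda>t. c * y t + d * z t) + SN n (\<lambda>t. c * ?y t + d * ?z t)"
      by (rule Sob_norm_primitive[OF conjunct1[OF IH] prim])
    also have "\<dots> \<le> (cmod c * nrm y + cmod d * nrm z) + (cmod c * SN n ?y + cmod d * SN n ?z)"
      using Lp_lincomb(2)[OF Sob_LP Sob_LP, OF Suc.prems, of c d] IH by (intro add_mono) auto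
    also have "\<dots> = cmod c * SN (Suc n) y + cmod d * SN (Suc n) z"
      by (simp add: Sob_norm_Suc algebra_simps)
    finally have n: "SN (Suc n) (\<lambda>t. c * y t + d * z t) \<le> cmod c * SN (Suc n) y + cmod d * SN (Suc n) z" .
    have "D j (\<lambda>t. c * y t + d * z t) t = c * D j y t + d * D j z t" if j: "j < Suc n" "t \<in> I" for j t
    proof (cases j)
      case (Suc i)
      then have "D j (\<lambda>t. c * y t + d * z t) t = D i (\<lambda>t. c * ?y t + d * ?z t) t"
        using new(2)[of i t] j by simp
      also have "\<dots> = c * D i ?y t + d * D i ?z t" using IH j Suc by auto
      finally show ?thesis unfolding Suc nderiv_Suc_shift[of a b i y] nderiv_Suc_shift[of a b i z] .
    qed simp
    moreover have "AE t in M. D (Suc n) (\<lambda>t. c * y t + d * z t) t = c * D (Suc n) y t + d * D (Suc n) z t"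
    proof -
      have "AE t in M. D n (\<lambda>t. c * ?y t + d * ?z t) t = c * D n ?y t + d * D n ?z t" using IH by blast
      with new(3) show ?thesis
        unfolding nderiv_Suc_shift[of a b n y] nderiv_Suc_shift[of a b n z] by eventually_elim simp
    qed
    ultimately show ?case using new(1) n by blast
  qed
  then show "(\<lambda>t. c * y t + d * z t) \<in> S n"
    "SN n (\<lambda>t. c * y t + d * z t) \<le> cmod c * SN n y + cmod d * SN n z"
    "\<And>j t. j < n \<Longrightarrow> t \<in> I \<Longrightarrow> D j (\<lambda>t. c * y t + d * z t) t = c * D j y t + d * D j z t"
    "AE t in M. D n (\<lambda>t. c * y t + d * z t) t = c * D n y t + d * D n z t" by blast+
qed

lemma Sob_add:
  assumes "y \<in> S n" "z \<in> S n"
  shows "(\<lambda>t. y t + z t) \<in> S n" "SN n (\<lambda>t. y t + z t) \<le> SN n y + SN n z"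
  using Sob_lincomb(1,2)[OF assms, where c = 1 and d = 1] by simp_all

lemma Sob_diff:
  assumes "y \<in> S n" "z \<in> S n"
  shows "(\<lambda>t. y t - z t) \<in> S n" "SN n (\<lambda>t. y t - z t) \<le> SN n y + SN n z"
    "\<And>j t. j < n \<Longrightarrow> t \<in> I \<Longrightarrow> D j (\<lambda>t. y t - z t) t = D j y t - D j z t"
    "AE t in M. D n (\<lambda>t. y t - z t) t = D n y t - D n z t"
  using Sob_lincomb[OF assms, where c = 1 and d = "-1"] by simp_all

lemma Sob_scale:
  assumes "y \<in> S n"
  shows "(\<lambda>t. c * y t) \<in> S n" "SN n (\<lambda>t. c * y t) = cmod c * SN n y"
    "\<And>j t. j < n \<Longrightarrow> t \<in> I \<Longrightarrow> D j (\<lambda>t. c * y t) t = c * D j y t"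
    "AE t in M. D n (\<lambda>t. c * y t) t = c * D n y t"
proof -
  have *: "(\<lambda>t. c * y t) \<in> S n \<and> SN n (\<lambda>t. c * y t) \<le> cmod c * SN n y" if "y \<in> S n" for c y
    using Sob_lincomb[OF that that, where c = c and d = 0] by simp
  show "(\<lambda>t. c * y t) \<in> S n"
    "\<And>j t. j < n \<Longrightarrow> t \<in> I \<Longrightarrow> D j (\<lambda>t. c * y t) t = c * D j y t"
    "AE t in M. D n (\<lambda>t. c * y t) t = c * D n y t"
    using Sob_lincomb[OF assms assms, where c = c and d = 0] by simp_all
  show "SN n (\<lambda>t. c * y t) = cmod c * SN n y"
  proof (cases "c = 0")
    case True
    then show ?thesis using *[OF assms, of 0] Sob_norm_nonneg[of n "\<lambda>t. 0"] by simp
  next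
    case False
    then have "SN n y \<le> cmod (1/c) * SN n (\<lambda>t. c * y t)"
      using *[of "\<lambda>t. c * y t" "1/c"] * assms by simp
    then have "cmod c * SN n y \<le> SN n (\<lambda>t. c * y t)"
      using False by (simp add: norm_divide field_simps)
    then show ?thesis using *[OF assms, of c] by simp
  qed
qed

lemma Sob_cong:
  assumes "\<And>t. t \<in> I \<Longrightarrow> y t = z t"
  shows "SN n y = SN n z" "y \<in> S n \<Longrightarrow> z \<in> S n"
proof -
  show "SN n y = SN n z"
    unfolding Sob_norm_def using assms by (intro sum.cong refl Lp_cong(2) nderiv_cong) auto
  show "z \<in> S n" if "y \<in> S n"
  proof (cases n)
    case 0 then show ?thesis using that Lp_cong(1)[of y z] assms by simp
  next
    case (Suc m)
    have yy: "D (Suc 0) y \<in> S m" "primitive y (D (Suc 0) y)" using Sob_SucD that Suc by blast+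
    have "z t = z a + integral {a..t} (D (Suc 0) y)" if "t \<in> I" for t
      using primitiveD[OF yy(2) that] assms[of a] assms[OF that] ab by simp
    then have "primitive z (D (Suc 0) y)" unfolding primitive_def by blast
    then show ?thesis using Sob_SucI(1)[OF yy(1)] Suc by blast
  qed
qed

lemma Sob_zero: "(\<lambda>t. 0) \<in> S n" "SN n (\<lambda>t. 0) = 0"
proof -
  show *: "(\<lambda>t. 0) \<in> S n"
  proof (induction n)
    case 0 then show ?case by (simp add: continuous_LP)
  next
    case (Suc n)
    then show ?case by (rule Sob_SucI(1)) (simp add: primitive_def)
  qed
  show "SN n (\<lambda>t. 0) = 0" using Sob_scale(2)[OF *, of 0] by simp
qed

lemma Sob_sum:
  assumes "finite X" "\<And>x. x \<in> X \<Longrightarrow> f x \<in> S n"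
  shows "(\<lambda>t. \<Sum>x\<in>X. f x t) \<in> S n" "SN n (\<lambda>t. \<Sum>x\<in>X. f x t) \<le> (\<Sum>x\<in>X. SN n (f x))"
proof -
  have "(\<lambda>t. \<Sum>x\<in>X. f x t) \<in> S n \<and> SN n (\<lambda>t. \<Sum>x\<in>X. f x t) \<le> (\<Sum>x\<in>X. SN n (f x))"
    using assms
  proof (induction X)
    case (insert x X)
    then have IH: "(\<lambda>t. \<Sum>x\<in>X. f x t) \<in> S n" "SN n (\<lambda>t. \<Sum>x\<in>X. f x t) \<le> (\<Sum>x\<in>X. SN n (f x))"
      and x: "f x \<in> S n" by auto
    show ?case using Sob_add[OF x IH(1)] IH(2) insert(1,2) by simp
  qed (simp add: Sob_zero)
  then show "(\<lambda>t. \<Sum>x\<in>X. f x t) \<in> S n" "SN n (\<lambda>t. \<Sum>x\<in>X. f x t) \<le> (\<Sum>x\<in>X. SN n (f x))"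
    by auto
qed

lemma Sob_Suc_subset: "y \<in> S (Suc n) \<Longrightarrow> y \<in> S n"
proof (induction n arbitrary: y)
  case 0 then show ?case using Sob_LP[OF 0] by simp
next
  case (Suc n)
  show ?case by (rule Sob_SucI(1)[OF Suc.IH]) (use Sob_SucD[OF Suc.prems] in auto)
qed

lemma Sob_nderiv: "y \<in> S (n + j) \<Longrightarrow> D j y \<in> S n"
proof (induction j arbitrary: y)
  case (Suc j)
  show ?case unfolding nderiv_Suc_shift[of a b j y] by (rule Suc.IH) (use Sob_SucD(1) Suc.prems in simp)
qed simp

lemma Sob_norm_nderiv: "SN n (D j y) \<le> SN (n + j) y"
  by (simp add: Sob_norm_shift sum_nonneg Lp_norm_nonneg)

lemma Sob_norm_mono: "m \<le> n \<Longrightarrow> SN m y \<le> SN n y"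
  by (rule lift_Suc_mono_le[of "\<lambda>n. SN n y", OF Sob_norm_Suc_le])

lemma Sob_subset: "m \<le> n \<Longrightarrow> y \<in> S n \<Longrightarrow> y \<in> S m"
  by (induction n) (auto simp: le_Suc_eq simp del: Sob.simps intro: Sob_Suc_subset)

section \<open>Boundedness of Sobolev functions and completeness\<close>

lemma norm_integral_le:
  assumes g: "g \<in> LP" and uv: "u \<in> I" "v \<in> I"
  shows "cmod (integral {u..v} g) \<le> (b - a + 1) * nrm g"
proof -
  have gi: "integrable M g" using Lp_integrable(1)[OF g] .
  have sub: "{u..v} \<subseteq> I" using uv by auto
  have gu: "integrable (lebesgue_on {u..v}) g" by (rule integrable_lebesgue_on_subset[OF gi _ sub]) auto
  have "cmod (integral {u..v} g) = cmod (integral\<^sup>L (lebesgue_on {u..v}) g)"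
    by (simp add: lebesgue_integral_eq_integral[OF gu])
  also have "\<dots> \<le> (\<integral>t. cmod (g t) \<partial>(lebesgue_on {u..v}))" by (rule integral_norm_bound)
  also have "\<dots> \<le> (\<integral>t. cmod (g t) \<partial>M)"
    by (rule integral_mono_lebesgue_on_AE[OF integrable_norm[OF gi] _ _ sub]) auto
  also have "\<dots> \<le> (b - a + 1) * nrm g" by (rule Lp_integrable(2)[OF g])
  finally show ?thesis .
qed

text \<open>An embedding constant of W_p^1 into bounded functions: 1 / (b - a) comes from averaging
  over the interval and b - a + 1 from the comparison of L_1 with L_p.\<close>

definition emb :: real where "emb = (b - a + 1) * (1 + 1 / (b - a))"

lemma emb_pos: "0 < emb"
  unfolding emb_def using ab by (intro mult_pos_pos add_pos_nonneg) auto

text \<open>For every s, |y(t)| is at most |y(s)| plus a bound for the integral of \<open>g\<close>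
  between s and t; averaging over s replaces the value |y(s)| by the norm of y.\<close>

lemma primitive_sup_bound:
  assumes prim: "primitive y g" and g: "g \<in> LP" and t: "t \<in> I"
  shows "cmod (y t) \<le> emb * (nrm y + nrm g)"
proof -
  define G where "G = (b - a + 1) * nrm g"
  have y: "y \<in> LP" using primitive_continuous[OF prim g] by (rule continuous_LP)
  note yi = Lp_integrable[OF y]
  have pt: "cmod (y t) \<le> cmod (y s) + G" if s: "s \<in> I" for s
  proof -
    have "cmod (y t - y s) \<le> G"
    proof (cases "s \<le> t")
      case True
      then show ?thesis
        using primitive_diff[OF prim g, of s t] norm_integral_le[OF g, of s t] s t by (simp add: G_def)
    next
      case False
      then show ?thesis
        using primitive_diff[OF prim g, of t s] norm_integral_le[OF g, of t s] s t
        by (simp add: G_def norm_minus_commute)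
    qed
    then show ?thesis using norm_triangle_sub[of "y t" "y s"] by linarith
  qed
  have "(\<integral>s. cmod (y t) \<partial>M) \<le> (\<integral>s. cmod (y s) + G \<partial>M)"
    using yi pt by (intro integral_mono) auto
  then have "(b - a) * cmod (y t) \<le> (\<integral>s. cmod (y s) \<partial>M) + (b - a) * G"
    using yi ab measure_M by (simp add: Bochner_Integration.integral_add)
  also have "\<dots> \<le> (b - a + 1) * nrm y + (b - a) * G"
    using yi(2) by simp
  finally have "cmod (y t) \<le> ((b - a + 1) * nrm y + (b - a) * G) / (b - a)"
    using ab by (simp add: field_simps)
  also have "\<dots> = (b - a + 1) * (1 / (b - a)) * nrm y + (b - a + 1) * nrm g"
  proof -
    have "((x + 1) * u + x * ((x + 1) * v)) / x = (x + 1) * (1 / x) * u + (x + 1) * v" if "0 < x" for x u v :: real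
      using that by (simp add: field_simps)
    from this[of "b - a"] ab show ?thesis by (simp add: G_def)
  qed
  also have "\<dots> \<le> emb * nrm y + emb * nrm g"
    using ab Lp_norm_nonneg unfolding emb_def by (intro add_mono mult_right_mono mult_left_mono) auto
  finally show ?thesis by (simp add: distrib_left)
qed

lemma Sob_sup_bound:
  assumes y: "y \<in> S (Suc n)" and t: "t \<in> I"
  shows "cmod (y t) \<le> emb * SN (Suc n) y"
proof -
  note yy = Sob_SucD[OF y]
  have "cmod (y t) \<le> emb * (nrm y + nrm (D (Suc 0) y))"
    by (rule primitive_sup_bound[OF yy(2) Sob_LP[OF yy(1)] t])
  also have "\<dots> \<le> emb * SN (Suc n) y"
    unfolding Sob_norm_Suc using Lp_norm_le_Sob_norm[of "D (Suc 0) y" n] emb_pos by (intro mult_left_mono) auto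
  finally show ?thesis .
qed

text \<open>Induction on the order: the derivatives converge in the space of lower order, the values
  at \<open>a\<close> converge by the sup bound, and these two limits determine the limit
  function.\<close>

lemma Sob_complete:
  assumes "\<And>k. f k \<in> S n"
    and "\<And>e. 0 < e \<Longrightarrow> \<exists>N. \<forall>i\<ge>N. \<forall>j\<ge>N. SN n (\<lambda>t. f i t - f j t) \<le> e"
  shows "\<exists>g\<in>S n. (\<lambda>k. SN n (\<lambda>t. f k t - g t)) \<longlonglongrightarrow> 0"
  using assms
proof (induction n arbitrary: f)
  case 0
  then show ?case using Lp_complete[of f] by (simp add: Sob_norm_0)
next
  case (Suc n)
  note fk = Sob_SucD[OF Suc.prems(1)]
  note fL = Sob_LP[OF fk(1)]
  have eq: "SN (Suc n) (\<lambda>t. f i t - f j t) =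
      nrm (\<lambda>t. f i t - f j t) + SN n (\<lambda>t. D (Suc 0) (f i) t - D (Suc 0) (f j) t)" for i j
    using Sob_norm_primitive[OF Sob_lincomb(1)[OF fk(1)[of i] fk(1)[of j], where c = 1 and d = "-1"]
        primitive_lincomb[OF fk(2)[of i] fL[of i] fk(2)[of j] fL[of j], where c = 1 and d = "-1"]] by simp
  have "\<exists>h\<in>S n. (\<lambda>k. SN n (\<lambda>t. D (Suc 0) (f k) t - h t)) \<longlonglongrightarrow> 0"
  proof (rule Suc.IH[OF fk(1)])
    fix e :: real assume "0 < e"
    then obtain N where "\<forall>i\<ge>N. \<forall>j\<ge>N. SN (Suc n) (\<lambda>t. f i t - f j t) \<le> e"
      using Suc.prems(2) by blast
    then have "\<forall>i\<ge>N. \<forall>j\<ge>N. SN n (\<lambda>t. D (Suc 0) (f i) t - D (Suc 0) (f j) t) \<le> e"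
      unfolding eq using Lp_norm_nonneg by (smt (verit))
    then show "\<exists>N. \<forall>i\<ge>N. \<forall>j\<ge>N. SN n (\<lambda>t. D (Suc 0) (f i) t - D (Suc 0) (f j) t) \<le> e" by blast
  qed
  then obtain h where h: "h \<in> S n" and lim: "(\<lambda>k. SN n (\<lambda>t. D (Suc 0) (f k) t - h t)) \<longlonglongrightarrow> 0" by blast
  have aI: "a \<in> I" using ab by simp
  have "Cauchy (\<lambda>k. f k a)"
  proof (rule metric_CauchyI)
    fix e :: real assume e: "0 < e"
    then have "0 < e / (2 * emb)" using emb_pos by simp
    then obtain N where N: "\<forall>i\<ge>N. \<forall>j\<ge>N. SN (Suc n) (\<lambda>t. f i t - f j t) \<le> e / (2 * emb)"
      using Suc.prems(2) by blast
    have "dist (f i a) (f j a) < e" if "i \<ge> N" "j \<ge> N" for i j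
    proof -
      have "cmod (f i a - f j a) \<le> emb * SN (Suc n) (\<lambda>t. f i t - f j t)"
        by (rule Sob_sup_bound[OF Sob_diff(1)[OF Suc.prems(1) Suc.prems(1)] aI])
      also have "\<dots> \<le> emb * (e / (2 * emb))" using N that emb_pos by (intro mult_left_mono) auto
      also have "\<dots> < e" using e emb_pos by simp
      finally show ?thesis by (simp add: dist_norm)
    qed
    then show "\<exists>N. \<forall>i\<ge>N. \<forall>j\<ge>N. dist (f i a) (f j a) < e" by blast
  qed
  then obtain \<alpha> where \<alpha>: "(\<lambda>k. f k a) \<longlonglongrightarrow> \<alpha>" using Cauchy_convergent_iff convergent_def by blast
  \<comment> \<open>The limit is built as a primitive, so that its membership and norm follow from
    \<open>h\<close> without differentiating it.\<close>
  define g where "g t = \<alpha> + integral {a..t} h" for t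
  have primg: "primitive g h" by (simp add: primitive_def g_def)
  have hL: "h \<in> LP" using h by (rule Sob_LP)
  have g: "g \<in> S (Suc n)" by (rule Sob_SucI(1)[OF h primg])
  have dk: "D (Suc 0) (f k) \<in> S n" for k by (rule fk(1))
  have primd: "primitive (\<lambda>t. f k t - g t) (\<lambda>t. D (Suc 0) (f k) t - h t)" for k
    using primitive_lincomb[OF fk(2) fL primg hL, where c = 1 and d = "-1"] by simp
  have dS: "(\<lambda>t. D (Suc 0) (f k) t - h t) \<in> S n" for k by (rule Sob_diff(1)[OF dk h])
  \<comment> \<open>Bounds the L_p norm of the difference: its value at \<open>a\<close> plus the
    integral of the difference of derivatives bounds it pointwise, and b - a + 1 passes from the
    pointwise bound to the norm.\<close>
  define E where "E k = (b - a + 1) * (cmod (f k a - \<alpha>) + (b - a + 1) * SN n (\<lambda>t. D (Suc 0) (f k) t - h t))" for k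
  have bound: "SN (Suc n) (\<lambda>t. f k t - g t) \<le> E k + SN n (\<lambda>t. D (Suc 0) (f k) t - h t)" for k
  proof -
    let ?d = "\<lambda>t. D (Suc 0) (f k) t - h t"
    define K where "K = cmod (f k a - \<alpha>) + (b - a + 1) * SN n ?d"
    have K0: "0 \<le> K" unfolding K_def using ab Sob_norm_nonneg by (intro add_nonneg_nonneg mult_nonneg_nonneg) auto
    have "cmod (f k t - g t) \<le> K" if t: "t \<in> I" for t
    proof -
      have "f k t - g t = (f k a - g a) + integral {a..t} ?d" using primitiveD[OF primd t] .
      then have "cmod (f k t - g t) \<le> cmod (f k a - g a) + cmod (integral {a..t} ?d)"
        by (simp only: norm_triangle_ineq)
      also have "cmod (integral {a..t} ?d) \<le> (b - a + 1) * nrm ?d"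
        by (rule norm_integral_le[OF Sob_LP[OF dS] aI t])
      also have "\<dots> \<le> (b - a + 1) * SN n ?d"
        using ab by (intro mult_left_mono Lp_norm_le_Sob_norm) auto
      finally show ?thesis by (simp add: K_def g_def)
    qed
    moreover have "(\<lambda>t. f k t - g t) \<in> LP" by (rule Sob_LP[OF Sob_diff(1)[OF Suc.prems(1) g]])
    ultimately have "nrm (\<lambda>t. f k t - g t) \<le> K * (b - a + 1)"
      using K0 by (intro Lp_bounded(2) AE_M_I Lp_measurable)
    then show ?thesis
      unfolding Sob_norm_primitive[OF dS primd] by (simp add: E_def K_def mult.commute)
  qed
  have "(\<lambda>k. E k + SN n (\<lambda>t. D (Suc 0) (f k) t - h t)) \<longlonglongrightarrow>
      (b - a + 1) * (cmod (\<alpha> - \<alpha>) + (b - a + 1) * 0) + 0"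
    unfolding E_def by (intro tendsto_intros lim \<alpha>)
  then have "(\<lambda>k. E k + SN n (\<lambda>t. D (Suc 0) (f k) t - h t)) \<longlonglongrightarrow> 0" by simp
  then have "(\<lambda>k. SN (Suc n) (\<lambda>t. f k t - g t)) \<longlonglongrightarrow> 0"
    by (rule tendsto_sandwich[OF _ _ tendsto_const, rotated 2])
       (auto simp: bound Sob_norm_nonneg)
  then show ?case using g by blast
qed

section \<open>Products of Sobolev functions\<close>

lemma LP_mult_bounded:
  assumes h: "h \<in> LP" and y: "continuous_on I y" and K: "0 \<le> K" "\<And>t. t \<in> I \<Longrightarrow> cmod (y t) \<le> K"
  shows "(\<lambda>t. h t * y t) \<in> LP" "nrm (\<lambda>t. h t * y t) \<le> K * nrm h"
proof -
  have [measurable]: "h \<in> borel_measurable M" "y \<in> borel_measurable M"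
    using h continuous_LP[OF y] by (auto dest: Lp_measurable)
  have m: "(\<lambda>t. h t * y t) \<in> borel_measurable M" by measurable
  have le: "AE t in M. cmod (h t * y t) \<le> K * cmod (h t)"
  proof (rule AE_M_I)
    fix t assume "t \<in> I"
    from mult_right_mono[OF K(2)[OF this], of "cmod (h t)"] show "cmod (h t * y t) \<le> K * cmod (h t)"
      by (simp add: norm_mult mult.commute)
  qed
  show "(\<lambda>t. h t * y t) \<in> LP" "nrm (\<lambda>t. h t * y t) \<le> K * nrm h"
    by (rule Lp_mono[OF h m K(1) le])+
qed

text \<open>The Leibniz rule holds almost everywhere and the product is absolutely continuous, which
  together make it a primitive.\<close>

lemma primitive_mult:
  assumes A: "primitive A A'" "A' \<in> LP" and y: "primitive y y'" "y' \<in> LP"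
  shows "primitive (\<lambda>t. A t * y t) (\<lambda>t. A' t * y t + A t * y' t)"
proof (rule AC_primitive)
  obtain K1 where K1: "\<And>t. t \<in> I \<Longrightarrow> cmod (A t) \<le> K1"
    using continuous_on_Icc_bounded[OF primitive_continuous[OF A]] by blast
  obtain K2 where K2: "\<And>t. t \<in> I \<Longrightarrow> cmod (y t) \<le> K2"
    using continuous_on_Icc_bounded[OF primitive_continuous[OF y]] by blast
  show "abs_continuous_on a b (\<lambda>t. A t * y t)"
    by (rule abs_continuous_on_mult[OF primitive_AC[OF A] _ primitive_AC[OF y], of "max K1 K2"])
       (use K1 K2 in \<open>auto simp: le_max_iff_disj\<close>)
  show "AE t in M. ((\<lambda>t. A t * y t) has_vector_derivative A' t * y t + A t * y' t) (at t within I)"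
    using primitive_AE[OF A] primitive_AE[OF y]
  proof eventually_elim
    case (elim t)
    from has_vector_derivative_mult[OF this] show ?case by (simp add: add.commute)
  qed
qed

text \<open>Order at least one makes a Sobolev space an algebra, since one factor can then be
  bounded pointwise. Higher orders follow by induction through the Leibniz rule; the constant
  depends on the order, not on the factors.\<close>

lemma Sob_mult:
  "\<exists>C\<ge>0. \<forall>A\<in>S (Suc n). \<forall>y\<in>S (Suc n). (\<lambda>t. A t * y t) \<in> S (Suc n) \<and>
     SN (Suc n) (\<lambda>t. A t * y t) \<le> C * SN (Suc n) A * SN (Suc n) y"
proof -
  let ?d = "D (Suc 0)"
  \<comment> \<open>Shared by the base case and the induction step, which differ in how the two
    Leibniz terms are bounded. Of the new constant, \<open>emb\<close> pays for the product itself
    and \<open>C\<close> for each Leibniz term.\<close>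
  have step: "(\<lambda>t. A t * y t) \<in> S (Suc n) \<and> SN (Suc n) (\<lambda>t. A t * y t) \<le> (emb + 2 * C) * SN (Suc n) A * SN (Suc n) y"
    if A: "A \<in> S (Suc n)" and y: "y \<in> S (Suc n)" and C: "0 \<le> C"
      and 1: "(\<lambda>t. ?d A t * y t) \<in> S n" "SN n (\<lambda>t. ?d A t * y t) \<le> C * SN (Suc n) A * SN (Suc n) y"
      and 2: "(\<lambda>t. A t * ?d y t) \<in> S n" "SN n (\<lambda>t. A t * ?d y t) \<le> C * SN (Suc n) A * SN (Suc n) y"
    for A y n C
  proof -
    note A' = Sob_SucD[OF A] and y' = Sob_SucD[OF y]
    let ?g = "\<lambda>t. ?d A t * y t + A t * ?d y t"
    have g: "?g \<in> S n" "SN n ?g \<le> 2 * C * SN (Suc n) A * SN (Suc n) y"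
      using Sob_add[OF 1(1) 2(1)] 1(2) 2(2) by auto
    have prim: "primitive (\<lambda>t. A t * y t) ?g"
      by (rule primitive_mult[OF A'(2) Sob_LP[OF A'(1)] y'(2) Sob_LP[OF y'(1)]])
    have "nrm (\<lambda>t. y t * A t) \<le> (emb * SN (Suc n) A) * nrm y"
      using emb_pos Sob_norm_nonneg Sob_sup_bound[OF A]
      by (intro LP_mult_bounded(2) Sob_LP[OF y] Sob_Suc_continuous[OF A]) auto
    also have "\<dots> \<le> emb * SN (Suc n) A * SN (Suc n) y"
      using emb_pos Sob_norm_nonneg by (intro mult_left_mono Lp_norm_le_Sob_norm) auto
    finally have "nrm (\<lambda>t. A t * y t) \<le> emb * SN (Suc n) A * SN (Suc n) y" by (simp add: mult.commute)
    then show ?thesis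
      using Sob_SucI(1)[OF g(1) prim] g(2) unfolding Sob_norm_primitive[OF g(1) prim]
      by (simp add: algebra_simps)
  qed
  show ?thesis
  proof (induction n)
    case 0
    have "(\<lambda>t. h t * z t) \<in> S 0 \<and> SN 0 (\<lambda>t. h t * z t) \<le> emb * SN (Suc 0) z * SN 0 h"
      if h: "h \<in> S 0" and z: "z \<in> S (Suc 0)" for h z
      using emb_pos Sob_norm_nonneg[of "Suc 0" z] Sob_sup_bound[OF z] h
        LP_mult_bounded[OF Sob_LP[OF h] Sob_Suc_continuous[OF z], of "emb * SN (Suc 0) z"]
      by (auto simp: Sob_norm_0)
    note * = this
    have "SN 0 (?d z) \<le> SN (Suc 0) z" for z using Lp_norm_nonneg by (simp add: Sob_norm_Suc)
    note ** = this
    have "(\<lambda>t. A t * y t) \<in> S (Suc 0) \<and>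
        SN (Suc 0) (\<lambda>t. A t * y t) \<le> (emb + 2 * emb) * SN (Suc 0) A * SN (Suc 0) y"
      if A: "A \<in> S (Suc 0)" and y: "y \<in> S (Suc 0)" for A y
    proof (rule step[OF A y])
      show "0 \<le> emb" using emb_pos by simp
      have "emb * SN (Suc 0) y * SN 0 (?d A) \<le> emb * SN (Suc 0) y * SN (Suc 0) A"
        using emb_pos Sob_norm_nonneg by (intro mult_left_mono **) auto
      then show "(\<lambda>t. ?d A t * y t) \<in> S 0" "SN 0 (\<lambda>t. ?d A t * y t) \<le> emb * SN (Suc 0) A * SN (Suc 0) y"
        using *[OF Sob_SucD(1)[OF A] y] by (auto simp: mult_ac simp del: Sob.simps)
      have "emb * SN (Suc 0) A * SN 0 (?d y) \<le> emb * SN (Suc 0) A * SN (Suc 0) y"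
        using emb_pos Sob_norm_nonneg by (intro mult_left_mono **) auto
      then show "(\<lambda>t. A t * ?d y t) \<in> S 0" "SN 0 (\<lambda>t. A t * ?d y t) \<le> emb * SN (Suc 0) A * SN (Suc 0) y"
        using *[OF Sob_SucD(1)[OF y] A] by (auto simp: mult_ac simp del: Sob.simps)
    qed
    then show ?case using emb_pos by (intro exI[of _ "emb + 2 * emb"]) auto
  next
    case (Suc n)
    then obtain C where C: "C \<ge> 0" and IH: "\<And>A y. A \<in> S (Suc n) \<Longrightarrow> y \<in> S (Suc n) \<Longrightarrow>
        (\<lambda>t. A t * y t) \<in> S (Suc n) \<and> SN (Suc n) (\<lambda>t. A t * y t) \<le> C * SN (Suc n) A * SN (Suc n) y"
      by blast
    have d: "?d z \<in> S (Suc n)" "z \<in> S (Suc n)" "SN (Suc n) (?d z) \<le> SN (Suc (Suc n)) z"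
       "SN (Suc n) z \<le> SN (Suc (Suc n)) z" if "z \<in> S (Suc (Suc n))" for z
      using Sob_SucD(1)[OF that] Sob_Suc_subset[OF that] Sob_norm_nderiv[of "Suc n" "Suc 0" z]
        Sob_norm_Suc_le[of "Suc n" z] by simp_all
    have le: "C * SN (Suc n) u * SN (Suc n) v \<le> C * U * V"
      if "SN (Suc n) u \<le> U" "SN (Suc n) v \<le> V" for u v U V
      using that C Sob_norm_nonneg[of "Suc n" u] Sob_norm_nonneg[of "Suc n" v]
      by (intro mult_mono mult_left_mono mult_nonneg_nonneg) linarith+
    have "(\<lambda>t. A t * y t) \<in> S (Suc (Suc n)) \<and>
        SN (Suc (Suc n)) (\<lambda>t. A t * y t) \<le> (emb + 2 * C) * SN (Suc (Suc n)) A * SN (Suc (Suc n)) y"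
      if A: "A \<in> S (Suc (Suc n))" and y: "y \<in> S (Suc (Suc n))" for A y
    proof (rule step[OF A y C])
      show "(\<lambda>t. ?d A t * y t) \<in> S (Suc n)" "(\<lambda>t. A t * ?d y t) \<in> S (Suc n)"
        using IH d A y by blast+
      show "SN (Suc n) (\<lambda>t. ?d A t * y t) \<le> C * SN (Suc (Suc n)) A * SN (Suc (Suc n)) y"
        using IH[OF d(1)[OF A] d(2)[OF y]] le[OF d(3)[OF A] d(4)[OF y]] by linarith
      show "SN (Suc n) (\<lambda>t. A t * ?d y t) \<le> C * SN (Suc (Suc n)) A * SN (Suc (Suc n)) y"
        using IH[OF d(2)[OF A] d(1)[OF y]] le[OF d(4)[OF A] d(3)[OF y]] by linarith
    qed
    then show ?case using emb_pos C by (intro exI[of _ "emb + 2 * C"]) auto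
  qed
qed

end

section \<open>Gronwall's inequality\<close>

lemma integrable_mult_continuous:
  fixes \<beta> W :: "real \<Rightarrow> real"
  assumes \<beta>: "integrable (lebesgue_on {a..b}) \<beta>" and W: "continuous_on {a..b} W"
  shows "integrable (lebesgue_on {a..b}) (\<lambda>s. \<beta> s * W s)"
proof -
  obtain m where m: "\<And>t. t \<in> {a..b} \<Longrightarrow> norm (W t) \<le> m"
    using continuous_on_Icc_bounded[OF W] by blast
  have [measurable]: "W \<in> borel_measurable (lebesgue_on {a..b})" "\<beta> \<in> borel_measurable (lebesgue_on {a..b})"
    using W \<beta> by (auto intro: continuous_imp_measurable_on_sets_lebesgue borel_measurable_integrable)
  have "integrable (lebesgue_on {a..b}) (\<lambda>s. m * \<beta> s)" using \<beta> by simp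
  then show ?thesis
  proof (rule Bochner_Integration.integrable_bound)
    show "AE s in lebesgue_on {a..b}. norm (\<beta> s * W s) \<le> norm (m * \<beta> s)"
    proof (rule AE_I2)
      fix s assume "s \<in> space (lebesgue_on {a..b})"
      then have "norm (W s) \<le> \<bar>m\<bar>" using order_trans[OF m abs_ge_self] by simp
      from mult_right_mono[OF this, of "\<bar>\<beta> s\<bar>"] show "norm (\<beta> s * W s) \<le> norm (m * \<beta> s)"
        by (simp add: abs_mult mult.commute)
    qed
  qed measurable
qed

text \<open>The usual exponential is replaced by a finite march: the interval is cut so finely that
  \<open>\<beta>\<close> has integral below 1/2 over each step, and half of the maximum of
  \<open>W\<close> is absorbed on the left. The constant depends on \<open>\<beta>\<close> and the
  interval alone, being chosen before \<open>W\<close> and \<open>K\<close>.\<close>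

lemma gronwall_integrable:
  fixes \<beta> :: "real \<Rightarrow> real"
  assumes ab: "a < b" and \<beta>: "integrable (lebesgue_on {a..b}) \<beta>" "\<And>t. t \<in> {a..b} \<Longrightarrow> 0 \<le> \<beta> t"
  shows "\<exists>G\<ge>0. \<forall>W K. continuous_on {a..b} W \<longrightarrow>
    (\<forall>t\<in>{a..b}. 0 \<le> W t \<and> W t \<le> K + integral {a..t} (\<lambda>s. \<beta> s * W s)) \<longrightarrow> (\<forall>t\<in>{a..b}. W t \<le> G * K)"
proof -
  define \<phi> where "\<phi> t = integral {a..t} \<beta>" for t
  have \<beta>i: "\<beta> integrable_on {u..v}" if "a \<le> u" "v \<le> b" for u v
    by (rule integrable_on_subinterval[OF integrable_on_lebesgue_on[OF \<beta>(1)]]) (use that in auto)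
  have \<phi>d: "integral {u..v} \<beta> = \<phi> v - \<phi> u" if "a \<le> u" "u \<le> v" "v \<le> b" for u v
    using Henstock_Kurzweil_Integration.integral_combine[of a u v \<beta>] \<beta>i[of a v] that by (simp add: \<phi>_def)
  have \<phi>0: "0 \<le> \<phi> v - \<phi> u" if "a \<le> u" "u \<le> v" "v \<le> b" for u v
    unfolding \<phi>d[OF that, symmetric] using that
    by (intro Henstock_Kurzweil_Integration.integral_nonneg \<beta>i \<beta>(2)) auto
  have "continuous_on {a..b} \<phi>"
    unfolding \<phi>_def by (intro indefinite_integral_continuous_1 \<beta>i) auto
  then have "uniformly_continuous_on {a..b} \<phi>" by (intro compact_uniformly_continuous) auto
  then obtain \<delta> where \<delta>: "0 < \<delta>" "\<And>s t. s \<in> {a..b} \<Longrightarrow> t \<in> {a..b} \<Longrightarrow> dist t s < \<delta> \<Longrightarrow> dist (\<phi> t) (\<phi> s) < 1/2"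
    unfolding uniformly_continuous_on_def by (meson half_gt_zero zero_less_one)
  define P where "P W K \<longleftrightarrow> continuous_on {a..b} W \<and>
    (\<forall>t\<in>{a..b}. 0 \<le> W t \<and> W t \<le> K + integral {a..t} (\<lambda>s. \<beta> s * W s))" for W K
  have WI: "(\<lambda>s. \<beta> s * W s) integrable_on {u..v}" if W: "continuous_on {a..b} W" and uv: "a \<le> u" "v \<le> b" for W u v
    by (rule integrable_on_subinterval[OF integrable_on_lebesgue_on[OF integrable_mult_continuous[OF \<beta>(1) W]]])
       (use uv in auto)
  define \<Phi> where "\<Phi> = \<phi> b"
  have \<Phi>0: "0 \<le> \<Phi>" using \<phi>0[of a b] ab by (simp add: \<Phi>_def \<phi>_def)
  \<comment> \<open>The march advances by \<delta>/2 so that a step stays strictly below \<delta>,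
    as uniform continuity of \<open>\<phi>\<close> requires.\<close>
  have claim: "\<exists>G\<ge>0. \<forall>W K. P W K \<longrightarrow> (\<forall>t\<in>{a..b}. t \<le> a + real k * (\<delta>/2) \<longrightarrow> W t \<le> G * K)" for k
  proof (induction k)
    case 0
    have "W t \<le> 1 * K" if "P W K" "t \<in> {a..b}" "t \<le> a" for W K t
    proof -
      have "t = a" using that by simp
      then show ?thesis using that ab unfolding P_def by (force dest: bspec[of _ _ a])
    qed
    then show ?case by (intro exI[of _ 1]) auto
  next
    case (Suc k)
    then obtain G where G: "G \<ge> 0"
      and IH: "\<And>W K t. P W K \<Longrightarrow> t \<in> {a..b} \<Longrightarrow> t \<le> a + real k * (\<delta>/2) \<Longrightarrow> W t \<le> G * K" by blast
    \<comment> \<open>On the new step the maximum of W is at most K + G K \<Phi> plus half of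
      itself, which gives the second entry; the first keeps the bound already reached.\<close>
    have "W t \<le> max G (2 * (1 + G * \<Phi>)) * K"
      if P: "P W K" and t: "t \<in> {a..b}" "t \<le> a + real (Suc k) * (\<delta>/2)" for W K t
    proof -
      have cW: "continuous_on {a..b} W" and W0: "\<And>t. t \<in> {a..b} \<Longrightarrow> 0 \<le> W t"
        and We: "\<And>t. t \<in> {a..b} \<Longrightarrow> W t \<le> K + integral {a..t} (\<lambda>s. \<beta> s * W s)"
        using P by (auto simp: P_def)
      have "W a \<le> K + 0" using We[of a] ab by simp
      moreover have "0 \<le> W a" using W0[of a] ab by simp
      ultimately have K0: "0 \<le> K" by linarith
      define c where "c = a + real k * (\<delta>/2)"
      have ca: "a \<le> c" using \<delta>(1) by (simp add: c_def)
      show ?thesis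
      proof (cases "t \<le> c")
        case True
        then have "W t \<le> G * K" using IH[OF P t(1)] by (simp add: c_def)
        also have "\<dots> \<le> max G (2 * (1 + G * \<Phi>)) * K" using K0 by (intro mult_right_mono) auto
        finally show ?thesis .
      next
        case False
        have "real (Suc k) * (\<delta>/2) = real k * (\<delta>/2) + \<delta>/2" by (simp add: distrib_right)
        then have tc: "t < c + \<delta>" using t(2) \<delta>(1) unfolding c_def by linarith
        have cb: "c \<le> b" using False t(1) by simp
        have "continuous_on {c..t} W" using cW ca t(1) by (auto intro: continuous_on_subset)
        \<comment> \<open>A maximum point over the new step: there \<open>W\<close> can be pulled
          out of the integral and compared with its own value.\<close>
        then obtain \<tau> where \<tau>: "\<tau> \<in> {c..t}" "\<And>s. s \<in> {c..t} \<Longrightarrow> W s \<le> W \<tau>"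
          using continuous_attains_sup[of "{c..t}" W] False by auto
        have \<tau>I: "\<tau> \<in> {a..b}" "c \<le> \<tau>" using \<tau> ca t by auto
        have part1: "integral {a..c} (\<lambda>s. \<beta> s * W s) \<le> (G * K) * \<Phi>"
        proof -
          have "integral {a..c} (\<lambda>s. \<beta> s * W s) \<le> integral {a..c} (\<lambda>s. (G * K) * \<beta> s)"
          proof (rule integral_le)
            fix s assume s: "s \<in> {a..c}"
            then have "W s \<le> G * K" using IH[OF P, of s] cb by (simp add: c_def)
            then have "\<beta> s * W s \<le> \<beta> s * (G * K)" using \<beta>(2)[of s] s cb by (intro mult_left_mono) auto
            then show "\<beta> s * W s \<le> (G * K) * \<beta> s" by (simp add: mult.commute)
          qed (use WI[OF cW] \<beta>i ca cb in \<open>auto intro: integrable_on_mult_right\<close>)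
          also have "\<dots> = (G * K) * (\<phi> c - \<phi> a)" using \<phi>d[of a c] ca cb by simp
          also have "\<dots> \<le> (G * K) * \<Phi>"
            using \<phi>0[of c b] ca cb G K0 by (intro mult_left_mono) (auto simp: \<Phi>_def \<phi>_def)
          finally show ?thesis .
        qed
        have part2: "integral {c..\<tau>} (\<lambda>s. \<beta> s * W s) \<le> W \<tau> * (1/2)"
        proof -
          have "integral {c..\<tau>} (\<lambda>s. \<beta> s * W s) \<le> integral {c..\<tau>} (\<lambda>s. W \<tau> * \<beta> s)"
          proof (rule integral_le)
            fix s assume s: "s \<in> {c..\<tau>}"
            then have "W s \<le> W \<tau>" using \<tau> by auto
            then have "\<beta> s * W s \<le> \<beta> s * W \<tau>" using \<beta>(2)[of s] s ca \<tau>I by (intro mult_left_mono) auto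
            then show "\<beta> s * W s \<le> W \<tau> * \<beta> s" by (simp add: mult.commute)
          qed (use WI[OF cW] \<beta>i ca \<tau>I in \<open>auto intro: integrable_on_mult_right\<close>)
          also have "\<dots> = W \<tau> * (\<phi> \<tau> - \<phi> c)" using \<phi>d[of c \<tau>] ca \<tau>I by simp
          also have "\<dots> \<le> W \<tau> * (1/2)"
          proof (rule mult_left_mono)
            have "dist (\<phi> \<tau>) (\<phi> c) < 1/2"
              using \<tau> tc ca cb \<tau>I by (intro \<delta>(2)) (auto simp: dist_real_def)
            then show "\<phi> \<tau> - \<phi> c \<le> 1/2" unfolding dist_real_def by linarith
          qed (rule W0[OF \<tau>I(1)])
          finally show ?thesis .
        qed
        have "integral {a..c} (\<lambda>s. \<beta> s * W s) + integral {c..\<tau>} (\<lambda>s. \<beta> s * W s) = integral {a..\<tau>} (\<lambda>s. \<beta> s * W s)"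
          using ca \<tau>I WI[OF cW, of a \<tau>] by (intro Henstock_Kurzweil_Integration.integral_combine) auto
        moreover have "w \<le> 2 * (k + x)" if "i1 + i2 = i" "w \<le> k + i" "i1 \<le> x" "i2 \<le> w * (1/2)"
          for w k i i1 i2 x :: real using that by argo
        ultimately have "W \<tau> \<le> 2 * (K + (G * K) * \<Phi>)" using We[OF \<tau>I(1)] part1 part2 by blast
        also have "\<dots> = 2 * (1 + G * \<Phi>) * K" by (simp add: algebra_simps)
        also have "\<dots> \<le> max G (2 * (1 + G * \<Phi>)) * K" using K0 by (intro mult_right_mono) auto
        finally show ?thesis using \<tau>(2)[of t] False by force
      qed
    qed
    then show ?case using G by (intro exI[of _ "max G (2 * (1 + G * \<Phi>))"]) auto
  qed
  obtain k where k: "(b - a) / (\<delta>/2) \<le> real k" using real_arch_simple by blast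
  then have "b \<le> a + real k * (\<delta>/2)" using \<delta>(1) by (simp add: field_simps)
  moreover obtain G where "G \<ge> 0" "\<And>W K t. P W K \<Longrightarrow> t \<in> {a..b} \<Longrightarrow> t \<le> a + real k * (\<delta>/2) \<Longrightarrow> W t \<le> G * K"
    using claim[of k] by blast
  ultimately show ?thesis unfolding P_def by (intro exI[of _ G]) fastforce
qed

lemma has_vector_derivative_vec:
  fixes f :: "real \<Rightarrow> complex ^ 'm::finite"
  assumes "\<And>i. ((\<lambda>t. f t $ i) has_vector_derivative f' $ i) F"
  shows "(f has_vector_derivative f') F"
proof -
  have "((\<lambda>t. \<Sum>i\<in>UNIV. axis i (f t $ i)) has_vector_derivative (\<Sum>i\<in>UNIV. axis i (f' $ i))) F"
  proof (rule has_vector_derivative_sum)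
    fix i :: 'm
    have "bounded_linear (axis i :: complex \<Rightarrow> complex ^ 'm)"
      by (rule linear_conv_bounded_linear[THEN iffD1])
         (auto simp: linear_iff vec_eq_iff axis_def)
    from bounded_linear.has_vector_derivative[OF this assms]
    show "((\<lambda>t. axis i (f t $ i)) has_vector_derivative axis i (f' $ i)) F" .
  qed
  moreover have "(\<Sum>i\<in>UNIV. axis i (x $ i)) = x" for x :: "complex ^ 'm"
    by (simp add: vec_eq_iff axis_def if_distrib[of "\<lambda>f. f _"] sum.delta cong: if_cong)
  ultimately show ?thesis by simp
qed

section \<open>The differential operator on vector-valued functions\<close>

context lp_interval
begin

text \<open>The premise has the shape of the differential equation for solutions: everywhere if n is
  at least 1, almost everywhere if n = 0.\<close>

lemma Sob_cong_AE:
  assumes "if n \<ge> 1 then \<forall>t\<in>I. f t = g t else AE t in M. f t = g t" "f \<in> S n"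
  shows "g \<in> S n" "SN n g = SN n f"
proof -
  have "g \<in> S n \<and> SN n g = SN n f"
  proof (cases "n \<ge> 1")
    case True
    then show ?thesis using Sob_cong[of f g n] assms by auto
  next
    case False
    then have "n = 0" by simp
    then show ?thesis using Lp_cong_AE[of f g] assms by (simp add: Sob_norm_0)
  qed
  then show "g \<in> S n" "SN n g = SN n f" by auto
qed

lemma vSob_norm_nonneg: "0 \<le> VN n y"
  by (simp add: vSob_norm_def sum_nonneg Sob_norm_nonneg)

lemma Sob_norm_le_vSob_norm: "SN n (\<lambda>t. y t $ i) \<le> VN n y"
  unfolding vSob_norm_def by (rule member_le_sum) (auto simp: Sob_norm_nonneg)

lemma vSobD: "y \<in> VS n \<Longrightarrow> (\<lambda>t. y t $ i) \<in> S n"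
  by (simp add: vSob_def)

lemma vSob_lincomb:
  assumes "y \<in> VS n" "z \<in> VS n"
  shows "(\<lambda>t. c *s y t + d *s z t) \<in> VS n"
    "VN n (\<lambda>t. c *s y t + d *s z t) \<le> cmod c * VN n y + cmod d * VN n z"
proof -
  show "(\<lambda>t. c *s y t + d *s z t) \<in> VS n"
    using assms Sob_lincomb(1) by (simp add: vSob_def)
  have "VN n (\<lambda>t. c *s y t + d *s z t) \<le>
     (\<Sum>i\<in>UNIV. cmod c * SN n (\<lambda>t. y t $ i) + cmod d * SN n (\<lambda>t. z t $ i))"
    unfolding vSob_norm_def using Sob_lincomb(2)[OF vSobD[OF assms(1)] vSobD[OF assms(2)]]
    by (intro sum_mono) simp
  then show "VN n (\<lambda>t. c *s y t + d *s z t) \<le> cmod c * VN n y + cmod d * VN n z"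
    by (simp add: vSob_norm_def sum.distrib sum_distrib_left)
qed

lemma vSob_add:
  assumes "y \<in> VS n" "z \<in> VS n"
  shows "(\<lambda>t. y t + z t) \<in> VS n"
    "VN n (\<lambda>t. y t + z t) \<le> VN n y + VN n z"
  using vSob_lincomb[OF assms, of 1 1] by simp_all

lemma vSob_diff:
  assumes "y \<in> VS n" "z \<in> VS n"
  shows "(\<lambda>t. y t - z t) \<in> VS n"
    "VN n (\<lambda>t. y t - z t) \<le> VN n y + VN n z"
  using vSob_lincomb[OF assms, of 1 "-1"] by (simp_all add: vector_sneg_minus1[symmetric])

lemma vSob_scale:
  assumes "y \<in> VS n"
  shows "(\<lambda>t. c *s y t) \<in> VS n"
    "VN n (\<lambda>t. c *s y t) = cmod c * VN n y"
  using assms Sob_scale(1,2) by (auto simp: vSob_def vSob_norm_def sum_distrib_left)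

lemma vSob_zero: "(\<lambda>t. 0) \<in> VS n" "VN n (\<lambda>t. 0) = 0"
  using Sob_zero by (simp_all add: vSob_def vSob_norm_def)

lemma vSob_norm_minus_commute:
  "VN n (\<lambda>t. y t - z t) = VN n (\<lambda>t. z t - y t)"
  if "y \<in> VS n" "z \<in> VS n"
  using vSob_scale(2)[OF vSob_diff(1)[OF that], of "-1"] by (simp add: vector_sneg_minus1[symmetric])

lemma vSob_complete:
  fixes f :: "nat \<Rightarrow> real \<Rightarrow> complex ^ 'm::finite"
  assumes f: "\<And>k. f k \<in> VS n"
    and C: "\<And>e. 0 < e \<Longrightarrow> \<exists>N. \<forall>i\<ge>N. \<forall>j\<ge>N. VN n (\<lambda>t. f i t - f j t) \<le> e"
  shows "\<exists>g\<in>VS n. (\<lambda>k. VN n (\<lambda>t. f k t - g t)) \<longlonglongrightarrow> 0"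
proof -
  have "\<exists>g\<in>S n. (\<lambda>k. SN n (\<lambda>t. f k t $ i - g t)) \<longlonglongrightarrow> 0" for i
  proof (rule Sob_complete[OF vSobD[OF f]])
    fix e :: real assume "0 < e"
    from C[OF this] obtain N where "\<forall>k\<ge>N. \<forall>j\<ge>N. VN n (\<lambda>t. f k t - f j t) \<le> e" by blast
    moreover have "SN n (\<lambda>t. f k t $ i - f j t $ i) \<le> VN n (\<lambda>t. f k t - f j t)" for k j
      using Sob_norm_le_vSob_norm[of n "\<lambda>t. f k t - f j t" i] by simp
    ultimately show "\<exists>N. \<forall>k\<ge>N. \<forall>j\<ge>N. SN n (\<lambda>t. f k t $ i - f j t $ i) \<le> e"
      using order_trans by blast
  qed
  then have "\<forall>i. \<exists>g. g \<in> S n \<and> (\<lambda>k. SN n (\<lambda>t. f k t $ i - g t)) \<longlonglongrightarrow> 0" by blast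
  from choice[OF this] obtain g where
    g: "\<And>i. g i \<in> S n" "\<And>i. (\<lambda>k. SN n (\<lambda>t. f k t $ i - g i t)) \<longlonglongrightarrow> 0" by blast
  have "(\<lambda>k. \<Sum>i\<in>UNIV. SN n (\<lambda>t. f k t $ i - g i t)) \<longlonglongrightarrow> (\<Sum>i\<in>(UNIV::'m set). 0)"
    by (intro tendsto_sum g(2))
  then show ?thesis
    using g(1) by (intro bexI[of _ "\<lambda>t. \<chi> i. g i t"]) (simp_all add: vSob_def vSob_norm_def)
qed

lemma nderiv_vec_step:
  fixes y :: "real \<Rightarrow> complex ^ 'm::finite"
  assumes eq: "\<And>i s. s \<in> I \<Longrightarrow> nderiv a b j y s $ i = D j (\<lambda>t. y t $ i) s" and t: "t \<in> I"
    and d: "\<And>i. D j (\<lambda>t. y t $ i) differentiable (at t within I)"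
  shows "nderiv a b (Suc j) y t $ i = D (Suc j) (\<lambda>t. y t $ i) t"
proof -
  define v where "v = (\<chi> i. D (Suc j) (\<lambda>t. y t $ i) t)"
  have "((\<lambda>s. nderiv a b j y s $ i) has_vector_derivative v $ i) (at t within I)" for i
  proof -
    have "(D j (\<lambda>t. y t $ i) has_vector_derivative v $ i) (at t within I)"
      using d[of i] by (simp add: v_def nderiv_Suc vector_derivative_works[symmetric])
    then show ?thesis
      using has_vector_derivative_within_cong[of I "\<lambda>s. nderiv a b j y s $ i" "D j (\<lambda>t. y t $ i)" t] eq t by blast
  qed
  then have "(nderiv a b j y has_vector_derivative v) (at t within I)" by (rule has_vector_derivative_vec)
  from vector_derivative_within_closed_interval[OF ab t this] show ?thesis
    by (simp add: nderiv_Suc v_def)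
qed

text \<open>Functions in W_p^n lie in C^(n-1), so n - 1 is the last order given by continuity, and
  its own derivative is known only almost everywhere.\<close>

lemma Sob_differentiable:
  assumes "y \<in> S n"
  shows "\<And>j t. Suc j < n \<Longrightarrow> t \<in> I \<Longrightarrow> D j y differentiable (at t within I)"
    "n = Suc j \<Longrightarrow> AE t in M. D j y differentiable (at t within I)"
  using assms by (cases n; force simp: C_on_def)+

text \<open>Needed because \<open>diff_op\<close> differentiates the vector function while the norms
  differentiate its components. If some component has no derivative at a point, the arbitrary vector
  value need not have matching components.\<close>

lemma nderiv_vec:
  fixes y :: "real \<Rightarrow> complex ^ 'm::finite"
  assumes y: "y \<in> VS n"
  shows "\<And>j t i. j < n \<Longrightarrow> t \<in> I \<Longrightarrow> nderiv a b j y t $ i = D j (\<lambda>t. y t $ i) t"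
    "AE t in M. \<forall>i. nderiv a b n y t $ i = D n (\<lambda>t. y t $ i) t"
proof -
  have 1: "\<forall>t\<in>I. \<forall>i. nderiv a b j y t $ i = D j (\<lambda>t. y t $ i) t" if "j < n" for j
    using that
  proof (induction j)
    case (Suc j)
    then have IH: "\<forall>t\<in>I. \<forall>i. nderiv a b j y t $ i = D j (\<lambda>t. y t $ i) t" by simp
    show ?case
    proof (intro ballI allI)
      fix t i assume "t \<in> I"
      then show "nderiv a b (Suc j) y t $ i = D (Suc j) (\<lambda>t. y t $ i) t"
        using IH Sob_differentiable(1)[OF vSobD[OF y] Suc.prems] by (intro nderiv_vec_step) auto
    qed
  qed simp
  then show "\<And>j t i. j < n \<Longrightarrow> t \<in> I \<Longrightarrow> nderiv a b j y t $ i = D j (\<lambda>t. y t $ i) t" by blast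
  show "AE t in M. \<forall>i. nderiv a b n y t $ i = D n (\<lambda>t. y t $ i) t"
  proof (cases n)
    case (Suc j)
    have "AE t in M. \<forall>i\<in>UNIV. D j (\<lambda>t. y t $ i) differentiable (at t within I)"
      using Sob_differentiable(2)[OF vSobD[OF y] Suc] by (intro AE_finite_allI) auto
    moreover have "AE t in M. t \<in> I" by (rule AE_M_I)
    ultimately show ?thesis
    proof eventually_elim
      case (elim t)
      show ?case
      proof
        fix i
        show "nderiv a b n y t $ i = D n (\<lambda>t. y t $ i) t"
          unfolding Suc using 1[of j] elim Suc by (intro nderiv_vec_step) auto
      qed
    qed
  qed simp
qed

text \<open>\<open>LO\<close> and \<open>PO\<close> are the components of the differential expression and of its part of order
  less than \<open>r\<close>, written through the scalar derivatives of the components of \<open>y\<close>.\<close>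

definition PO :: "nat \<Rightarrow> (nat \<Rightarrow> real \<Rightarrow> complex ^ 'm::finite ^ 'm) \<Rightarrow> (real \<Rightarrow> complex ^ 'm) \<Rightarrow> 'm \<Rightarrow> real \<Rightarrow> complex"
  where "PO r A y i t = (\<Sum>l=1..r. \<Sum>j\<in>UNIV. A (r - l) t $ i $ j * D (r - l) (\<lambda>t. y t $ j) t)"

definition LO :: "nat \<Rightarrow> (nat \<Rightarrow> real \<Rightarrow> complex ^ 'm::finite ^ 'm) \<Rightarrow> (real \<Rightarrow> complex ^ 'm) \<Rightarrow> 'm \<Rightarrow> real \<Rightarrow> complex"
  where "LO r A y i t = D r (\<lambda>t. y t $ i) t + PO r A y i t"

text \<open>The norm of L y in (W_p^n)^m, formed from \<open>LO\<close> rather than from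
  \<open>diff_op\<close>, since these may differ on a null set when n = 0.\<close>

definition LN :: "nat \<Rightarrow> nat \<Rightarrow> (nat \<Rightarrow> real \<Rightarrow> complex ^ 'm::finite ^ 'm) \<Rightarrow> (real \<Rightarrow> complex ^ 'm) \<Rightarrow> real"
  where "LN n r A y = (\<Sum>i\<in>UNIV. SN n (LO r A y i))"

definition MN :: "nat \<Rightarrow> nat \<Rightarrow> (nat \<Rightarrow> real \<Rightarrow> complex ^ 'm::finite ^ 'm) \<Rightarrow> real"
  where "MN n r A = (\<Sum>l=1..r. mSob_norm a b n p (A (r - l)))"

lemma LN_nonneg: "0 \<le> LN n r A y"
  by (simp add: LN_def sum_nonneg Sob_norm_nonneg)

lemma MN_nonneg: "0 \<le> MN n r A"
  by (simp add: MN_def mSob_norm_def sum_nonneg Sob_norm_nonneg)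

text \<open>Derivatives of order below r are matched everywhere. The term of order r is exceptional
  only for n = 0, when r is the top order of the space.\<close>

lemma diff_op_LO:
  assumes y: "y \<in> VS (n + r)" and r: "r \<ge> 1"
  shows "if n \<ge> 1 then \<forall>t\<in>I. \<forall>i. diff_op a b r A y t $ i = LO r A y i t
    else AE t in M. \<forall>i. diff_op a b r A y t $ i = LO r A y i t"
proof -
  have *: "\<forall>i. diff_op a b r A y t $ i = LO r A y i t"
    if "t \<in> I" "\<forall>i. nderiv a b r y t $ i = D r (\<lambda>t. y t $ i) t" for t
  proof -
    have "nderiv a b (r - l) y t $ j = D (r - l) (\<lambda>t. y t $ j) t" if "l \<in> {1..r}" for l j
      using that \<open>t \<in> I\<close> by (intro nderiv_vec(1)[OF y]) auto
    then show ?thesis using that(2)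
      by (simp add: diff_op_def LO_def PO_def matrix_vector_mult_def)
  qed
  show ?thesis
  proof (cases "n \<ge> 1")
    case True
    then show ?thesis using * nderiv_vec(1)[OF y, of r] by simp
  next
    case False
    then have "n = 0" by simp
    then have "AE t in M. \<forall>i. nderiv a b r y t $ i = D r (\<lambda>t. y t $ i) t"
      using nderiv_vec(2)[OF y] by simp
    moreover have "AE t in M. t \<in> I" by (rule AE_M_I)
    ultimately have "AE t in M. \<forall>i. diff_op a b r A y t $ i = LO r A y i t"
      by eventually_elim (use * in blast)
    then show ?thesis using False by simp
  qed
qed

text \<open>The bound \<open>T\<close> for the solution factor is left open for two uses: a multiple
  of the Sobolev norm of \<open>y\<close> when the operator is bounded from above, and a multiple of
  Cauchy data plus residual in the a priori estimate.\<close>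

lemma PO_bound:
  assumes "\<And>l i j. l \<in> {1..r} \<Longrightarrow> (\<lambda>t. A (r - l) t $ i $ j * D (r - l) (\<lambda>t. y t $ j) t) \<in> S m \<and>
      SN m (\<lambda>t. A (r - l) t $ i $ j * D (r - l) (\<lambda>t. y t $ j) t) \<le> T * SN m (\<lambda>t. A (r - l) t $ i $ j)"
  shows "PO r A y i \<in> S m" "(\<Sum>i\<in>UNIV. SN m (PO r A y i)) \<le> T * MN m r A"
proof -
  let ?f = "\<lambda>l i j t. A (r - l) t $ i $ j * D (r - l) (\<lambda>t. y t $ j) t"
  have in1: "(\<lambda>t. \<Sum>j\<in>UNIV. ?f l i j t) \<in> S m \<and>
      SN m (\<lambda>t. \<Sum>j\<in>UNIV. ?f l i j t) \<le> T * (\<Sum>j\<in>UNIV. SN m (\<lambda>t. A (r - l) t $ i $ j))"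
    if "l \<in> {1..r}" for l i
  proof
    have fS: "?f l i j \<in> S m" for j using assms[OF that] by blast
    show "(\<lambda>t. \<Sum>j\<in>UNIV. ?f l i j t) \<in> S m" by (rule Sob_sum(1)) (simp_all add: fS)
    have "SN m (\<lambda>t. \<Sum>j\<in>UNIV. ?f l i j t) \<le> (\<Sum>j\<in>UNIV. SN m (?f l i j))"
      by (rule Sob_sum(2)) (simp_all add: fS)
    also have "\<dots> \<le> (\<Sum>j\<in>UNIV. T * SN m (\<lambda>t. A (r - l) t $ i $ j))"
      using assms[OF that] by (intro sum_mono) auto
    finally show "SN m (\<lambda>t. \<Sum>j\<in>UNIV. ?f l i j t) \<le> T * (\<Sum>j\<in>UNIV. SN m (\<lambda>t. A (r - l) t $ i $ j))"
      by (simp add: sum_distrib_left)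
  qed
  have eq: "PO r A y i = (\<lambda>t. \<Sum>l=1..r. \<Sum>j\<in>UNIV. ?f l i j t)" for i
    by (rule ext) (simp add: PO_def)
  show "PO r A y i \<in> S m" for i
    unfolding eq by (rule Sob_sum(1)) (use in1 in blast)+
  have "SN m (PO r A y i) \<le> (\<Sum>l=1..r. T * (\<Sum>j\<in>UNIV. SN m (\<lambda>t. A (r - l) t $ i $ j)))" for i
  proof -
    have "SN m (PO r A y i) \<le> (\<Sum>l=1..r. SN m (\<lambda>t. \<Sum>j\<in>UNIV. ?f l i j t))"
      unfolding eq by (rule Sob_sum(2)) (use in1 in blast)+
    also have "\<dots> \<le> (\<Sum>l=1..r. T * (\<Sum>j\<in>UNIV. SN m (\<lambda>t. A (r - l) t $ i $ j)))"
      using in1 by (intro sum_mono) auto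
    finally show ?thesis .
  qed
  then have "(\<Sum>i\<in>UNIV. SN m (PO r A y i)) \<le> (\<Sum>i\<in>UNIV. \<Sum>l=1..r. T * (\<Sum>j\<in>UNIV. SN m (\<lambda>t. A (r - l) t $ i $ j)))"
    by (rule sum_mono)
  also have "\<dots> = (\<Sum>l=1..r. \<Sum>i\<in>UNIV. T * (\<Sum>j\<in>UNIV. SN m (\<lambda>t. A (r - l) t $ i $ j)))"
    by (rule sum.swap)
  also have "\<dots> = T * MN m r A"
    by (simp add: MN_def mSob_norm_def sum_distrib_left)
  finally show "(\<Sum>i\<in>UNIV. SN m (PO r A y i)) \<le> T * MN m r A" .
qed

text \<open>The extra order on \<open>y\<close> makes the product estimate valid for n = 0 too,
  where \<open>A\<close> is merely in L_p but \<open>y\<close> is bounded.\<close>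

lemma Sob_mult_Suc:
  "\<exists>C\<ge>0. \<forall>A\<in>S n. \<forall>y\<in>S (Suc n). (\<lambda>t. A t * y t) \<in> S n \<and> SN n (\<lambda>t. A t * y t) \<le> C * SN (Suc n) y * SN n A"
proof (cases n)
  case 0
  have "(\<lambda>t. A t * y t) \<in> S 0 \<and> SN 0 (\<lambda>t. A t * y t) \<le> emb * SN (Suc 0) y * SN 0 A"
    if A: "A \<in> S 0" and y: "y \<in> S (Suc 0)" for A y
    using emb_pos Sob_norm_nonneg[of "Suc 0" y] Sob_sup_bound[OF y]
      LP_mult_bounded[OF Sob_LP[OF A] Sob_Suc_continuous[OF y], of "emb * SN (Suc 0) y"]
    by (auto simp: Sob_norm_0)
  then show ?thesis using 0 emb_pos by (intro exI[of _ emb]) auto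
next
  case (Suc m)
  obtain C where C: "C \<ge> 0" "\<And>A y. A \<in> S n \<Longrightarrow> y \<in> S n \<Longrightarrow> (\<lambda>t. A t * y t) \<in> S n \<and>
     SN n (\<lambda>t. A t * y t) \<le> C * SN n A * SN n y"
    using Sob_mult[of m] Suc by blast
  have "(\<lambda>t. A t * y t) \<in> S n \<and> SN n (\<lambda>t. A t * y t) \<le> C * SN (Suc n) y * SN n A"
    if A: "A \<in> S n" and y: "y \<in> S (Suc n)" for A y
  proof -
    have "C * SN n A * SN n y \<le> C * SN n A * SN (Suc n) y"
      using C(1) Sob_norm_nonneg by (intro mult_left_mono Sob_norm_Suc_le) auto
    then show ?thesis using C(2)[OF A Sob_Suc_subset[OF y]] by (auto simp: mult_ac)
  qed
  then show ?thesis using C(1) by blast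
qed

text \<open>Since l is at least 1, at least one order above k is left after r - l differentiations;
  this spare order is what products with coefficients use.\<close>

lemma nderiv_lower:
  assumes y: "y \<in> S (k + r)" and l: "l \<in> {1..r}"
  shows "D (r - l) y \<in> S (Suc k)" "SN (Suc k) (D (r - l) y) \<le> SN (k + r) y"
proof -
  have eq: "k + r = (k + l) + (r - l)" using l by auto
  have "D (r - l) y \<in> S (k + l)" using y unfolding eq by (rule Sob_nderiv)
  then show "D (r - l) y \<in> S (Suc k)" using l by (intro Sob_subset[of "Suc k" "k + l"]) auto
  have "SN (Suc k) (D (r - l) y) \<le> SN (k + l) (D (r - l) y)" using l by (intro Sob_norm_mono) auto
  also have "\<dots> \<le> SN (k + r) y" using Sob_norm_nderiv[of "k + l" "r - l" y] unfolding eq .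
  finally show "SN (Suc k) (D (r - l) y) \<le> SN (k + r) y" .
qed

lemma mSobD: "X \<in> MS n \<Longrightarrow> (\<lambda>t. X t $ i $ j) \<in> S n"
  by (simp add: mSob_def)

lemma PO_Sob_bound:
  "\<exists>C\<ge>0. \<forall>A. \<forall>y :: real \<Rightarrow> complex ^ 'm::finite. (\<forall>l\<in>{1..r}. A (r - l) \<in> MS n) \<longrightarrow> y \<in> VS (n + r) \<longrightarrow>
     (\<forall>i. PO r A y i \<in> S n) \<and> (\<Sum>i\<in>UNIV. SN n (PO r A y i)) \<le> C * MN n r A * VN (n + r) y"
proof -
  obtain C where C: "C \<ge> 0" "\<And>A y. A \<in> S n \<Longrightarrow> y \<in> S (Suc n) \<Longrightarrow>
     (\<lambda>t. A t * y t) \<in> S n \<and> SN n (\<lambda>t. A t * y t) \<le> C * SN (Suc n) y * SN n A"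
    using Sob_mult_Suc[of n] by blast
  have "(\<forall>i. PO r A y i \<in> S n) \<and> (\<Sum>i\<in>UNIV. SN n (PO r A y i)) \<le> (C * VN (n + r) y) * MN n r A"
    if A: "\<forall>l\<in>{1..r}. A (r - l) \<in> MS n" and y: "y \<in> VS (n + r)"
    for A and y :: "real \<Rightarrow> complex ^ 'm"
  proof -
    have "(\<lambda>t. A (r - l) t $ i $ j * D (r - l) (\<lambda>t. y t $ j) t) \<in> S n \<and>
      SN n (\<lambda>t. A (r - l) t $ i $ j * D (r - l) (\<lambda>t. y t $ j) t) \<le>
       (C * VN (n + r) y) * SN n (\<lambda>t. A (r - l) t $ i $ j)" if l: "l \<in> {1..r}" for l i j
    proof -
      have Al: "(\<lambda>t. A (r - l) t $ i $ j) \<in> S n" using A l mSobD by blast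
      note lo = nderiv_lower[OF vSobD[OF y] l]
      have "C * SN (Suc n) (D (r - l) (\<lambda>t. y t $ j)) * SN n (\<lambda>t. A (r - l) t $ i $ j) \<le>
         (C * VN (n + r) y) * SN n (\<lambda>t. A (r - l) t $ i $ j)"
        using order_trans[OF lo(2) Sob_norm_le_vSob_norm] C(1)
        by (intro mult_right_mono mult_left_mono Sob_norm_nonneg) auto
      then show ?thesis using C(2)[OF Al lo(1)] by (meson order_trans)
    qed
    from PO_bound[OF this] show ?thesis by blast
  qed
  then show ?thesis using C(1) by (intro exI[of _ C]) (auto simp: mult_ac)
qed

lemma PO_Sob:
  assumes "\<forall>l\<in>{1..r}. A (r - l) \<in> MS n" "y \<in> VS (n + r)"
  shows "PO r A y i \<in> S n"
  using PO_Sob_bound[of r n] assms by blast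

lemma LO_Sob:
  assumes A: "\<forall>l\<in>{1..r}. A (r - l) \<in> MS n" and y: "y \<in> VS (n + r)"
  shows "LO r A y i \<in> S n"
  using Sob_add(1)[OF Sob_nderiv[OF vSobD[OF y]] PO_Sob[OF A y]] by (simp add: LO_def[abs_def])

lemma LO_lincomb:
  assumes y: "y \<in> VS (n + r)" and z: "z \<in> VS (n + r)"
  shows "if n \<ge> 1 then \<forall>t\<in>I. LO r A (\<lambda>t. c *s y t + d *s z t) i t = c * LO r A y i t + d * LO r A z i t
    else AE t in M. LO r A (\<lambda>t. c *s y t + d *s z t) i t = c * LO r A y i t + d * LO r A z i t"
proof -
  let ?c = "\<lambda>j t. c * y t $ j + d * z t $ j"
  note lc = Sob_lincomb(3)[OF vSobD[OF y] vSobD[OF z]]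
  have *: "LO r A (\<lambda>t. c *s y t + d *s z t) i t = c * LO r A y i t + d * LO r A z i t"
    if "t \<in> I" "D r (?c i) t = c * D r (\<lambda>t. y t $ i) t + d * D r (\<lambda>t. z t $ i) t" for t
  proof -
    have "D (r - l) (?c j) t = c * D (r - l) (\<lambda>t. y t $ j) t + d * D (r - l) (\<lambda>t. z t $ j) t"
      if "l \<in> {1..r}" for l j
      using that \<open>t \<in> I\<close> by (intro lc) auto
    then have "PO r A (\<lambda>t. c *s y t + d *s z t) i t = c * PO r A y i t + d * PO r A z i t"
      by (simp add: PO_def sum.distrib[symmetric] sum_distrib_left algebra_simps)
    then show ?thesis using that(2) by (simp add: LO_def algebra_simps)
  qed
  show ?thesis
  proof (cases "n \<ge> 1")
    case True
    then show ?thesis using * lc[of r] by simp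
  next
    case False
    then have "n = 0" by simp
    then have "AE t in M. D r (?c i) t = c * D r (\<lambda>t. y t $ i) t + d * D r (\<lambda>t. z t $ i) t"
      using Sob_lincomb(4)[OF vSobD[OF y, of i] vSobD[OF z, of i], where c = c and d = d] by simp
    moreover have "AE t in M. t \<in> I" by (rule AE_M_I)
    ultimately have "AE t in M. LO r A (\<lambda>t. c *s y t + d *s z t) i t = c * LO r A y i t + d * LO r A z i t"
      by eventually_elim (use * in blast)
    then show ?thesis using False by simp
  qed
qed

lemma LN_lincomb:
  fixes y z :: "real \<Rightarrow> complex ^ 'm::finite"
  assumes A: "\<forall>l\<in>{1..r}. A (r - l) \<in> MS n"
    and y: "y \<in> VS (n + r)" and z: "z \<in> VS (n + r)"
  shows "LN n r A (\<lambda>t. c *s y t + d *s z t) \<le> cmod c * LN n r A y + cmod d * LN n r A z"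
proof -
  have "SN n (LO r A (\<lambda>t. c *s y t + d *s z t) i) \<le> cmod c * SN n (LO r A y i) + cmod d * SN n (LO r A z i)" for i
  proof -
    have "SN n (\<lambda>t. c * LO r A y i t + d * LO r A z i t) = SN n (LO r A (\<lambda>t. c *s y t + d *s z t) i)"
      by (rule Sob_cong_AE(2)[OF LO_lincomb[OF y z] LO_Sob[OF A vSob_lincomb(1)[OF y z]]])
    then show ?thesis using Sob_lincomb(2)[OF LO_Sob[OF A y, of i] LO_Sob[OF A z, of i], of c d] by simp
  qed
  then have "LN n r A (\<lambda>t. c *s y t + d *s z t) \<le> (\<Sum>i\<in>UNIV. cmod c * SN n (LO r A y i) + cmod d * SN n (LO r A z i))"
    unfolding LN_def by (rule sum_mono)
  then show ?thesis by (simp add: LN_def sum.distrib sum_distrib_left)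
qed

lemma LN_bounded:
  fixes A :: "nat \<Rightarrow> real \<Rightarrow> complex ^ 'm::finite ^ 'm"
  assumes A: "\<forall>l\<in>{1..r}. A (r - l) \<in> MS n"
  obtains C where "0 \<le> C" "\<And>y. y \<in> VS (n + r) \<Longrightarrow> LN n r A y \<le> C * VN (n + r) y"
proof -
  obtain C where C: "C \<ge> 0" "\<And>A y :: real \<Rightarrow> complex ^ 'm. (\<forall>l\<in>{1..r}. A (r - l) \<in> MS n) \<Longrightarrow> y \<in> VS (n + r) \<Longrightarrow>
     (\<Sum>i\<in>UNIV. SN n (PO r A y i)) \<le> C * MN n r A * VN (n + r) y"
    using PO_Sob_bound[of r n, where 'm = 'm] by blast
  have "LN n r A y \<le> (1 + C * MN n r A) * VN (n + r) y" if y: "y \<in> VS (n + r)" for y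
  proof -
    have "SN n (LO r A y i) \<le> SN (n + r) (\<lambda>t. y t $ i) + SN n (PO r A y i)" for i
      using Sob_add(2)[OF Sob_nderiv[OF vSobD[OF y, of i]] PO_Sob[OF A y, of i]]
        Sob_norm_nderiv[of n r "\<lambda>t. y t $ i"] unfolding LO_def[abs_def] by linarith
    then have "LN n r A y \<le> (\<Sum>i\<in>UNIV. SN (n + r) (\<lambda>t. y t $ i) + SN n (PO r A y i))"
      unfolding LN_def by (rule sum_mono)
    also have "\<dots> \<le> VN (n + r) y + C * MN n r A * VN (n + r) y"
      using C(2)[OF A y] by (simp add: sum.distrib vSob_norm_def)
    finally show ?thesis by (simp add: algebra_simps)
  qed
  moreover have "0 \<le> 1 + C * MN n r A" using C MN_nonneg[of n r A] by simp
  ultimately show ?thesis using that by blast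
qed

text \<open>The leading terms of two such operators coincide, so they differ by a lower-order
  operator whose coefficients are the differences.\<close>

lemma LN_perturb:
  "\<exists>C\<ge>0. \<forall>A A'. \<forall>y :: real \<Rightarrow> complex ^ 'm::finite. (\<forall>l\<in>{1..r}. A (r - l) \<in> MS n) \<longrightarrow>
     (\<forall>l\<in>{1..r}. A' (r - l) \<in> MS n) \<longrightarrow> y \<in> VS (n + r) \<longrightarrow>
     LN n r A y \<le> LN n r A' y + C * MN n r (\<lambda>j t. A j t - A' j t) * VN (n + r) y"
proof -
  obtain C where C: "C \<ge> 0" "\<And>A y :: real \<Rightarrow> complex ^ 'm. (\<forall>l\<in>{1..r}. A (r - l) \<in> MS n) \<Longrightarrow> y \<in> VS (n + r) \<Longrightarrow>
     (\<Sum>i\<in>UNIV. SN n (PO r A y i)) \<le> C * MN n r A * VN (n + r) y"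
    using PO_Sob_bound[of r n, where 'm = 'm] by blast
  have "LN n r A y \<le> LN n r A' y + C * MN n r (\<lambda>j t. A j t - A' j t) * VN (n + r) y"
    if A: "\<forall>l\<in>{1..r}. A (r - l) \<in> MS n" and A': "\<forall>l\<in>{1..r}. A' (r - l) \<in> MS n"
      and y: "y \<in> VS (n + r)"
    for A A' and y :: "real \<Rightarrow> complex ^ 'm"
  proof -
    let ?d = "\<lambda>j t. A j t - A' j t"
    have d: "\<forall>l\<in>{1..r}. ?d (r - l) \<in> MS n"
      using A A' Sob_diff(1) by (simp add: mSob_def)
    have "LO r A y i = (\<lambda>t. LO r A' y i t + PO r ?d y i t)" for i
      by (rule ext) (simp add: LO_def PO_def sum.distrib[symmetric] algebra_simps)
    then have "SN n (LO r A y i) \<le> SN n (LO r A' y i) + SN n (PO r ?d y i)" for i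
      using Sob_add(2)[OF LO_Sob[OF A' y] PO_Sob[OF d y]] by simp
    then have "LN n r A y \<le> (\<Sum>i\<in>UNIV. SN n (LO r A' y i) + SN n (PO r ?d y i))"
      unfolding LN_def by (rule sum_mono)
    also have "\<dots> \<le> LN n r A' y + C * MN n r ?d * VN (n + r) y"
      using C(2)[OF d y] by (simp add: sum.distrib LN_def)
    finally show ?thesis .
  qed
  then show ?thesis using C(1) by blast
qed

section \<open>The a priori estimate\<close>

lemma LP_norm_integral:
  assumes h: "h \<in> LP" and t: "t \<in> I"
  shows "(\<lambda>s. cmod (h s)) integrable_on {a..t}" "integral {a..t} (\<lambda>s. cmod (h s)) \<le> (b - a + 1) * nrm h"
proof -
  have hi: "integrable M (\<lambda>s. cmod (h s))" using Lp_integrable(1)[OF h] by (rule integrable_norm)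
  have sub: "{a..t} \<subseteq> I" using t by auto
  have hu: "integrable (lebesgue_on {a..t}) (\<lambda>s. cmod (h s))"
    by (rule integrable_lebesgue_on_subset[OF hi _ sub]) auto
  then show "(\<lambda>s. cmod (h s)) integrable_on {a..t}" by (rule integrable_on_lebesgue_on) auto
  have "integral {a..t} (\<lambda>s. cmod (h s)) = (\<integral>s. cmod (h s) \<partial>(lebesgue_on {a..t}))"
    by (simp add: lebesgue_integral_eq_integral[OF hu])
  also have "\<dots> \<le> (\<integral>s. cmod (h s) \<partial>M)"
    by (rule integral_mono_lebesgue_on_AE[OF hi _ _ sub]) auto
  also have "\<dots> \<le> (b - a + 1) * nrm h" by (rule Lp_integrable(2)[OF h])
  finally show "integral {a..t} (\<lambda>s. cmod (h s)) \<le> (b - a + 1) * nrm h" .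
qed

text \<open>The Cauchy data at \<open>a\<close>, measured in the l1 norm.\<close>

definition ini :: "nat \<Rightarrow> (real \<Rightarrow> complex ^ 'm::finite) \<Rightarrow> real" where
  "ini r y = (\<Sum>j<r. \<Sum>i\<in>UNIV. cmod (D j (\<lambda>t. y t $ i) a))"

lemma ini_nonneg: "0 \<le> ini r y"
  by (simp add: ini_def sum_nonneg)

lemma nderiv_below_order:
  assumes y: "y \<in> S (n + r)" and j: "j < r"
  shows "continuous_on I (D j y)" "primitive (D j y) (D (Suc j) y)" "D (Suc j) y \<in> LP"
proof -
  obtain k where k: "n + r = Suc k + j" using j by (metis add.commute add_Suc_right less_imp_Suc_add add.left_commute)
  have "D j y \<in> S (Suc k)" using y unfolding k by (rule Sob_nderiv)
  then show "continuous_on I (D j y)" "primitive (D j y) (D (Suc j) y)" "D (Suc j) y \<in> LP"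
    using Sob_Suc_continuous Sob_SucD[of "D j y" k] Sob_LP unfolding nderiv_1_nderiv by blast+
qed

text \<open>Gronwall for the sum of all derivatives of order below r, as for the equivalent
  first-order system. The coefficients are only integrable, which is why the integral form of
  Gronwall with integrable weight is used.\<close>

lemma sup_apriori:
  fixes A :: "nat \<Rightarrow> real \<Rightarrow> complex ^ 'm::finite ^ 'm"
  assumes r: "r \<ge> 1" and A: "\<forall>l\<in>{1..r}. A (r - l) \<in> MS n"
  shows "\<exists>C\<ge>0. \<forall>y\<in>VS (n + r). \<forall>j<r. \<forall>i. \<forall>t\<in>I.
    cmod (D j (\<lambda>t. y t $ i) t) \<le> C * (ini r y + LN n r A y)"
proof -
  define \<alpha> where "\<alpha> s = (\<Sum>i\<in>UNIV. \<Sum>l=1..r. \<Sum>j\<in>UNIV. cmod (A (r - l) s $ i $ j))" for s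
  \<comment> \<open>The summand 1 accounts for derivatives that are again of order below r,
    \<open>\<alpha>\<close> for the coefficients in the derivative of order r.\<close>
  define \<beta> where "\<beta> s = 1 + \<alpha> s" for s
  have \<alpha>0: "0 \<le> \<alpha> s" for s by (simp add: \<alpha>_def sum_nonneg)
  have "integrable M (\<lambda>s. cmod (A (r - l) s $ i $ j))" if "l \<in> {1..r}" for l i j
    using Lp_integrable(1)[OF Sob_LP[OF mSobD]] A that by (intro integrable_norm) blast
  then have "integrable M \<alpha>" unfolding \<alpha>_def[abs_def] by (intro Bochner_Integration.integrable_sum) auto
  then have \<beta>i: "integrable M \<beta>" unfolding \<beta>_def[abs_def]
    by (intro Bochner_Integration.integrable_add M.integrable_const)
  from gronwall_integrable[OF ab \<beta>i] obtain G where G: "G \<ge> 0"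
    and gron: "\<And>W K. continuous_on I W \<Longrightarrow>
      (\<forall>t\<in>I. 0 \<le> W t \<and> W t \<le> K + integral {a..t} (\<lambda>s. \<beta> s * W s)) \<Longrightarrow> (\<forall>t\<in>I. W t \<le> G * K)"
    using \<alpha>0 by (auto simp: \<beta>_def add_nonneg_nonneg)
  have "cmod (D j (\<lambda>t. y t $ i) t) \<le> (G * (b - a + 1)) * (ini r y + LN n r A y)"
    if y: "y \<in> VS (n + r)" and j: "j < r" and t: "t \<in> I" for y :: "real \<Rightarrow> complex ^ 'm" and i j t
  proof -
    define d where "d j i = D j (\<lambda>t. y t $ i)" for j i
    note dj = nderiv_below_order[OF vSobD[OF y], folded d_def]
    define W where "W t = (\<Sum>j<r. \<Sum>i\<in>UNIV. cmod (d j i t))" for t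
    define g where "g s = (\<Sum>i\<in>UNIV. cmod (LO r A y i s))" for s
    have dW: "cmod (d j i s) \<le> W s" if "j < r" for j i s
    proof -
      have "cmod (d j i s) \<le> (\<Sum>i\<in>UNIV. cmod (d j i s))" by (rule member_le_sum) auto
      also have "\<dots> \<le> W s" unfolding W_def using that by (intro member_le_sum) (auto simp: sum_nonneg)
      finally show ?thesis .
    qed
    have W0: "0 \<le> W s" for s by (simp add: W_def sum_nonneg)
    have Wc: "continuous_on I W"
      unfolding W_def by (intro continuous_on_sum continuous_on_norm dj(1)) auto
    have POle: "cmod (PO r A y i s) \<le> (\<Sum>l=1..r. \<Sum>j\<in>UNIV. cmod (A (r - l) s $ i $ j)) * W s" for i s
    proof -
      have "cmod (PO r A y i s) \<le> (\<Sum>l=1..r. \<Sum>j\<in>UNIV. cmod (A (r - l) s $ i $ j * d (r - l) j s))"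
        unfolding PO_def d_def by (intro sum_norm_le norm_sum)
      also have "\<dots> \<le> (\<Sum>l=1..r. \<Sum>j\<in>UNIV. cmod (A (r - l) s $ i $ j) * W s)"
        using r by (intro sum_mono) (auto simp: norm_mult intro!: mult_left_mono dW)
      finally show ?thesis by (simp add: sum_distrib_right)
    qed
    have pt: "(\<Sum>j<r. \<Sum>i\<in>UNIV. cmod (d (Suc j) i s)) \<le> \<beta> s * W s + g s" for s
    proof -
      define F where "F j = (\<Sum>i\<in>UNIV. cmod (d j i s))" for j
      \<comment> \<open>Raising every order by one keeps the sum up to its two ends:
        \<open>F 0\<close> is dropped, and \<open>F r\<close> is eliminated by writing the
        derivative of order r as \<open>LO\<close> minus \<open>PO\<close>.\<close>
      have "F 0 + (\<Sum>j<r. F (Suc j)) = (\<Sum>j<r. F j) + F r"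
        using sum.lessThan_Suc_shift[of F r] by simp
      moreover have "0 \<le> F 0" by (simp add: F_def sum_nonneg)
      moreover have "F r \<le> g s + \<alpha> s * W s"
      proof -
        have "cmod (d r i s) \<le> cmod (LO r A y i s) + (\<Sum>l=1..r. \<Sum>j\<in>UNIV. cmod (A (r - l) s $ i $ j)) * W s" for i
        proof -
          have "d r i s = LO r A y i s - PO r A y i s" by (simp add: LO_def d_def)
          then have "cmod (d r i s) \<le> cmod (LO r A y i s) + cmod (PO r A y i s)" by (simp only: norm_triangle_ineq4)
          then show ?thesis using POle[of i s] by linarith
        qed
        then have "F r \<le> (\<Sum>i\<in>UNIV. cmod (LO r A y i s) + (\<Sum>l=1..r. \<Sum>j\<in>UNIV. cmod (A (r - l) s $ i $ j)) * W s)"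
          unfolding F_def by (rule sum_mono)
        then show ?thesis by (simp add: sum.distrib g_def \<alpha>_def sum_distrib_right)
      qed
      ultimately have "(\<Sum>j<r. F (Suc j)) \<le> W s + (g s + \<alpha> s * W s)"
        unfolding W_def F_def by linarith
      then show ?thesis by (simp add: F_def \<beta>_def algebra_simps)
    qed
    \<comment> \<open>The inhomogeneous term of Gronwall: the Cauchy data and the L_1 size of L y,
      the latter estimated by its Sobolev norm.\<close>
    define K where "K = ini r y + (b - a + 1) * LN n r A y"
    have LOL: "LO r A y i \<in> LP" for i using Sob_LP[OF LO_Sob[OF A y]] .
    have We: "W t \<le> K + integral {a..t} (\<lambda>s. \<beta> s * W s)" if t: "t \<in> I" for t
    proof -
      have aI: "{a..t} \<subseteq> I" using t by auto
      have each: "cmod (d j i t) \<le> cmod (d j i a) + integral {a..t} (\<lambda>s. cmod (d (Suc j) i s))" if "j < r" for j i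
      proof -
        have "d j i t = d j i a + integral {a..t} (d (Suc j) i)" using primitiveD[OF dj(2)[OF that] t] .
        then have "cmod (d j i t) \<le> cmod (d j i a) + cmod (integral {a..t} (d (Suc j) i))"
          by (simp only: norm_triangle_ineq)
        moreover have "cmod (integral {a..t} (d (Suc j) i)) \<le> integral {a..t} (\<lambda>s. cmod (d (Suc j) i s))"
          by (rule integral_norm_bound_integral[OF LP_integrable_on[OF dj(3)[OF that]] LP_norm_integral(1)[OF dj(3)[OF that] t]])
             (use t ab in auto)
        ultimately show ?thesis by linarith
      qed
      have "W t \<le> (\<Sum>j<r. \<Sum>i\<in>UNIV. cmod (d j i a) + integral {a..t} (\<lambda>s. cmod (d (Suc j) i s)))"
        unfolding W_def using each by (intro sum_mono) auto
      also have "\<dots> = ini r y + (\<Sum>j<r. \<Sum>i\<in>UNIV. integral {a..t} (\<lambda>s. cmod (d (Suc j) i s)))"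
        by (simp add: sum.distrib ini_def d_def)
      also have "(\<Sum>j<r. \<Sum>i\<in>UNIV. integral {a..t} (\<lambda>s. cmod (d (Suc j) i s))) =
          integral {a..t} (\<lambda>s. \<Sum>j<r. \<Sum>i\<in>UNIV. cmod (d (Suc j) i s))"
      proof -
        have di: "(\<lambda>s. cmod (d (Suc j) i s)) integrable_on {a..t}" if "j < r" for j i
          using LP_norm_integral(1)[OF dj(3)[OF that] t] .
        have "integral {a..t} (\<lambda>s. \<Sum>j<r. \<Sum>i\<in>UNIV. cmod (d (Suc j) i s)) =
            (\<Sum>j<r. integral {a..t} (\<lambda>s. \<Sum>i\<in>UNIV. cmod (d (Suc j) i s)))"
          by (rule Henstock_Kurzweil_Integration.integral_sum) (auto intro!: integrable_sum di)
        also have "\<dots> = (\<Sum>j<r. \<Sum>i\<in>UNIV. integral {a..t} (\<lambda>s. cmod (d (Suc j) i s)))"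
          by (intro sum.cong refl Henstock_Kurzweil_Integration.integral_sum) (auto intro: di)
        finally show ?thesis by simp
      qed
      also have "\<dots> \<le> integral {a..t} (\<lambda>s. \<beta> s * W s + g s)"
      proof (rule integral_le)
        show "(\<lambda>s. \<Sum>j<r. \<Sum>i\<in>UNIV. cmod (d (Suc j) i s)) integrable_on {a..t}"
          using LP_norm_integral(1)[OF dj(3) t] by (intro integrable_sum) auto
        have "integrable (lebesgue_on {a..t}) (\<lambda>s. \<beta> s * W s)"
          by (rule integrable_lebesgue_on_subset[OF integrable_mult_continuous[OF \<beta>i Wc] _ aI]) auto
        then have bw: "(\<lambda>s. \<beta> s * W s) integrable_on {a..t}" by (rule integrable_on_lebesgue_on) auto
        have gi: "g integrable_on {a..t}"
          unfolding g_def[abs_def] using LP_norm_integral(1)[OF LOL t] by (intro integrable_sum) auto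
        show "(\<lambda>s. \<beta> s * W s + g s) integrable_on {a..t}"
          using bw gi by (rule Henstock_Kurzweil_Integration.integrable_add)
      qed (rule pt)
      also have "\<dots> = integral {a..t} (\<lambda>s. \<beta> s * W s) + integral {a..t} g"
      proof (rule Henstock_Kurzweil_Integration.integral_add)
        have "integrable (lebesgue_on {a..t}) (\<lambda>s. \<beta> s * W s)"
          by (rule integrable_lebesgue_on_subset[OF integrable_mult_continuous[OF \<beta>i Wc] _ aI]) auto
        then show "(\<lambda>s. \<beta> s * W s) integrable_on {a..t}" by (rule integrable_on_lebesgue_on) auto
        show "g integrable_on {a..t}"
          unfolding g_def[abs_def] using LP_norm_integral(1)[OF LOL t] by (intro integrable_sum) auto
      qed
      also have "integral {a..t} g = (\<Sum>i\<in>UNIV. integral {a..t} (\<lambda>s. cmod (LO r A y i s)))"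
        unfolding g_def[abs_def] using LP_norm_integral(1)[OF LOL t]
        by (intro Henstock_Kurzweil_Integration.integral_sum) auto
      also have "\<dots> \<le> (\<Sum>i\<in>UNIV. (b - a + 1) * SN n (LO r A y i))"
      proof (rule sum_mono)
        fix i
        have "integral {a..t} (\<lambda>s. cmod (LO r A y i s)) \<le> (b - a + 1) * nrm (LO r A y i)"
          by (rule LP_norm_integral(2)[OF LOL t])
        also have "\<dots> \<le> (b - a + 1) * SN n (LO r A y i)"
          using ab by (intro mult_left_mono Lp_norm_le_Sob_norm) auto
        finally show "integral {a..t} (\<lambda>s. cmod (LO r A y i s)) \<le> (b - a + 1) * SN n (LO r A y i)" .
      qed
      also have "\<dots> = (b - a + 1) * LN n r A y" by (simp add: LN_def sum_distrib_left)
      finally show ?thesis by (simp add: K_def)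
    qed
    have "W t \<le> G * K" using gron[OF Wc] W0 We t by blast
    also have "\<dots> \<le> G * ((b - a + 1) * (ini r y + LN n r A y))"
    proof (rule mult_left_mono[OF _ G])
      have "1 * ini r y \<le> (b - a + 1) * ini r y" using ab ini_nonneg by (intro mult_right_mono) auto
      then show "K \<le> (b - a + 1) * (ini r y + LN n r A y)" unfolding K_def distrib_left by simp
    qed
    finally show ?thesis using dW[OF j, of i t] by (simp add: d_def mult.assoc)
  qed
  then show ?thesis using G ab by (intro exI[of _ "G * (b - a + 1)"]) auto
qed

text \<open>Bootstrapping from the pointwise bounds up to order n + r: a bound of order k + r for
  \<open>y\<close> yields one of order k + 1 for its derivatives below r, hence for the lower-order
  terms, and the equation passes it on to the derivative of order r.\<close>

lemma apriori:
  fixes A :: "nat \<Rightarrow> real \<Rightarrow> complex ^ 'm::finite ^ 'm"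
  assumes r: "r \<ge> 1" and A: "\<forall>l\<in>{1..r}. A (r - l) \<in> MS n"
  shows "\<exists>C\<ge>0. \<forall>y\<in>VS (n + r). VN (n + r) y \<le> C * (ini r y + LN n r A y)"
proof -
  define X where "X y = ini r y + LN n r A y" for y
  have X0: "0 \<le> X y" for y by (simp add: X_def ini_nonneg LN_nonneg)
  obtain C0 where C0: "C0 \<ge> 0" and sup: "\<And>y j i t. y \<in> VS (n + r) \<Longrightarrow> j < r \<Longrightarrow> t \<in> I \<Longrightarrow>
      cmod (D j (\<lambda>t. y t $ i) t) \<le> C0 * X y"
    using sup_apriori[where A = A and n = n, OF r A] unfolding X_def by blast
  \<comment> \<open>One round of the bootstrapping. The three summands of the constant pay for the
    derivatives below order r, bounded pointwise, for L y, and for the lower-order part.\<close>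
  have PO_to_norm: "VN (k + r) y \<le> (real CARD('m) * (real r * (C0 * (b - a + 1))) + 1 + c * MN k r A) * X y"
    if k: "k \<le> n" and y: "y \<in> VS (n + r)" and c: "0 \<le> c"
     and PO: "\<And>l i j. l \<in> {1..r} \<Longrightarrow> (\<lambda>t. A (r - l) t $ i $ j * D (r - l) (\<lambda>t. y t $ j) t) \<in> S k \<and>
      SN k (\<lambda>t. A (r - l) t $ i $ j * D (r - l) (\<lambda>t. y t $ j) t) \<le> (c * X y) * SN k (\<lambda>t. A (r - l) t $ i $ j)"
    for k y c
  proof -
    note POk = PO_bound[where A = A and y = y and m = k, OF PO]
    have low: "nrm (D j (\<lambda>t. y t $ i)) \<le> C0 * (b - a + 1) * X y" if "j < r" for j i
    proof -
      have "nrm (D j (\<lambda>t. y t $ i)) \<le> (C0 * X y) * (b - a + 1)"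
        using sup[OF y that] C0 X0 continuous_LP[OF nderiv_below_order(1)[OF vSobD[OF y] that]]
        by (intro Lp_bounded(2) AE_M_I Lp_measurable) auto
      then show ?thesis by (simp add: mult_ac)
    qed
    have top: "SN k (D r (\<lambda>t. y t $ i)) \<le> SN n (LO r A y i) + SN k (PO r A y i)" for i
    proof -
      have "D r (\<lambda>t. y t $ i) = (\<lambda>t. LO r A y i t - PO r A y i t)" by (rule ext) (simp add: LO_def)
      moreover have "LO r A y i \<in> S k" using LO_Sob[OF A y] k Sob_subset by blast
      ultimately have "SN k (D r (\<lambda>t. y t $ i)) \<le> SN k (LO r A y i) + SN k (PO r A y i)"
        using Sob_diff(2)[OF _ POk(1)] by simp
      then show ?thesis using Sob_norm_mono[OF k, of "LO r A y i"] by linarith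
    qed
    have "SN (k + r) (\<lambda>t. y t $ i) \<le> real r * (C0 * (b - a + 1) * X y) + (SN n (LO r A y i) + SN k (PO r A y i))" for i
    proof -
      have "(\<Sum>j<r. nrm (D j (\<lambda>t. y t $ i))) \<le> (\<Sum>j<r. C0 * (b - a + 1) * X y)"
        using low by (intro sum_mono) auto
      then show ?thesis unfolding Sob_norm_shift using top[of i] by simp
    qed
    then have "VN (k + r) y \<le>
       (\<Sum>i\<in>(UNIV::'m set). real r * (C0 * (b - a + 1) * X y) + (SN n (LO r A y i) + SN k (PO r A y i)))"
      unfolding vSob_norm_def by (rule sum_mono)
    also have "\<dots> = real CARD('m) * (real r * (C0 * (b - a + 1) * X y)) + (LN n r A y + (\<Sum>i\<in>UNIV. SN k (PO r A y i)))"
      by (simp add: sum.distrib LN_def)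
    also have "\<dots> \<le> real CARD('m) * (real r * (C0 * (b - a + 1) * X y)) + (X y + (c * X y) * MN k r A)"
      using POk(2) ini_nonneg[of r y] by (intro add_mono order_refl) (auto simp: X_def)
    also have "\<dots> = (real CARD('m) * (real r * (C0 * (b - a + 1))) + 1 + c * MN k r A) * X y"
      by (simp add: algebra_simps)
    finally show ?thesis .
  qed
  let ?B = "real CARD('m) * (real r * (C0 * (b - a + 1))) + 1"
  have B0: "0 \<le> ?B" using C0 ab by (intro add_nonneg_nonneg mult_nonneg_nonneg) auto
  have "\<exists>C\<ge>0. \<forall>y\<in>VS (n + r). VN (k + r) y \<le> C * X y" if "k \<le> n" for k
    using that
  proof (induction k)
    case 0
    \<comment> \<open>At the start the coefficients are used as L_p functions only, multiplied by
      derivatives that are bounded pointwise.\<close>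
    have "VN (0 + r) y \<le> (?B + C0 * MN 0 r A) * X y" if y: "y \<in> VS (n + r)" for y
    proof (rule PO_to_norm[OF _ y C0])
      fix l i j assume l: "l \<in> {1..r}"
      have Al: "(\<lambda>t. A (r - l) t $ i $ j) \<in> LP" using A l mSobD Sob_LP by blast
      have lr: "r - l < r" using l r by auto
      from LP_mult_bounded[OF Al nderiv_below_order(1)[OF vSobD[OF y] lr], of "C0 * X y"] sup[OF y lr] C0 X0
      show "(\<lambda>t. A (r - l) t $ i $ j * D (r - l) (\<lambda>t. y t $ j) t) \<in> S 0 \<and>
        SN 0 (\<lambda>t. A (r - l) t $ i $ j * D (r - l) (\<lambda>t. y t $ j) t) \<le> (C0 * X y) * SN 0 (\<lambda>t. A (r - l) t $ i $ j)"
        by (simp add: Sob_norm_0)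
    qed simp
    then show ?case using B0 C0 MN_nonneg[of 0 r A] by (intro exI[of _ "?B + C0 * MN 0 r A"]) auto
  next
    case (Suc k)
    then obtain C where C: "C \<ge> 0" and IH: "\<And>y. y \<in> VS (n + r) \<Longrightarrow> VN (k + r) y \<le> C * X y"
      by auto
    obtain E where E: "E \<ge> 0" and mult: "\<And>u v. u \<in> S (Suc k) \<Longrightarrow> v \<in> S (Suc k) \<Longrightarrow> (\<lambda>t. u t * v t) \<in> S (Suc k) \<and>
        SN (Suc k) (\<lambda>t. u t * v t) \<le> E * SN (Suc k) u * SN (Suc k) v"
      using Sob_mult[of k] by blast
    have EC: "0 \<le> E * C" using E C by simp
    have "vSob_norm a b (Suc k + r) p y \<le> (?B + (E * C) * MN (Suc k) r A) * X y"
      if y: "y \<in> VS (n + r)" for y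
    proof (rule PO_to_norm[OF Suc.prems y EC])
      fix l i j assume l: "l \<in> {1..r}"
      let ?u = "\<lambda>t. A (r - l) t $ i $ j" and ?v = "D (r - l) (\<lambda>t. y t $ j)"
      have u: "?u \<in> S (Suc k)" using A l mSobD Sob_subset[OF Suc.prems] by blast
      have yk: "(\<lambda>t. y t $ j) \<in> S (k + r)"
        by (rule Sob_subset[OF _ vSobD[OF y]]) (use Suc.prems in simp)
      note v = nderiv_lower[OF yk l]
      \<comment> \<open>The gain of one order that drives the induction: the bound of order k + r
        for \<open>y\<close> controls order k + 1 of a derivative below r.\<close>
      have "SN (Suc k) ?v \<le> C * X y"
        using v(2) Sob_norm_le_vSob_norm[of "k + r" y j] IH[OF y] by linarith
      then have "E * SN (Suc k) ?u * SN (Suc k) ?v \<le> E * SN (Suc k) ?u * (C * X y)"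
        using E Sob_norm_nonneg by (intro mult_left_mono) auto
      then show "(\<lambda>t. ?u t * ?v t) \<in> S (Suc k) \<and> SN (Suc k) (\<lambda>t. ?u t * ?v t) \<le> (E * C * X y) * SN (Suc k) ?u"
        using mult[OF u v(1)] by (auto simp: mult_ac)
    qed
    then show ?case using B0 EC MN_nonneg[of "Suc k" r A] by (intro exI[of _ "?B + (E * C) * MN (Suc k) r A"]) auto
  qed
  then show ?thesis unfolding X_def by blast
qed

end

lemma of_real_vector_scalar_mult: "of_real c *s (x :: complex ^ 'n::finite) = c *\<^sub>R x"
  by (simp add: vec_eq_iff scaleR_conv_of_real[of c "x $ _"])

section \<open>Uniform boundedness\<close>

context lp_interval
begin

lemma vSob_norm_triangle:
  assumes "x \<in> VS n" "y \<in> VS n" "z \<in> VS n"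
  shows "VN n (\<lambda>t. x t - z t) \<le> VN n (\<lambda>t. x t - y t) + VN n (\<lambda>t. y t - z t)"
  using vSob_add(2)[OF vSob_diff(1)[OF assms(1,2)] vSob_diff(1)[OF assms(2,3)]] by simp

lemma cont_linear_op_diff:
  assumes f: "cont_linear_op a b n p f" and "y \<in> VS n" "z \<in> VS n"
  shows "f (\<lambda>t. y t - z t) = f y - f z"
proof -
  have "f (\<lambda>t. y t + (- 1) *s z t) = f y + (- 1) *s f z"
    using assms vSob_scale(1)[OF assms(3), of "- 1"] unfolding cont_linear_op_def by metis
  then show ?thesis by (simp add: vector_sneg_minus1[symmetric])
qed

lemma cont_linear_op_scaleR:
  assumes "cont_linear_op a b n p f" "y \<in> VS n"
  shows "norm (f (\<lambda>t. of_real c *s y t)) = \<bar>c\<bar> * norm (f y)"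
proof -
  have "f (\<lambda>t. of_real c *s y t) = of_real c *s f y"
    using assms unfolding cont_linear_op_def by blast
  then show ?thesis by (simp only: of_real_vector_scalar_mult norm_scaleR)
qed

lemma cont_linear_op_bounded:
  assumes f: "cont_linear_op a b n p f"
  shows "\<exists>K\<ge>0. \<forall>y\<in>VS n. norm (f y) \<le> K * VN n y"
proof -
  let ?V = "VS n" and ?N = "VN n"
  have f0: "f (\<lambda>t. 0) = 0"
    using cont_linear_op_diff[OF f vSob_zero(1) vSob_zero(1)] by simp
  have "\<forall>y\<in>?V. \<forall>\<epsilon>>0. \<exists>\<delta>>0. \<forall>z\<in>?V. ?N (\<lambda>t. z t - y t) < \<delta> \<longrightarrow> norm (f z - f y) < \<epsilon>"
    using f unfolding cont_linear_op_def by (elim conjE)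
  from this[rule_format, OF vSob_zero(1) zero_less_one]
  have "\<exists>\<delta>>0. \<forall>z\<in>?V. ?N (\<lambda>t. z t - 0) < \<delta> \<longrightarrow> norm (f z - f (\<lambda>t. 0)) < 1" .
  then obtain \<delta> where \<delta>: "0 < \<delta>" "\<And>z. z \<in> ?V \<Longrightarrow> ?N z < \<delta> \<Longrightarrow> norm (f z) < 1"
    by (auto simp: f0)
  have "norm (f y) \<le> (2 / \<delta>) * ?N y" if y: "y \<in> ?V" for y
  proof (rule field_le_epsilon)
    fix e :: real assume e: "0 < e"
    \<comment> \<open>Strictly positive even if the seminorm of \<open>y\<close> vanishes; the
      correction is tuned so that 2 s / \<delta> exceeds the desired bound by exactly
      \<open>e\<close>.\<close>
    define s where "s = ?N y + e * \<delta> / 2"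
    have s: "0 < s" "?N y < s" using e \<delta>(1) vSob_norm_nonneg[of n y] by (auto simp: s_def add_nonneg_pos)
    define c where "c = \<delta> / (2 * s)"
    have c: "0 < c" using \<delta> s by (simp add: c_def)
    have "?N (\<lambda>t. of_real c *s y t) = c * ?N y" using vSob_scale(2)[OF y, of "of_real c"] c by simp
    also have "\<dots> \<le> c * s" using s c by simp
    also have "\<dots> < \<delta>" using s \<delta>(1) by (simp add: c_def)
    finally have "norm (f (\<lambda>t. of_real c *s y t)) < 1" using \<delta>(2) vSob_scale(1)[OF y] by blast
    then have "c * norm (f y) < 1" using cont_linear_op_scaleR[OF f y, of c] c by simp
    then have "norm (f y) < 2 * s / \<delta>" using s \<delta>(1) by (simp add: c_def field_simps)
    also have "\<dots> = (2 / \<delta>) * ?N y + e" using \<delta>(1) by (simp add: s_def field_simps)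
    finally show "norm (f y) \<le> (2 / \<delta>) * ?N y + e" by simp
  qed
  then show ?thesis using \<delta>(1) by (intro exI[of _ "2 / \<delta>"]) auto
qed

text \<open>The constant is the operator norm, the supremum over the closed unit ball. The last
  clause supplies the nearly norming elements for the gliding hump.\<close>

lemma cont_linear_op_norm:
  assumes f: "cont_linear_op a b n p f"
  obtains \<beta> where "0 \<le> \<beta>" "\<And>y. y \<in> VS n \<Longrightarrow> norm (f y) \<le> \<beta> * VN n y"
    "\<And>\<gamma>. \<gamma> < \<beta> \<Longrightarrow> \<exists>y\<in>VS n. VN n y \<le> 1 \<and> \<gamma> < norm (f y)"
proof -
  let ?V = "VS n" and ?N = "VN n"
  obtain K where K: "K \<ge> 0" "\<And>y. y \<in> ?V \<Longrightarrow> norm (f y) \<le> K * ?N y"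
    using cont_linear_op_bounded[OF f] by blast
  define U where "U = (\<lambda>y. norm (f y)) ` {y\<in>?V. ?N y \<le> 1}"
  have z: "norm (f (\<lambda>t. 0)) \<in> U" unfolding U_def by (intro imageI) (simp add: vSob_zero)
  have bdd: "bdd_above U"
  proof (rule bdd_aboveI)
    fix u assume "u \<in> U"
    then obtain y where y: "y \<in> ?V" "?N y \<le> 1" "u = norm (f y)" by (auto simp: U_def)
    have "K * ?N y \<le> K * 1" using K(1) y(2) by (rule mult_left_mono[rotated])
    then show "u \<le> K" using K(2)[OF y(1)] y(3) by simp
  qed
  show ?thesis
  proof (rule that[of "Sup U"])
    show "0 \<le> Sup U" using cSup_upper[OF z bdd] norm_ge_zero order_trans by blast
    show "norm (f y) \<le> Sup U * ?N y" if y: "y \<in> ?V" for y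
    proof (cases "?N y = 0")
      case True then show ?thesis using K(2)[OF y] by simp
    next
      case False
      then have pos: "0 < ?N y" using vSob_norm_nonneg[of n y] by simp
      have "?N (\<lambda>t. of_real (1 / ?N y) *s y t) = 1"
        using vSob_scale(2)[OF y, of "of_real (1 / ?N y)"] pos by (simp add: norm_divide)
      then have "norm (f (\<lambda>t. of_real (1 / ?N y) *s y t)) \<in> U"
        unfolding U_def using vSob_scale(1)[OF y] by (intro imageI) simp
      from cSup_upper[OF this bdd] have "norm (f y) / ?N y \<le> Sup U"
        unfolding cont_linear_op_scaleR[OF f y] using pos by simp
      then show ?thesis using pos by (simp add: field_simps)
    qed
    show "\<exists>y\<in>?V. ?N y \<le> 1 \<and> \<gamma> < norm (f y)" if "\<gamma> < Sup U" for \<gamma>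
      using less_cSupD[OF _ that] z unfolding U_def by blast
  qed
qed

text \<open>Sokal's gliding hump: an increment \<open>\<plusminus>3\<^sup>-\<^sup>m x\<^sub>m\<close> with \<open>x\<^sub>m\<close> nearly norming for the
  functional number \<open>k m\<close> makes the value of that functional large, and the remaining increments
  are too small to destroy this.\<close>

lemma vSob_uniform_boundedness:
  fixes F :: "nat \<Rightarrow> (real \<Rightarrow> complex ^ 'm::finite) \<Rightarrow> complex ^ 'k::finite"
  assumes F: "\<And>k. cont_linear_op a b n p (F k)"
    and bd: "\<And>y. y \<in> VS n \<Longrightarrow> \<exists>K. \<forall>k. norm (F k y) \<le> K"
  shows "\<exists>C. \<forall>k. \<forall>y\<in>VS n. norm (F k y) \<le> C * VN n y"
proof (rule ccontr)
  let ?V = "VS n :: (real \<Rightarrow> complex ^ 'm) set" and ?N = "VN n :: (real \<Rightarrow> complex ^ 'm) \<Rightarrow> real"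
  assume "\<not> ?thesis"
  then have unb: "\<exists>k. \<exists>y\<in>?V. C * ?N y < norm (F k y)" for C by (meson not_le)
  \<comment> \<open>Norms above 4^m beat the damping 3^(-m) of the increments. The fraction 3/4
    leaves room for the tail, which costs 1/2.\<close>
  have "\<exists>k \<beta> x. 4 ^ m < \<beta> \<and> (\<forall>y\<in>?V. norm (F k y) \<le> \<beta> * ?N y) \<and> x \<in> ?V \<and> ?N x \<le> 1 \<and> 3/4 * \<beta> < norm (F k x)"
    for m :: nat
  proof -
    obtain k y where ky: "y \<in> ?V" "4 ^ m * ?N y < norm (F k y)" using unb by blast
    obtain \<beta> where \<beta>: "0 \<le> \<beta>" "\<And>y. y \<in> ?V \<Longrightarrow> norm (F k y) \<le> \<beta> * ?N y"
      "\<And>\<gamma>. \<gamma> < \<beta> \<Longrightarrow> \<exists>y\<in>?V. ?N y \<le> 1 \<and> \<gamma> < norm (F k y)"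
      using cont_linear_op_norm[OF F[of k]] by blast
    have "4 ^ m * ?N y < \<beta> * ?N y" using ky(2) \<beta>(2)[OF ky(1)] by linarith
    then have b4: "4 ^ m < \<beta>" using vSob_norm_nonneg[of n y] by (simp add: mult_less_cancel_right)
    moreover have "0 < (4::real) ^ m" by simp
    ultimately have "3/4 * \<beta> < \<beta>" by linarith
    from \<beta>(3)[OF this] obtain x where x: "x \<in> ?V" "?N x \<le> 1" "3/4 * \<beta> < norm (F k x)" by blast
    show ?thesis
      by (intro exI[of _ k] exI[of _ \<beta>] exI[of _ x] conjI ballI b4 \<beta>(2) x)
  qed
  then have "\<forall>m. \<exists>z. 4 ^ m < fst (snd z) \<and> (\<forall>y\<in>?V. norm (F (fst z) y) \<le> fst (snd z) * ?N y) \<and>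
      snd (snd z) \<in> ?V \<and> ?N (snd (snd z)) \<le> 1 \<and> 3/4 * fst (snd z) < norm (F (fst z) (snd (snd z)))"
    by simp
  from choice[OF this] obtain z where z: "\<And>m. 4 ^ m < fst (snd (z m)) \<and>
      (\<forall>y\<in>?V. norm (F (fst (z m)) y) \<le> fst (snd (z m)) * ?N y) \<and>
      snd (snd (z m)) \<in> ?V \<and> ?N (snd (snd (z m))) \<le> 1 \<and>
      3/4 * fst (snd (z m)) < norm (F (fst (z m)) (snd (snd (z m))))" by blast
  define k where "k m = fst (z m)" for m
  define \<beta> where "\<beta> m = fst (snd (z m))" for m
  define x where "x m = snd (snd (z m))" for m
  have \<beta>4: "4 ^ m < \<beta> m" and \<beta>b: "\<And>y. y \<in> ?V \<Longrightarrow> norm (F (k m) y) \<le> \<beta> m * ?N y"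
    and x: "x m \<in> ?V" "?N (x m) \<le> 1" "3/4 * \<beta> m < norm (F (k m) (x m))" for m
    using z[of m] by (auto simp: k_def \<beta>_def x_def)
  have \<beta>0: "0 < \<beta> m" for m using \<beta>4[of m] zero_less_power[of "4::real" m] by linarith
  have "\<exists>s. \<forall>m. s m \<in> ?V \<and> (?N (\<lambda>t. s (Suc m) t - s m t) \<le> (1/3) ^ m \<and>
      3/4 * \<beta> m * (1/3) ^ m \<le> norm (F (k m) (s (Suc m))))"
  proof (rule dependent_nat_choice)
    show "\<exists>s. s \<in> ?V" using vSob_zero(1) by blast
    fix s m assume s: "s \<in> ?V"
    define v where "v t = of_real ((1/3) ^ m) *s x m t" for t
    have v: "v \<in> ?V" unfolding v_def by (rule vSob_scale(1)[OF x(1)])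
    have Nv: "?N v \<le> (1/3) ^ m"
      unfolding v_def using vSob_scale(2)[OF x(1), of "of_real ((1/3) ^ m)" m] x(2)[of m]
      by (simp add: norm_power norm_divide power_divide divide_right_mono)
    have Fv: "3/4 * \<beta> m * (1/3) ^ m \<le> norm (F (k m) v)"
      unfolding v_def cont_linear_op_scaleR[OF F x(1)] using mult_right_mono[OF less_imp_le[OF x(3)[of m]], of "(1/3) ^ m"]
      by (simp add: mult.commute)
    note pm = vSob_add(1)[OF s v] vSob_diff(1)[OF s v]
    \<comment> \<open>The two candidates differ by 2 v, so at least one has an image no smaller than
      that of v; this decides the sign.\<close>
    have "(\<lambda>t. (s t + v t) - (s t - v t)) = (\<lambda>t. of_real 2 *s v t)"
      by (rule ext) (simp add: of_real_vector_scalar_mult scaleR_2 del: of_real_numeral)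
    then have "2 * norm (F (k m) v) = norm (F (k m) (\<lambda>t. s t + v t) - F (k m) (\<lambda>t. s t - v t))"
      using cont_linear_op_diff[OF F pm] cont_linear_op_scaleR[OF F v, of "k m" 2] by simp
    also have "\<dots> \<le> norm (F (k m) (\<lambda>t. s t + v t)) + norm (F (k m) (\<lambda>t. s t - v t))"
      by (rule norm_triangle_ineq4)
    finally consider "norm (F (k m) v) \<le> norm (F (k m) (\<lambda>t. s t + v t))"
      | "norm (F (k m) v) \<le> norm (F (k m) (\<lambda>t. s t - v t))" by linarith
    then show "\<exists>s'. s' \<in> ?V \<and> ?N (\<lambda>t. s' t - s t) \<le> (1/3) ^ m \<and> 3/4 * \<beta> m * (1/3) ^ m \<le> norm (F (k m) s')"
    proof cases
      case 1
      have "?N (\<lambda>t. (s t + v t) - s t) \<le> (1/3) ^ m" using Nv by simp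
      then show ?thesis using pm(1) 1 Fv order_trans by blast
    next
      case 2
      have "?N (\<lambda>t. (s t - v t) - s t) = ?N v"
        using vSob_norm_minus_commute[OF pm(2) s] by simp
      then have "?N (\<lambda>t. (s t - v t) - s t) \<le> (1/3) ^ m" using Nv by simp
      then show ?thesis using pm(2) 2 Fv order_trans by blast
    qed
  qed
  then obtain s where s: "\<And>m. s m \<in> ?V" "\<And>m. ?N (\<lambda>t. s (Suc m) t - s m t) \<le> (1/3) ^ m"
    "\<And>m. 3/4 * \<beta> m * (1/3) ^ m \<le> norm (F (k m) (s (Suc m)))" by blast
  have tail: "?N (\<lambda>t. s (m + i) t - s m t) \<le> 3/2 * (1/3) ^ m" for m i
  proof -
    \<comment> \<open>The exact partial geometric sum, so that the induction closes.\<close>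
    have "?N (\<lambda>t. s (m + i) t - s m t) \<le> 3/2 * (1/3) ^ m - 3/2 * (1/3) ^ (m + i)"
    proof (induction i)
      case (Suc i)
      have "?N (\<lambda>t. s (m + Suc i) t - s m t) \<le> ?N (\<lambda>t. s (Suc (m + i)) t - s (m + i) t) + ?N (\<lambda>t. s (m + i) t - s m t)"
        using vSob_norm_triangle[OF s(1) s(1) s(1), of "Suc (m + i)" m "m + i"] by simp
      also have "\<dots> \<le> (1/3) ^ (m + i) + (3/2 * (1/3) ^ m - 3/2 * (1/3) ^ (m + i))"
        by (intro add_mono s(2) Suc.IH)
      also have "\<dots> = 3/2 * (1/3) ^ m - 3/2 * (1/3) ^ (m + Suc i)" by simp
      finally show ?case .
    qed (simp add: vSob_zero(2))
    moreover have "0 \<le> (1/3::real) ^ (m + i)" by simp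
    ultimately show ?thesis by linarith
  qed
  have to0: "(\<lambda>m. 3/2 * (1/3::real) ^ m) \<longlonglongrightarrow> 0"
    by (intro tendsto_mult_right_zero LIMSEQ_realpow_zero) auto
  have "\<exists>g\<in>?V. (\<lambda>m. ?N (\<lambda>t. s m t - g t)) \<longlonglongrightarrow> 0"
  proof (rule vSob_complete[OF s(1)])
    fix e :: real assume e: "0 < e"
    then have "0 < e / 2" by simp
    from order_tendstoD(2)[OF to0 this] obtain M0 where M0: "3/2 * (1/3::real) ^ M0 < e / 2"
      by (auto simp: eventually_sequentially)
    have "?N (\<lambda>t. s i t - s j t) \<le> e" if "i \<ge> M0" "j \<ge> M0" for i j
    proof -
      have "?N (\<lambda>t. s i t - s M0 t) \<le> e / 2" "?N (\<lambda>t. s j t - s M0 t) \<le> e / 2"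
        using tail[of M0 "i - M0"] tail[of M0 "j - M0"] M0 that by auto
      then show ?thesis
        using vSob_norm_triangle[OF s(1) s(1) s(1), of i j M0] vSob_norm_minus_commute[OF s(1) s(1), of M0 j] by linarith
    qed
    then show "\<exists>N. \<forall>i\<ge>N. \<forall>j\<ge>N. ?N (\<lambda>t. s i t - s j t) \<le> e" by blast
  qed
  then obtain g where g: "g \<in> ?V" "(\<lambda>m. ?N (\<lambda>t. s m t - g t)) \<longlonglongrightarrow> 0" by blast
  have gs: "?N (\<lambda>t. s m t - g t) \<le> 3/2 * (1/3) ^ m" for m
  proof (rule field_le_epsilon)
    fix e :: real assume "0 < e"
    from order_tendstoD(2)[OF g(2) this] obtain M0 where M0: "\<forall>i\<ge>M0. ?N (\<lambda>t. s i t - g t) < e"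
      by (auto simp: eventually_sequentially)
    have "?N (\<lambda>t. s m t - g t) \<le> ?N (\<lambda>t. s m t - s (m + M0) t) + ?N (\<lambda>t. s (m + M0) t - g t)"
      by (rule vSob_norm_triangle[OF s(1) s(1) g(1)])
    moreover have "?N (\<lambda>t. s m t - s (m + M0) t) \<le> 3/2 * (1/3) ^ m"
      using tail[of m M0] vSob_norm_minus_commute[OF s(1) s(1), of m "m + M0"] by simp
    moreover have "?N (\<lambda>t. s (m + M0) t - g t) < e" using M0 by simp
    ultimately show "?N (\<lambda>t. s m t - g t) \<le> 3/2 * (1/3) ^ m + e" by linarith
  qed
  have big: "(4/3) ^ m / 4 \<le> norm (F (k m) g)" for m
  proof -
    have "norm (F (k m) (s (Suc m))) - norm (F (k m) g) \<le> norm (F (k m) (s (Suc m)) - F (k m) g)"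
      by (rule norm_triangle_ineq2)
    also have "\<dots> = norm (F (k m) (\<lambda>t. s (Suc m) t - g t))"
      using cont_linear_op_diff[OF F s(1) g(1)] by simp
    also have "\<dots> \<le> \<beta> m * ?N (\<lambda>t. s (Suc m) t - g t)" by (rule \<beta>b[OF vSob_diff(1)[OF s(1) g(1)]])
    \<comment> \<open>The tail after step m costs at most half of
      \<open>\<beta> m * (1/3) ^ m\<close>; of the gained 3/4 there remains 1/4.\<close>
    also have "\<dots> \<le> \<beta> m * (3/2 * (1/3) ^ Suc m)" using \<beta>0[of m] gs[of "Suc m"] by (intro mult_left_mono) auto
    finally have "1/4 * (\<beta> m * (1/3) ^ m) \<le> norm (F (k m) g)" using s(3)[of m] by simp
    moreover have "4 ^ m * (1/3) ^ m \<le> \<beta> m * (1/3::real) ^ m" using \<beta>4[of m] by (intro mult_right_mono) auto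
    moreover have "4 ^ m * (1/3) ^ m = (4/3::real) ^ m" by (simp add: power_mult_distrib[symmetric])
    ultimately show ?thesis by linarith
  qed
  obtain K where K: "\<And>m. norm (F m g) \<le> K" using bd[OF g(1)] by blast
  obtain m where "4 * K < (4/3) ^ m" using real_arch_pow[of "4/3" "4 * K"] by auto
  then show False using big[of m] K[of "k m"] by linarith
qed

section \<open>Residuals of solutions expressed by the operator norm\<close>

lemma LO_diff:
  assumes y: "y \<in> VS (n + r)" and z: "z \<in> VS (n + r)"
  shows "if n \<ge> 1 then \<forall>t\<in>I. LO r A (\<lambda>t. y t - z t) i t = LO r A y i t - LO r A z i t
    else AE t in M. LO r A (\<lambda>t. y t - z t) i t = LO r A y i t - LO r A z i t"
  using LO_lincomb[OF y z, where c = 1 and d = "-1" and A = A and i = i]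
  by (cases "n \<ge> 1") (simp_all add: vector_sneg_minus1[symmetric])

lemma LN_diff:
  assumes "\<forall>l\<in>{1..r}. A (r - l) \<in> MS n" "y \<in> VS (n + r)" "z \<in> VS (n + r)"
  shows "LN n r A (\<lambda>t. y t - z t) \<le> LN n r A y + LN n r A z"
  using LN_lincomb[OF assms, of 1 "-1"] by (simp add: vector_sneg_minus1[symmetric])

lemma LN_scale:
  assumes "\<forall>l\<in>{1..r}. A (r - l) \<in> MS n" "y \<in> VS (n + r)"
  shows "LN n r A (\<lambda>t. c *s y t) \<le> cmod c * LN n r A y"
  using LN_lincomb[OF assms assms(2), of c 0] by simp

lemma AE_Ioo_iff: "(AE t in lebesgue_on {a<..<b}. P t) \<longleftrightarrow> (AE t in M. P t)"
proof -
  have "AE t in lebesgue. t \<noteq> a \<and> t \<noteq> b"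
    by (auto simp: eventually_ae_filter_negligible intro!: exI[of _ "{a, b}"])
  then have "(AE t in lebesgue. t \<in> {a<..<b} \<longrightarrow> P t) \<longleftrightarrow> (AE t in lebesgue. t \<in> I \<longrightarrow> P t)"
    by (intro eventually_subst eventually_mono[OF \<open>AE t in lebesgue. t \<noteq> a \<and> t \<noteq> b\<close>]) auto
  then show ?thesis by (simp add: AE_restrict_space_iff)
qed

text \<open>Since \<open>z\<close> solves the equation with right-hand side \<open>f\<close>,
  linearity turns the residual of \<open>y\<close> into the operator applied to y - z.\<close>

lemma residual_norm:
  assumes A: "\<forall>l\<in>{1..r}. A (r - l) \<in> MS n" and r: "r \<ge> 1"
    and y: "y \<in> VS (n + r)" and z: "z \<in> VS (n + r)" and f: "f \<in> VS n"
    and eqn: "if n \<ge> 1 then \<forall>t\<in>{a<..<b}. diff_op a b r A z t = f t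
      else AE t in lebesgue_on {a<..<b}. diff_op a b r A z t = f t"
  shows "VN n (\<lambda>t. diff_op a b r A y t - f t) = LN n r A (\<lambda>t. y t - z t)"
proof -
  have "if n \<ge> 1 then \<forall>t\<in>I. LO r A (\<lambda>t. y t - z t) i t = (diff_op a b r A y t - f t) $ i
    else AE t in M. LO r A (\<lambda>t. y t - z t) i t = (diff_op a b r A y t - f t) $ i" for i
  proof (cases "n \<ge> 1")
    case True
    then obtain k where k: "n = Suc k" by (cases n) auto
    have "LO r A z i t = f t $ i" if t: "t \<in> I" for t
    proof -
      \<comment> \<open>The equation is given on the open interval, whereas the congruence of norms
        asks for the closed one; continuity for n at least 1 supplies the end points.\<close>
      have "continuous_on I (\<lambda>t. LO r A z i t - f t $ i)"
        using LO_Sob[OF A z, of i] vSobD[OF f, of i] unfolding k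
        by (intro continuous_on_diff Sob_Suc_continuous)
      moreover have "LO r A z i s - f s $ i = 0" if "s \<in> {a<..<b}" for s
      proof -
        have "diff_op a b r A z s = f s" using eqn True that by simp
        moreover have "diff_op a b r A z s $ i = LO r A z i s" using diff_op_LO[OF z r, of A] True that by simp
        ultimately show ?thesis by simp
      qed
      ultimately have "LO r A z i t - f t $ i = 0"
        using continuous_constant_on_closure[of "{a<..<b}" "\<lambda>t. LO r A z i t - f t $ i" 0 t] t ab
        by (simp add: closure_greaterThanLessThan)
      then show ?thesis by simp
    qed
    then show ?thesis using LO_diff[OF y z, where A = A and i = i] diff_op_LO[OF y r, of A] True by auto
  next
    case False
    have "AE t in M. diff_op a b r A z t = f t" using eqn False by (simp add: AE_Ioo_iff)
    moreover have "AE t in M. LO r A (\<lambda>t. y t - z t) i t = LO r A y i t - LO r A z i t"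
      using LO_diff[OF y z, where A = A and i = i] False by simp
    moreover have "AE t in M. \<forall>i. diff_op a b r A y t $ i = LO r A y i t"
      "AE t in M. \<forall>i. diff_op a b r A z t $ i = LO r A z i t"
      using diff_op_LO[OF y r, of A] diff_op_LO[OF z r, of A] False by simp_all
    ultimately have "AE t in M. LO r A (\<lambda>t. y t - z t) i t = (diff_op a b r A y t - f t) $ i"
      by eventually_elim (metis vector_minus_component)
    then show ?thesis using False by simp
  qed
  from Sob_cong_AE(2)[OF this LO_Sob[OF A vSob_diff(1)[OF y z]]] show ?thesis
    by (simp add: vSob_norm_def LN_def)
qed

text \<open>A vanishing norm gives the equation almost everywhere; for n at least 1 the sup bound
  makes it hold at every point, as the notion of solution demands.\<close>

lemma LN_eq_0_solution:
  assumes A: "\<forall>l\<in>{1..r}. A (r - l) \<in> MS n" and r: "r \<ge> 1"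
    and y: "y \<in> VS (n + r)" and "LN n r A y = 0"
  shows "if n \<ge> 1 then \<forall>t\<in>{a<..<b}. diff_op a b r A y t = 0
      else AE t in lebesgue_on {a<..<b}. diff_op a b r A y t = 0"
proof -
  have z: "SN n (LO r A y i) = 0" for i
    using assms(4) unfolding LN_def by (subst (asm) sum_nonneg_eq_0_iff) (auto simp: Sob_norm_nonneg)
  show ?thesis
  proof (cases "n \<ge> 1")
    case True
    then obtain k where k: "n = Suc k" by (cases n) auto
    have "LO r A y i t = 0" if "t \<in> I" for i t
      using Sob_sup_bound[of "LO r A y i" k t] LO_Sob[OF A y, of i] z[of i] that unfolding k by simp
    then show ?thesis using diff_op_LO[OF y r, of A] True by (auto simp: vec_eq_iff)
  next
    case False
    then have n: "n = 0" by simp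
    have "AE t in M. LO r A y i t = 0" for i
      using Lp_norm_eq_0_AE[OF Sob_LP[OF LO_Sob[OF A y]]] z[of i] by (simp add: n Sob_norm_0)
    then have "AE t in M. \<forall>i\<in>UNIV. LO r A y i t = 0" by (intro AE_finite_allI) auto
    moreover have "AE t in M. \<forall>i. diff_op a b r A y t $ i = LO r A y i t"
      using diff_op_LO[OF y r, of A] False by simp
    ultimately have "AE t in M. diff_op a b r A y t = 0"
      by eventually_elim (simp add: vec_eq_iff)
    then show ?thesis using False by (simp add: AE_Ioo_iff)
  qed
qed

lemma MN_minus_commute:
  assumes A: "\<forall>l\<in>{1..r}. A (r - l) \<in> MS n" and A': "\<forall>l\<in>{1..r}. A' (r - l) \<in> MS n"
  shows "MN n r (\<lambda>j t. A j t - A' j t) = MN n r (\<lambda>j t. A' j t - A j t)"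
proof -
  have "SN n (\<lambda>t. u t - v t) = SN n (\<lambda>t. v t - u t)" if "u \<in> S n" "v \<in> S n" for u v
    using Sob_scale(2)[OF Sob_diff(1)[OF that], of "-1"] by simp
  moreover have "(\<lambda>t. A (r - l) t $ i $ j) \<in> S n" "(\<lambda>t. A' (r - l) t $ i $ j) \<in> S n" if "l \<in> {1..r}" for l i j
    using A A' that mSobD by blast+
  ultimately show ?thesis
    unfolding MN_def mSob_norm_def vector_minus_component by (intro sum.cong refl) blast
qed

end

section \<open>Parameters near the centre and uniform bounds for the boundary operators\<close>

text \<open>A limit at \<open>\<mu>0\<close> disregards the point itself; since it equals the value
  there, it is continuity, and sequences may hit \<open>\<mu>0\<close>.\<close>

lemma isCont_seq:
  fixes \<mu>0 :: "'a::metric_space" and g :: "'a \<Rightarrow> 'b::topological_space"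
  assumes "\<And>k. dist \<mu>0 (\<mu> k) < 1 / real (Suc k)" and "(g \<longlongrightarrow> g \<mu>0) (at \<mu>0)"
  shows "(\<lambda>k. g (\<mu> k)) \<longlonglongrightarrow> g \<mu>0"
proof -
  have "\<mu> \<longlonglongrightarrow> \<mu>0"
  proof (rule metric_LIMSEQ_I)
    fix e :: real assume "0 < e"
    then obtain N where N: "1 / real (Suc N) < e" using nat_approx_posE by metis
    have "dist (\<mu> k) \<mu>0 < e" if "k \<ge> N" for k
    proof -
      have "1 / real (Suc k) \<le> 1 / real (Suc N)" using that by (simp add: frac_le)
      then show ?thesis using assms(1)[of k] N by (simp add: dist_commute)
    qed
    then show "\<exists>N. \<forall>k\<ge>N. dist (\<mu> k) \<mu>0 < e" by blast
  qed
  moreover have "isCont g \<mu>0" using assms(2) by (simp add: isCont_def)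
  ultimately show ?thesis by (rule isCont_tendsto_compose[rotated])
qed

context lp_interval
begin

text \<open>For a given y, convergence bounds B(\<mu>) y only on a ball depending on y. Along a
  sequence of parameters tending to \<open>\<mu>0\<close> the values at each y are bounded outright,
  so the uniform boundedness principle applies to a sequence of counterexamples.\<close>

lemma boundary_uniformly_bounded:
  fixes \<mu>0 :: "'mu::metric_space" and B :: "'mu \<Rightarrow> (real \<Rightarrow> complex ^ 'm::finite) \<Rightarrow> complex ^ 'k::finite"
  assumes B: "\<And>\<mu>. cont_linear_op a b n p (B \<mu>)"
    and lim: "\<And>y. y \<in> VS n \<Longrightarrow> ((\<lambda>\<mu>. B \<mu> y) \<longlongrightarrow> B \<mu>0 y) (at \<mu>0)"
  shows "\<exists>\<epsilon>>0. \<exists>C\<ge>0. \<forall>\<mu>\<in>ball \<mu>0 \<epsilon>. \<forall>y\<in>VS n. norm (B \<mu> y) \<le> C * VN n y"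
proof (rule ccontr)
  let ?V = "VS n :: (real \<Rightarrow> complex ^ 'm) set" and ?N = "VN n :: (real \<Rightarrow> complex ^ 'm) \<Rightarrow> real"
  assume neg: "\<not> ?thesis"
  have "\<forall>k. \<exists>\<mu>. dist \<mu>0 \<mu> < 1 / real (Suc k) \<and> (\<exists>y\<in>?V. real k * ?N y < norm (B \<mu> y))"
    (is "\<forall>k. ?P k")
  proof (rule allI, rule ccontr)
    fix k assume "\<not> ?P k"
    then have "\<forall>\<mu>\<in>ball \<mu>0 (1 / real (Suc k)). \<forall>y\<in>?V. norm (B \<mu> y) \<le> real k * ?N y"
      by (meson mem_ball not_less)
    moreover have "0 < 1 / real (Suc k)" "0 \<le> real k" by simp_all
    ultimately show False using neg by blast
  qed
  from choice[OF this] obtain \<mu> where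
    \<mu>: "\<And>k. dist \<mu>0 (\<mu> k) < 1 / real (Suc k)" "\<And>k. \<exists>y\<in>?V. real k * ?N y < norm (B (\<mu> k) y)" by blast
  have "\<exists>C. \<forall>k. \<forall>y\<in>?V. norm (B (\<mu> k) y) \<le> C * ?N y"
  proof (rule vSob_uniform_boundedness[OF B])
    fix y assume y: "y \<in> ?V"
    have "(\<lambda>k. B (\<mu> k) y) \<longlonglongrightarrow> B \<mu>0 y" by (rule isCont_seq[OF \<mu>(1) lim[OF y]])
    then have "Bseq (\<lambda>k. B (\<mu> k) y)" by (intro convergent_imp_Bseq convergentI)
    then show "\<exists>K. \<forall>k. norm (B (\<mu> k) y) \<le> K" unfolding Bseq_def by blast
  qed
  then obtain C where C: "\<And>k y. y \<in> ?V \<Longrightarrow> norm (B (\<mu> k) y) \<le> C * ?N y" by blast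
  obtain k where k: "C \<le> real k" using real_arch_simple by blast
  obtain y where y: "y \<in> ?V" "real k * ?N y < norm (B (\<mu> k) y)" using \<mu>(2) by blast
  have "C * ?N y \<le> real k * ?N y" using k vSob_norm_nonneg by (rule mult_right_mono)
  then show False using C[OF y(1), of k] y(2) by linarith
qed

section \<open>The two-sided estimate\<close>

text \<open>Uniqueness enters as vanishing of the norm rather than of the function, because
  functions are not identified with their restrictions to the interval.\<close>

lemma inverse_estimate:
  fixes \<mu>0 :: "'mu::metric_space"
    and A :: "nat \<Rightarrow> 'mu \<Rightarrow> real \<Rightarrow> complex ^ 'm::finite ^ 'm"
    and B :: "'mu \<Rightarrow> (real \<Rightarrow> complex ^ 'm) \<Rightarrow> complex ^ 'k::finite"
  assumes r: "r \<ge> 1" and dim: "CARD('k) = r * CARD('m)"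
    and A: "\<And>\<mu>. \<forall>l\<in>{1..r}. A (r - l) \<mu> \<in> MS n"
    and B: "\<And>\<mu>. cont_linear_op a b (n + r) p (B \<mu>)"
    and uniq: "\<And>y. \<lbrakk>y \<in> VS (n + r); LN n r (\<lambda>j. A j \<mu>0) y = 0; B \<mu>0 y = 0\<rbrakk> \<Longrightarrow>
      VN (n + r) y = 0"
    and limA: "((\<lambda>\<mu>. MN n r (\<lambda>j t. A j \<mu> t - A j \<mu>0 t)) \<longlongrightarrow> 0) (at \<mu>0)"
    and limB: "\<And>y. y \<in> VS (n + r) \<Longrightarrow> ((\<lambda>\<mu>. B \<mu> y) \<longlongrightarrow> B \<mu>0 y) (at \<mu>0)"
  shows "\<exists>\<epsilon>>0. \<exists>C>0. \<forall>\<mu>\<in>ball \<mu>0 \<epsilon>. \<forall>y\<in>VS (n + r).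
    VN (n + r) y \<le> C * (LN n r (\<lambda>j. A j \<mu>) y + norm (B \<mu> y))"
proof (rule ccontr)
  let ?V = "VS (n + r) :: (real \<Rightarrow> complex ^ 'm) set"
  let ?N = "VN (n + r) :: (real \<Rightarrow> complex ^ 'm) \<Rightarrow> real"
  let ?L = "\<lambda>\<mu>. LN n r (\<lambda>j. A j \<mu>)"
  assume neg: "\<not> ?thesis"
  obtain \<epsilon>B CB where CB: "0 < \<epsilon>B" "0 \<le> CB"
    "\<And>\<mu> y. \<mu> \<in> ball \<mu>0 \<epsilon>B \<Longrightarrow> y \<in> ?V \<Longrightarrow> norm (B \<mu> y) \<le> CB * ?N y"
    using boundary_uniformly_bounded[OF B limB] by blast
  \<comment> \<open>The negated claim is used with constant k + 1 on a ball of radius at most 1 / (k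
    + 1); dividing by the norm makes both residuals smaller than 1 / (k + 1). Parameter and function
    form a pair so that one choice yields both.\<close>
  have "\<forall>k. \<exists>z. dist \<mu>0 (fst z) < 1 / real (Suc k) \<and> dist \<mu>0 (fst z) < \<epsilon>B \<and> snd z \<in> ?V \<and> ?N (snd z) = 1 \<and>
      ?L (fst z) (snd z) < 1 / real (Suc k) \<and> norm (B (fst z) (snd z)) < 1 / real (Suc k)"
    (is "\<forall>k. ?P k")
  proof
    fix k
    have e: "0 < min \<epsilon>B (1 / real (Suc k))" "0 < real (Suc k)" using CB(1) by simp_all
    obtain \<mu> y where \<mu>: "\<mu> \<in> ball \<mu>0 (min \<epsilon>B (1 / real (Suc k)))" and y: "y \<in> ?V"
      and big: "real (Suc k) * (?L \<mu> y + norm (B \<mu> y)) < ?N y"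
      using neg e by (meson not_le)
    have pos: "0 < ?N y" using big LN_nonneg[of n r "\<lambda>j. A j \<mu>" y]
      by (smt (verit) e(2) norm_ge_zero mult_nonneg_nonneg)
    define u where "u t = of_real (1 / ?N y) *s y t" for t
    have u: "u \<in> ?V" "?N u = 1"
      unfolding u_def using vSob_scale[OF y, of "of_real (1 / ?N y)"] pos by (simp_all add: norm_divide)
    have "?L \<mu> u \<le> ?L \<mu> y / ?N y"
      unfolding u_def using LN_scale[OF A y, where c = "of_real (1 / ?N y)"] pos by (simp add: norm_divide)
    moreover have "norm (B \<mu> u) = norm (B \<mu> y) / ?N y"
      unfolding u_def cont_linear_op_scaleR[OF B y] using pos by simp
    moreover have "?L \<mu> y / ?N y + norm (B \<mu> y) / ?N y < 1 / real (Suc k)"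
      using big pos e(2) by (simp add: field_simps)
    moreover have "0 \<le> ?L \<mu> y / ?N y" "0 \<le> norm (B \<mu> y) / ?N y"
      using pos LN_nonneg[of n r "\<lambda>j. A j \<mu>" y] by simp_all
    ultimately have "?L \<mu> u < 1 / real (Suc k)" "norm (B \<mu> u) < 1 / real (Suc k)" by linarith+
    then show "?P k" using \<mu> u by (intro exI[of _ "(\<mu>, u)"]) simp
  qed
  from choice[OF this] obtain z where z: "\<And>k. dist \<mu>0 (fst (z k)) < 1 / real (Suc k) \<and> dist \<mu>0 (fst (z k)) < \<epsilon>B \<and>
      snd (z k) \<in> ?V \<and> ?N (snd (z k)) = 1 \<and>
      ?L (fst (z k)) (snd (z k)) < 1 / real (Suc k) \<and> norm (B (fst (z k)) (snd (z k))) < 1 / real (Suc k)" by blast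
  define \<mu> where "\<mu> k = fst (z k)" for k
  define u where "u k = snd (z k)" for k
  have \<mu>: "dist \<mu>0 (\<mu> k) < 1 / real (Suc k)" "\<mu> k \<in> ball \<mu>0 \<epsilon>B" and u: "u k \<in> ?V" "?N (u k) = 1"
    and Lu: "?L (\<mu> k) (u k) < 1 / real (Suc k)" and Bu: "norm (B (\<mu> k) (u k)) < 1 / real (Suc k)" for k
    using z[of k] by (auto simp: \<mu>_def u_def)
  have inv0: "(\<lambda>k. 1 / real (Suc k)) \<longlonglongrightarrow> 0" using LIMSEQ_inverse_real_of_nat by (simp add: inverse_eq_divide)
  obtain CP where CP: "CP \<ge> 0" "\<And>A A' y. \<lbrakk>\<forall>l\<in>{1..r}. A (r - l) \<in> MS n; \<forall>l\<in>{1..r}. A' (r - l) \<in> MS n;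
      y \<in> ?V\<rbrakk> \<Longrightarrow> LN n r A y \<le> LN n r A' y + CP * MN n r (\<lambda>j t. A j t - A' j t) * ?N y"
    using LN_perturb[of r n, where 'm = 'm] by blast
  define \<kappa> where "\<kappa> \<mu> = MN n r (\<lambda>j t. A j \<mu> t - A j \<mu>0 t)" for \<mu>
  have \<kappa>0: "\<kappa> \<mu>0 = 0" by (simp add: \<kappa>_def MN_def mSob_norm_def Sob_zero)
  have "(\<lambda>k. \<kappa> (\<mu> k)) \<longlonglongrightarrow> \<kappa> \<mu>0"
    by (rule isCont_seq[OF \<mu>(1)]) (use limA \<kappa>0 in \<open>simp add: \<kappa>_def\<close>)
  then have \<kappa>lim: "(\<lambda>k. \<kappa> (\<mu> k)) \<longlonglongrightarrow> 0" using \<kappa>0 by simp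
  \<comment> \<open>Replaces the moving operator by the fixed one; the cost is the coefficient
    distance times the norm of \<open>u k\<close>, which is 1.\<close>
  have L0: "?L \<mu>0 (u k) \<le> 1 / real (Suc k) + CP * \<kappa> (\<mu> k)" for k
    using CP(2)[OF A[of \<mu>0] A[of "\<mu> k"] u(1)[of k]] u(2)[of k] Lu[of k]
      MN_minus_commute[OF A[of \<mu>0] A[of "\<mu> k"]]
    by (simp add: \<kappa>_def)
  have "(\<lambda>k. 1 / real (Suc k) + CP * \<kappa> (\<mu> k)) \<longlonglongrightarrow> 0 + CP * 0"
    by (intro tendsto_intros inv0 \<kappa>lim)
  then have "(\<lambda>k. 1 / real (Suc k) + CP * \<kappa> (\<mu> k)) \<longlonglongrightarrow> 0" by simp
  then have L0lim: "(\<lambda>k. ?L \<mu>0 (u k)) \<longlonglongrightarrow> 0"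
    by (rule tendsto_sandwich[OF _ _ tendsto_const, rotated 2])
      (simp_all only: eventually_sequentially L0 LN_nonneg simp_thms ex_simps)
  \<comment> \<open>The Cauchy data are r * m numbers, as many as boundary conditions; indexing them
    by \<open>'k\<close> stores them in a finite-dimensional vector type where bounded sequences
    have convergent subsequences.\<close>
  have "card ({..<r} \<times> (UNIV :: 'm set)) = CARD('k)" by (simp add: dim)
  then obtain h where h: "bij_betw h (UNIV :: 'k set) ({..<r} \<times> (UNIV :: 'm set))"
    using finite_same_card_bij[of "UNIV :: 'k set" "{..<r} \<times> (UNIV :: 'm set)"] by auto
  define iv where "iv y = (\<chi> \<kappa>. D (fst (h \<kappa>)) (\<lambda>t. y t $ snd (h \<kappa>)) a)" for y :: "real \<Rightarrow> complex ^ 'm"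
  have hr: "fst (h \<kappa>) < r" for \<kappa> using bij_betwE[OF h] by (auto simp: mem_Times_iff)
  have aI: "a \<in> I" using ab by simp
  have ini_iv: "ini r y = (\<Sum>\<kappa>\<in>UNIV. cmod (iv y $ \<kappa>))" for y
  proof -
    have "ini r y = (\<Sum>(j, i)\<in>{..<r} \<times> UNIV. cmod (D j (\<lambda>t. y t $ i) a))"
      by (simp add: ini_def sum.cartesian_product)
    also have "\<dots> = (\<Sum>\<kappa>\<in>UNIV. cmod (iv y $ \<kappa>))"
      by (simp add: sum.reindex_bij_betw[OF h, symmetric] iv_def split_beta)
    finally show ?thesis .
  qed
  have iv_diff: "iv (\<lambda>t. y t - w t) = iv y - iv w" if "y \<in> ?V" "w \<in> ?V" for y w
  proof -
    have "D (fst (h \<kappa>)) (\<lambda>t. y t $ snd (h \<kappa>) - w t $ snd (h \<kappa>)) a =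
        D (fst (h \<kappa>)) (\<lambda>t. y t $ snd (h \<kappa>)) a - D (fst (h \<kappa>)) (\<lambda>t. w t $ snd (h \<kappa>)) a" for \<kappa>
      by (rule Sob_diff(3)[OF vSobD[OF that(1)] vSobD[OF that(2)] _ aI]) (use hr[of \<kappa>] in simp)
    then show ?thesis by (simp add: iv_def vec_eq_iff)
  qed
  have iv_bound: "norm (iv y) \<le> real CARD('k) * (emb * ?N y)" if y: "y \<in> ?V" for y
  proof -
    have "norm (iv y) \<le> (\<Sum>\<kappa>\<in>UNIV. cmod (iv y $ \<kappa>))"
      unfolding norm_vec_def by (rule L2_set_le_sum) simp
    also have "\<dots> \<le> (\<Sum>\<kappa>\<in>(UNIV::'k set). emb * ?N y)"
    proof (rule sum_mono)
      fix \<kappa>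
      let ?j = "fst (h \<kappa>)" and ?y = "\<lambda>t. y t $ snd (h \<kappa>)"
      have l: "r - ?j \<in> {1..r}" "r - (r - ?j) = ?j" using hr[of \<kappa>] by auto
      note lo = nderiv_lower[OF vSobD[OF y] l(1), unfolded l(2)]
      have "cmod (D ?j ?y a) \<le> emb * SN (Suc n) (D ?j ?y)" by (rule Sob_sup_bound[OF lo(1) aI])
      also have "\<dots> \<le> emb * ?N y"
        using order_trans[OF lo(2) Sob_norm_le_vSob_norm] emb_pos by (intro mult_left_mono) auto
      finally show "cmod (iv y $ \<kappa>) \<le> emb * ?N y" by (simp add: iv_def)
    qed
    finally show ?thesis by simp
  qed
  have "bounded (range (\<lambda>k. iv (u k)))"
    unfolding bounded_iff using iv_bound[OF u(1)] u(2) by auto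
  then obtain l s where s: "strict_mono s" and ivlim: "((\<lambda>k. iv (u k)) \<circ> s) \<longlonglongrightarrow> l"
    using bounded_imp_convergent_subsequence by blast
  obtain CA where CA: "CA \<ge> 0" "\<And>y. y \<in> ?V \<Longrightarrow> ?N y \<le> CA * (ini r y + ?L \<mu>0 y)"
    using apriori[OF r A] by blast
  \<comment> \<open>The a priori estimate for a difference: once the Cauchy data converge along a
    subsequence and the residuals tend to 0, the functions are Cauchy in the full norm.\<close>
  have key: "?N (\<lambda>t. u i t - u j t) \<le> CA * (real CARD('k) * dist (iv (u i)) (iv (u j)) + (?L \<mu>0 (u i) + ?L \<mu>0 (u j)))"
    for i j
  proof -
    have "ini r (\<lambda>t. u i t - u j t) \<le> (\<Sum>\<kappa>\<in>(UNIV::'k set). dist (iv (u i)) (iv (u j)))"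
      unfolding ini_iv iv_diff[OF u(1) u(1)] dist_norm by (intro sum_mono Finite_Cartesian_Product.norm_nth_le)
    moreover have "?L \<mu>0 (\<lambda>t. u i t - u j t) \<le> ?L \<mu>0 (u i) + ?L \<mu>0 (u j)" by (rule LN_diff[OF A u(1) u(1)])
    ultimately have "CA * (ini r (\<lambda>t. u i t - u j t) + ?L \<mu>0 (\<lambda>t. u i t - u j t)) \<le>
       CA * (real CARD('k) * dist (iv (u i)) (iv (u j)) + (?L \<mu>0 (u i) + ?L \<mu>0 (u j)))"
      using CA(1) by (intro mult_left_mono add_mono) auto
    then show ?thesis using CA(2)[OF vSob_diff(1)[OF u(1) u(1)], of i j] by linarith
  qed
  have "\<exists>w\<in>?V. (\<lambda>k. ?N (\<lambda>t. u (s k) t - w t)) \<longlonglongrightarrow> 0"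
  proof (rule vSob_complete[OF u(1)])
    fix e :: real assume e: "0 < e"
    \<comment> \<open>\<open>CA\<close> may be 0, and the error shares below divide by this
      constant.\<close>
    define c where "c = CA + 1"
    have c: "0 < c" "CA \<le> c" using CA(1) by (auto simp: c_def)
    define e1 where "e1 = e / (2 * c * (real CARD('k) + 1))"
    define e2 where "e2 = e / (4 * c)"
    have e12: "0 < e1" "0 < e2" using e c by (simp_all add: e1_def e2_def)
    have "Cauchy ((\<lambda>k. iv (u k)) \<circ> s)" using ivlim by (rule LIMSEQ_imp_Cauchy)
    then obtain M1 where M1: "\<And>i j. i \<ge> M1 \<Longrightarrow> j \<ge> M1 \<Longrightarrow> dist (iv (u (s i))) (iv (u (s j))) < e1"
      using e12(1) unfolding Cauchy_def comp_def by meson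
    obtain M2 where M2: "\<And>i. i \<ge> M2 \<Longrightarrow> ?L \<mu>0 (u i) < e2"
      using order_tendstoD(2)[OF L0lim e12(2)] by (auto simp: eventually_sequentially)
    have "?N (\<lambda>t. u (s i) t - u (s j) t) \<le> e" if "i \<ge> max M1 M2" "j \<ge> max M1 M2" for i j
    proof -
      have "s i \<ge> M2" "s j \<ge> M2" using seq_suble[OF s, of i] seq_suble[OF s, of j] that by linarith+
      then have L: "?L \<mu>0 (u (s i)) + ?L \<mu>0 (u (s j)) \<le> 2 * e2" using M2[of "s i"] M2[of "s j"] by linarith
      have "real CARD('k) * dist (iv (u (s i))) (iv (u (s j))) \<le> (real CARD('k) + 1) * e1"
        using M1[of i j] that e12 by (intro mult_mono) auto
      with L have "CA * (real CARD('k) * dist (iv (u (s i))) (iv (u (s j))) + (?L \<mu>0 (u (s i)) + ?L \<mu>0 (u (s j))))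
          \<le> c * ((real CARD('k) + 1) * e1 + 2 * e2)"
        using c LN_nonneg by (intro mult_mono[OF c(2)] add_mono) (auto intro!: add_nonneg_nonneg)
      also have "\<dots> = c * ((real CARD('k) + 1) * e1) + c * (2 * e2)" by (rule distrib_left)
      also have "c * ((real CARD('k) + 1) * e1) = e / 2"
      proof -
        have "0 < real CARD('k) + 1" by (simp add: add_nonneg_pos)
        moreover have "x * (y * (e / (2 * x * y))) = e / 2" if "0 < x" "0 < y" for x y :: real using that by simp
        ultimately show ?thesis using c(1) unfolding e1_def by blast
      qed
      also have "c * (2 * e2) = e / 2" using c(1) by (simp add: e2_def)
      finally show ?thesis using key[of "s i" "s j"] by simp
    qed
    then show "\<exists>K. \<forall>i\<ge>K. \<forall>j\<ge>K. ?N (\<lambda>t. u (s i) t - u (s j) t) \<le> e" by blast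
  qed
  then obtain w where w: "w \<in> ?V" and wlim: "(\<lambda>k. ?N (\<lambda>t. u (s k) t - w t)) \<longlonglongrightarrow> 0" by blast
  define \<nu> where "\<nu> k = ?N (\<lambda>t. u (s k) t - w t)" for k
  have \<nu>lim: "\<nu> \<longlonglongrightarrow> 0" using wlim unfolding \<nu>_def[abs_def] .
  obtain CL where CL: "\<And>y. y \<in> ?V \<Longrightarrow> ?L \<mu>0 y \<le> CL * ?N y"
    by (rule LN_bounded[OF A[of \<mu>0]]) blast
  have "?L \<mu>0 w \<le> 0"
  proof (rule LIMSEQ_le_const)
    have "(\<lambda>k. ?L \<mu>0 (u (s k)) + CL * \<nu> k) \<longlonglongrightarrow> 0 + CL * 0"
      using LIMSEQ_subseq_LIMSEQ[OF L0lim s] by (intro tendsto_intros \<nu>lim) (simp add: comp_def)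
    then show "(\<lambda>k. ?L \<mu>0 (u (s k)) + CL * \<nu> k) \<longlonglongrightarrow> 0" by simp
    have "?L \<mu>0 w \<le> ?L \<mu>0 (u (s k)) + CL * \<nu> k" for k
    proof -
      have "?L \<mu>0 (\<lambda>t. u (s k) t - (u (s k) t - w t)) \<le> ?L \<mu>0 (u (s k)) + ?L \<mu>0 (\<lambda>t. u (s k) t - w t)"
        by (rule LN_diff[OF A u(1) vSob_diff(1)[OF u(1) w]])
      then show ?thesis using CL[OF vSob_diff(1)[OF u(1) w], of "s k"] by (simp add: \<nu>_def)
    qed
    then show "\<exists>K. \<forall>k\<ge>K. ?L \<mu>0 w \<le> ?L \<mu>0 (u (s k)) + CL * \<nu> k" by blast
  qed
  then have Lw: "?L \<mu>0 w = 0" using LN_nonneg by (rule antisym)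
  \<comment> \<open>The operators move while \<open>w\<close> is fixed: B(\<mu>) w is compared with
    B(\<mu>) u, which is small by construction, and the uniform bound \<open>CB\<close> controls the
    difference.\<close>
  have "norm (B \<mu>0 w) \<le> 0"
  proof (rule LIMSEQ_le[OF tendsto_norm])
    show "(\<lambda>k. B (\<mu> (s k)) w) \<longlonglongrightarrow> B \<mu>0 w"
      using LIMSEQ_subseq_LIMSEQ[OF isCont_seq[OF \<mu>(1) limB[OF w]] s] by (simp add: comp_def)
    have "(\<lambda>k. 1 / real (Suc (s k)) + CB * \<nu> k) \<longlonglongrightarrow> 0 + CB * 0"
      using LIMSEQ_subseq_LIMSEQ[OF inv0 s] by (intro tendsto_intros \<nu>lim) (simp add: comp_def)
    then show "(\<lambda>k. 1 / real (Suc (s k)) + CB * \<nu> k) \<longlonglongrightarrow> 0" by simp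
    have "norm (B (\<mu> (s k)) w) \<le> 1 / real (Suc (s k)) + CB * \<nu> k" for k
    proof -
      have "norm (B (\<mu> (s k)) w) \<le> norm (B (\<mu> (s k)) (u (s k))) + norm (B (\<mu> (s k)) (u (s k)) - B (\<mu> (s k)) w)"
        using norm_triangle_sub[of "B (\<mu> (s k)) w" "B (\<mu> (s k)) (u (s k))"] by (simp add: norm_minus_commute)
      also have "norm (B (\<mu> (s k)) (u (s k)) - B (\<mu> (s k)) w) \<le> CB * \<nu> k"
        using CB(3)[OF \<mu>(2) vSob_diff(1)[OF u(1) w], of "s k" "s k"] cont_linear_op_diff[OF B u(1) w]
        by (simp add: \<nu>_def)
      finally show ?thesis using Bu[of "s k"] by linarith
    qed
    then show "\<exists>K. \<forall>k\<ge>K. norm (B (\<mu> (s k)) w) \<le> 1 / real (Suc (s k)) + CB * \<nu> k" by blast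
  qed
  then have "B \<mu>0 w = 0" by simp
  from uniq[OF w Lw this] have Nw: "?N w = 0" .
  \<comment> \<open>The norm of \<open>u\<close> is 1 and that of \<open>w\<close> is 0, so their
    distance cannot fall below 1, although it tends to 0.\<close>
  have "1 \<le> \<nu> k" for k
    using vSob_norm_triangle[OF u(1)[of "s k"] w vSob_zero(1)] u(2)[of "s k"] Nw by (simp add: \<nu>_def)
  then have "1 \<le> (0::real)" using LIMSEQ_le_const[OF \<nu>lim] by blast
  then show False by simp
qed

end

theorem theorem5:
  fixes a b :: real and n r :: nat and p :: ereal
    and \<mu>0 :: "'mu::metric_space"
    and A :: "nat \<Rightarrow> 'mu \<Rightarrow> real \<Rightarrow> complex ^ 'm::finite ^ 'm"
    and B :: "'mu \<Rightarrow> (real \<Rightarrow> complex ^ 'm) \<Rightarrow> complex ^ 'k::finite"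
  assumes "a < b" and "r \<ge> 1" and "1 \<le> p"
    and dim: "CARD('k) = r * CARD('m)"
    and A_Sob: "\<And>\<mu> l. l \<in> {1..r} \<Longrightarrow> A (r - l) \<mu> \<in> mSob a b n p"
    and B_cont: "\<And>\<mu>. cont_linear_op a b (n + r) p (B \<mu>)"
    and cond_0: "\<And>y. is_solution a b n r p (\<lambda>j. A j \<mu>0) (B \<mu>0) (\<lambda>t. 0) 0 y \<Longrightarrow>
                   \<forall>t\<in>{a..b}. y t = 0"
    and cond_I: "\<And>l. l \<in> {1..r} \<Longrightarrow>
        ((\<lambda>\<mu>. mSob_norm a b n p (\<lambda>t. A (r - l) \<mu> t - A (r - l) \<mu>0 t)) \<longlongrightarrow> 0) (at \<mu>0)"
    and cond_II: "\<And>y. y \<in> vSob a b (n + r) p \<Longrightarrow> ((\<lambda>\<mu>. B \<mu> y) \<longlongrightarrow> B \<mu>0 y) (at \<mu>0)"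
  shows "\<exists>\<epsilon>>0. \<exists>\<gamma>1>0. \<exists>\<gamma>2>0.
     \<forall>(f :: 'mu \<Rightarrow> real \<Rightarrow> complex ^ 'm) (c :: 'mu \<Rightarrow> complex ^ 'k) (y :: 'mu \<Rightarrow> real \<Rightarrow> complex ^ 'm).
     \<forall>\<mu>\<in>ball \<mu>0 \<epsilon>.
       f \<mu>0 \<in> vSob a b n p \<and> f \<mu> \<in> vSob a b n p \<and>
       is_solution a b n r p (\<lambda>j. A j \<mu>0) (B \<mu>0) (f \<mu>0) (c \<mu>0) (y \<mu>0) \<and>
       is_solution a b n r p (\<lambda>j. A j \<mu>) (B \<mu>) (f \<mu>) (c \<mu>) (y \<mu>) \<longrightarrow>
       (let d = vSob_norm a b n p (\<lambda>t. diff_op a b r (\<lambda>j. A j \<mu>) (y \<mu>0) t - f \<mu> t)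
                + norm (B \<mu> (y \<mu>0) - c \<mu>)
        in \<gamma>1 * d \<le> vSob_norm a b (n + r) p (\<lambda>t. y \<mu>0 t - y \<mu> t) \<and>
           vSob_norm a b (n + r) p (\<lambda>t. y \<mu>0 t - y \<mu> t) \<le> \<gamma>2 * d)"
proof -
  interpret lp_interval a b p by unfold_locales fact+
  let ?V = "vSob a b (n + r) p :: (real \<Rightarrow> complex ^ 'm) set"
  let ?N = "vSob_norm a b (n + r) p :: (real \<Rightarrow> complex ^ 'm) \<Rightarrow> real"
  let ?L = "\<lambda>\<mu>. LN n r (\<lambda>j. A j \<mu>)"
  let ?\<kappa> = "\<lambda>\<mu>. MN n r (\<lambda>j t. A j \<mu> t - A j \<mu>0 t)"
  have A: "\<forall>l\<in>{1..r}. A (r - l) \<mu> \<in> mSob a b n p" for \<mu> using A_Sob by blast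
  have limA: "(?\<kappa> \<longlongrightarrow> 0) (at \<mu>0)"
    unfolding MN_def using tendsto_sum[OF cond_I, of "{1..r}" "\<lambda>l. l"] by simp
  \<comment> \<open>Uniqueness of solutions speaks of values on the interval, and these are all that
    the norm sees.\<close>
  have uniq: "?N y = 0" if y: "y \<in> ?V" "?L \<mu>0 y = 0" "B \<mu>0 y = 0" for y
  proof -
    have "is_solution a b n r p (\<lambda>j. A j \<mu>0) (B \<mu>0) (\<lambda>t. 0) 0 y"
      unfolding is_solution_def using y LN_eq_0_solution[OF A \<open>r \<ge> 1\<close> y(1,2)] by simp
    from cond_0[OF this] have "\<forall>t\<in>I. y t = 0" .
    then have "SN (n + r) (\<lambda>t. y t $ i) = SN (n + r) (\<lambda>t. 0)" for i by (intro Sob_cong(1)) simp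
    then show ?thesis by (simp add: vSob_norm_def Sob_zero)
  qed
  obtain \<epsilon>1 C1 where C1: "0 < \<epsilon>1" "0 < C1" "\<And>\<mu> y. \<mu> \<in> ball \<mu>0 \<epsilon>1 \<Longrightarrow> y \<in> ?V \<Longrightarrow> ?N y \<le> C1 * (?L \<mu> y + norm (B \<mu> y))"
    using inverse_estimate[OF \<open>r \<ge> 1\<close> dim A B_cont uniq limA cond_II] by blast
  obtain \<epsilon>2 C2 where C2: "0 < \<epsilon>2" "0 \<le> C2" "\<And>\<mu> y. \<mu> \<in> ball \<mu>0 \<epsilon>2 \<Longrightarrow> y \<in> ?V \<Longrightarrow> norm (B \<mu> y) \<le> C2 * ?N y"
    using boundary_uniformly_bounded[OF B_cont cond_II] by blast
  obtain C3 where C3: "0 \<le> C3" "\<And>y. y \<in> ?V \<Longrightarrow> ?L \<mu>0 y \<le> C3 * ?N y"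
    by (rule LN_bounded[OF A[of \<mu>0]]) blast
  obtain C4 where C4: "C4 \<ge> 0" "\<And>A A' y. \<lbrakk>\<forall>l\<in>{1..r}. A (r - l) \<in> mSob a b n p; \<forall>l\<in>{1..r}. A' (r - l) \<in> mSob a b n p;
      y \<in> ?V\<rbrakk> \<Longrightarrow> LN n r A y \<le> LN n r A' y + C4 * MN n r (\<lambda>j t. A j t - A' j t) * ?N y"
    using LN_perturb[of r n, where 'm = 'm] by blast
  \<comment> \<open>The limit says nothing about the centre of the ball, where the coefficient
    difference is zero anyway.\<close>
  obtain \<epsilon>3 where \<epsilon>3: "0 < \<epsilon>3" "\<And>\<mu>. \<mu> \<in> ball \<mu>0 \<epsilon>3 \<Longrightarrow> ?\<kappa> \<mu> \<le> 1"
  proof -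
    obtain d where d: "0 < d" "\<And>\<mu>. \<mu> \<noteq> \<mu>0 \<Longrightarrow> dist \<mu> \<mu>0 < d \<Longrightarrow> ?\<kappa> \<mu> < 1"
      using order_tendstoD(2)[OF limA, of 1] by (auto simp: eventually_at)
    have "?\<kappa> \<mu>0 = 0" by (simp add: MN_def mSob_norm_def Sob_zero)
    then have "?\<kappa> \<mu> \<le> 1" if "\<mu> \<in> ball \<mu>0 d" for \<mu>
      using d(2)[of \<mu>] that by (cases "\<mu> = \<mu>0") (auto simp: dist_commute)
    then show ?thesis using that d(1) by blast
  qed
  \<comment> \<open>\<open>C3\<close> bounds the unperturbed operator, \<open>C4\<close> its
    perturbation where the coefficients are at distance at most 1, \<open>C2\<close> the boundary
    operators; the added 1 makes 1 / T a legitimate lower constant.\<close>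
  define T where "T = C3 + C4 + C2 + 1"
  have T: "0 < T" using C2(2) C3(1) C4(1) by (simp add: T_def)
  have upper: "?L \<mu> w + norm (B \<mu> w) \<le> T * ?N w" if "\<mu> \<in> ball \<mu>0 \<epsilon>2" "\<mu> \<in> ball \<mu>0 \<epsilon>3" "w \<in> ?V" for \<mu> w
  proof -
    have "C4 * ?\<kappa> \<mu> * ?N w \<le> C4 * 1 * ?N w"
      using C4(1) \<epsilon>3(2)[OF that(2)] vSob_norm_nonneg by (intro mult_right_mono mult_left_mono) auto
    then have "?L \<mu> w + norm (B \<mu> w) \<le> C3 * ?N w + C4 * ?N w + C2 * ?N w"
      using C4(2)[OF A[of \<mu>] A[of \<mu>0] that(3)] C3(2)[OF that(3)] C2(3)[OF that(1,3)] by linarith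
    also have "\<dots> \<le> T * ?N w" using vSob_norm_nonneg[of "n + r" w] by (simp add: T_def algebra_simps)
    finally show ?thesis .
  qed
  have goal: "1 / T * d \<le> ?N (\<lambda>t. y \<mu>0 t - y \<mu> t) \<and> ?N (\<lambda>t. y \<mu>0 t - y \<mu> t) \<le> C1 * d"
    if \<mu>: "\<mu> \<in> ball \<mu>0 (min \<epsilon>1 (min \<epsilon>2 \<epsilon>3))" and f: "f \<mu> \<in> vSob a b n p"
      and s0: "is_solution a b n r p (\<lambda>j. A j \<mu>0) (B \<mu>0) (f \<mu>0) (c \<mu>0) (y \<mu>0)"
      and s1: "is_solution a b n r p (\<lambda>j. A j \<mu>) (B \<mu>) (f \<mu>) (c \<mu>) (y \<mu>)"
      and d: "d = vSob_norm a b n p (\<lambda>t. diff_op a b r (\<lambda>j. A j \<mu>) (y \<mu>0) t - f \<mu> t) + norm (B \<mu> (y \<mu>0) - c \<mu>)"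
    for f :: "'mu \<Rightarrow> real \<Rightarrow> complex ^ 'm" and c :: "'mu \<Rightarrow> complex ^ 'k" and y \<mu> d
  proof -
    have y: "y \<mu>0 \<in> ?V" "y \<mu> \<in> ?V" and Bc: "B \<mu> (y \<mu>) = c \<mu>"
      and eqn: "if n \<ge> 1 then \<forall>t\<in>{a<..<b}. diff_op a b r (\<lambda>j. A j \<mu>) (y \<mu>) t = f \<mu> t
        else AE t in lebesgue_on {a<..<b}. diff_op a b r (\<lambda>j. A j \<mu>) (y \<mu>) t = f \<mu> t"
      using s0 s1 unfolding is_solution_def by blast+
    let ?w = "\<lambda>t. y \<mu>0 t - y \<mu> t"
    have w: "?w \<in> ?V" by (rule vSob_diff(1)[OF y])
    \<comment> \<open>The right-hand sides disappear from the discrepancy, which now depends on the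
      difference of the solutions alone; this gives uniformity in all right-hand sides.\<close>
    have d': "d = ?L \<mu> ?w + norm (B \<mu> ?w)"
      unfolding d residual_norm[OF A \<open>r \<ge> 1\<close> y f eqn] cont_linear_op_diff[OF B_cont y] Bc ..
    have \<mu>s: "\<mu> \<in> ball \<mu>0 \<epsilon>1" "\<mu> \<in> ball \<mu>0 \<epsilon>2" "\<mu> \<in> ball \<mu>0 \<epsilon>3" using \<mu> by auto
    have "d \<le> T * ?N ?w" unfolding d' by (rule upper[OF \<mu>s(2,3) w])
    then have "1 / T * d \<le> ?N ?w" using T by (simp add: field_simps)
    moreover have "?N ?w \<le> C1 * d" unfolding d' by (rule C1(3)[OF \<mu>s(1) w])
    ultimately show ?thesis by blast
  qed
  have pos: "0 < min \<epsilon>1 (min \<epsilon>2 \<epsilon>3)" "0 < 1 / T" using C1(1) C2(1) \<epsilon>3(1) T by simp_all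
  show ?thesis
    unfolding Let_def
    by (rule exI, rule conjI[OF pos(1)], rule exI, rule conjI[OF pos(2)], rule exI, rule conjI[OF C1(2)],
        intro allI ballI impI, elim conjE, rule goal[OF _ _ _ _ refl])
qed

end
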